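(* For any fixed positive integers $i,j$, there is an algorithm that, given a $K_{i,j}$-free graph $G$ on $n$ vertices and a positive integer $k$, decides whether $G$ admits a Grundy coloring using at least $k$ colors in time $g(k)\cdot n^{\mathcal{O}(1)}$ for some computable function $g$ (depending on $i,j$); i.e., Grundy Coloring on $K_{i,j}$-free graphs is fixed-parameter tractable parameterized by $k$.
   Context: A graph is $K_{i,j}$-free if it has no subgraph (not necessarily induced) isomorphic to the complete bipartite graph $K_{i,j}$. A Grundy coloring of $G$ using $k'$ colors is a proper coloring $c:V(G)\to[k']$ with every color used such that every vertex $v$ with $c(v)=t$ has, for every $s\in[t-1]$, a neighbor $u$ with $c(u)=s$ (equivalently, a coloring produced by the first-fit greedy algorithm for some vertex ordering). "Using at least $k$ colors" means for some $k'\ge k$. *)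

theory Defs
  imports "Graph_Theory.Kuratowski"
begin

section \<open>Graphs and Grundy colorings\<close>

definition biclique_free :: "nat \<Rightarrow> nat \<Rightarrow> 'a pair_pre_digraph \<Rightarrow> bool" where
  "biclique_free i j G \<longleftrightarrow> \<not> (\<exists>H. subgraph H (with_proj G) \<and> K\<^bsub>i,j\<^esub> H)"

definition proper_coloring :: "'a pair_pre_digraph \<Rightarrow> ('a \<Rightarrow> nat) \<Rightarrow> bool" where
  "proper_coloring G c \<longleftrightarrow> (\<forall>(u, v) \<in> parcs G. c u \<noteq> c v)"

definition grundy_coloring :: "'a pair_pre_digraph \<Rightarrow> nat \<Rightarrow> ('a \<Rightarrow> nat) \<Rightarrow> bool" where
  "grundy_coloring G k c \<longleftrightarrow>
     c ` pverts G = {1..k} \<and>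
     proper_coloring G c \<and>
     (\<forall>v \<in> pverts G. \<forall>s \<in> {1..<c v}. \<exists>u \<in> pverts G. (v, u) \<in> parcs G \<and> c u = s)"

definition grundy_at_least :: "'a pair_pre_digraph \<Rightarrow> nat \<Rightarrow> bool" where
  "grundy_at_least G k \<longleftrightarrow> (\<exists>k' \<ge> k. \<exists>c. grundy_coloring G k' c)"


section \<open>Random access machines\<close>

text \<open>
  The machine model is the unit-cost RAM with addition and (truncated) subtraction, without
  multiplication, presented with structured control flow instead of jumps. Apart from
  the constants of the program, an instruction increases the bit length of the largest number stored
  by at most one, so running time in this model
  agrees with Turing machine time up to a polynomial, and the class FPT is the usual one.

  A state consists of the registers, of which a program mentions finitely many, and of an
  unbounded memory that is accessed indirectly through addresses held in registers.
\<close>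

type_synonym reg = nat

type_synonym state = "(reg \<Rightarrow> nat) \<times> (nat \<Rightarrow> nat)"

datatype prog =
    SKIP
  | LIT reg nat            (* x := a *)
  | ADD reg reg reg        (* x := y + z *)
  | SUB reg reg reg        (* x := y - z, truncated at 0 *)
  | LOAD reg reg           (* x := M[y] *)
  | STORE reg reg          (* M[x] := y *)
  | SEQ prog prog
  | IFNZ reg prog prog     (* if x > 0 then p else q *)
  | WHILENZ reg prog       (* while x > 0 do p *)

text \<open>
  \<open>exec p s t s'\<close>: program \<open>p\<close> started in state \<open>s\<close> halts after exactly \<open>t\<close> steps in state \<open>s'\<close>.
  Every elementary instruction and every evaluation of a branch or loop condition is one step.
\<close>

inductive exec :: "prog \<Rightarrow> state \<Rightarrow> nat \<Rightarrow> state \<Rightarrow> bool" where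
  Skip:  "exec SKIP s 1 s"
| Lit: "exec (LIT x a) (r, m) 1 (r(x := a), m)"
| Add:   "exec (ADD x y z) (r, m) 1 (r(x := r y + r z), m)"
| Sub:   "exec (SUB x y z) (r, m) 1 (r(x := r y - r z), m)"
| Load:  "exec (LOAD x y) (r, m) 1 (r(x := m (r y)), m)"
| Store: "exec (STORE x y) (r, m) 1 (r, m(r x := r y))"
| Seq:   "exec p s t s' \<Longrightarrow> exec q s' t' s'' \<Longrightarrow> exec (SEQ p q) s (t + t') s''"
| IfT:   "fst s x > 0 \<Longrightarrow> exec p s t s' \<Longrightarrow> exec (IFNZ x p q) s (t + 1) s'"
| IfF:   "fst s x = 0 \<Longrightarrow> exec q s t s' \<Longrightarrow> exec (IFNZ x p q) s (t + 1) s'"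
| LoopF: "fst s x = 0 \<Longrightarrow> exec (WHILENZ x p) s 1 s"
| LoopT: "fst s x > 0 \<Longrightarrow> exec p s t s' \<Longrightarrow> exec (WHILENZ x p) s' t' s'' \<Longrightarrow>
            exec (WHILENZ x p) s (t + t' + 1) s''"

lemma exec_deterministic:
  "exec p s t s' \<Longrightarrow> exec p s u s'' \<Longrightarrow> u = t \<and> s'' = s'"
proof (induction arbitrary: u s'' rule: exec.induct)
  case Skip
  from Skip.prems show ?case by cases auto
next
  case Lit
  from Lit.prems show ?case by cases auto
next
  case Add
  from Add.prems show ?case by cases auto
next
  case Sub
  from Sub.prems show ?case by cases auto
next
  case Load
  from Load.prems show ?case by cases auto
next
  case Store
  from Store.prems show ?case by cases auto
next
  case (Seq p s t s' q t' s2)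
  from Seq.prems obtain v v' s1 where "exec p s v s1" "exec q s1 v' s''" "u = v + v'"
    by cases blast
  then show ?case using Seq.IH(1)[of v s1] Seq.IH(2)[of v' s''] by simp
next
  case (IfT s x p t s' q)
  from IfT.prems IfT.hyps(1) obtain v where "exec p s v s''" "u = v + 1"
    by cases simp_all
  then show ?case using IfT.IH[of v s''] by simp
next
  case (IfF s x q t s' p)
  from IfF.prems IfF.hyps(1) obtain v where "exec q s v s''" "u = v + 1"
    by cases simp_all
  then show ?case using IfF.IH[of v s''] by simp
next
  case LoopF
  from LoopF.prems show ?case using LoopF.hyps by cases simp_all
next
  case (LoopT s x p t s' t' s2)
  from LoopT.prems LoopT.hyps(1) obtain v v' s1
    where "exec p s v s1" "exec (WHILENZ x p) s1 v' s''" "u = v + v' + 1"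
    by cases simp_all
  then show ?case using LoopT.IH(1)[of v s1] LoopT.IH(2)[of v' s''] by simp
qed

definition computable :: "(nat \<Rightarrow> nat) \<Rightarrow> bool" where
  "computable g \<longleftrightarrow>
     (\<exists>p. \<forall>k. \<exists>t r m. exec p ((\<lambda>_. 0)(0 := k), \<lambda>_. 0) t (r, m) \<and> r 0 = g k)"

text \<open>
  Input of a graph on the vertices \<open>0, \<dots>, n - 1\<close> together with a number \<open>k\<close>: register 0 holds \<open>n\<close>,
  register 1 holds \<open>k\<close>, and the first \<open>n * n\<close> memory cells hold the adjacency matrix row by row.
\<close>

definition graph_input :: "nat \<Rightarrow> nat pair_pre_digraph \<Rightarrow> nat \<Rightarrow> state" where
  "graph_input n G k =
     ((\<lambda>_. 0)(0 := n, 1 := k),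
      \<lambda>a. if a < n * n \<and> (a div n, a mod n) \<in> parcs G then 1 else 0)"

end

theory Submission
  imports Defs
begin

text \<open>
  A Grundy coloring with at least \<open>k\<close> colors exists iff some set of at most \<open>2 ^ (k - 1)\<close> colored vertices is
  properly colored and gives each of its members of color \<open>c\<close> neighbors of all smaller colors:
  first-fit extends such a witness to the whole graph. A witness for a vertex \<open>v\<close> of color \<open>c\<close> consists
  of \<open>v\<close> and of one witness for a neighbor of \<open>v\<close> of each smaller color.

  The algorithm keeps, for every vertex \<open>v\<close>, a pool: a vertex set of size bounded in terms of \<open>k\<close> inside
  which a witness for \<open>v\<close> can be chosen no matter which few other colored vertices it has to be
  compatible with. The pool of \<open>v\<close> is grown from \<open>{v}\<close> in \<open>2 ^ k * j + 1\<close> rounds. A round adds, for every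
  quantifier-free type over the current pool, one tuple of this type taken from the pool of another vertex,
  and then every vertex with at least \<open>j\<close> neighbors in the pool; as the graph has no \<open>K\<^bsub>i,j\<^esub>\<close>, the number of
  the latter is bounded. A tuple of the right type can only be spoiled by a vertex \<open>y\<close> outside the
  pool, through a new neighbor of \<open>y\<close>; after \<open>j\<close> such rounds \<open>y\<close> itself has entered the pool. Hence
  in one of the rounds the tuple is good.

  After \<open>k\<close> sweeps over all vertices it remains to try all colorings of each pool.
\<close>

section \<open>Witnesses and pools\<close>

text \<open>The obstacle is that witnesses for different neighbors of \<open>v\<close> may clash:
  they can give one vertex two colors, or adjacent vertices the same color. One stored witness per
  vertex is therefore not enough. A pool must offer a replacement against every context
  \<open>Y\<close> of other colored vertices, and \<open>Y\<close> is unknown while the pool is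
  built. A type over the pool controls clashes inside the pool but says nothing about the part of
  \<open>Y\<close> outside it; this is where the absorption of vertices with \<open>j\<close>
  neighbors is needed.

  Context and witness share a budget \<open>L\<close>. The subwitnesses of \<open>v\<close> are
  replaced one color at a time, the others serving as context, so all sizes together stay within
  \<open>card Y + 2 ^ (c - 1)\<close>. As subwitnesses have smaller colors, each sweep raises by one
  the color that the pools can handle. Each of at most \<open>L\<close> context vertices can spoil
  at most \<open>j\<close> rounds, hence \<open>j * L + 1\<close> rounds with
  \<open>L = 2 ^ k\<close>.

  One round enlarges a pool doubly exponentially, and the number of rounds depends on
  \<open>k\<close>; so the bound on the running time is an exponential tower whose height grows with
  \<open>k\<close>.\<close>

definition conflict_free :: "('v \<Rightarrow> 'v \<Rightarrow> bool) \<Rightarrow> ('v \<times> nat) set \<Rightarrow> ('v \<times> nat) set \<Rightarrow> bool" where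
  "conflict_free E A B \<longleftrightarrow>
     (\<forall>x c y d. (x, c) \<in> A \<longrightarrow> (y, d) \<in> B \<longrightarrow> (c = d \<longrightarrow> \<not> E x y) \<and> (c \<noteq> d \<longrightarrow> x \<noteq> y))"

text \<open>Partial colorings are relations, so that partial witnesses merge by plain union.
  \<open>conflict_free E W W\<close> says at once that the coloring is proper and that no vertex
  carries two colors.\<close>

definition grundy_set :: "('v \<Rightarrow> 'v \<Rightarrow> bool) \<Rightarrow> ('v \<times> nat) set \<Rightarrow> bool" where
  "grundy_set E W \<longleftrightarrow> conflict_free E W W \<and>
     (\<forall>x c. (x, c) \<in> W \<longrightarrow> 1 \<le> c \<and> (\<forall>s \<in> {1..<c}. \<exists>y. (y, s) \<in> W \<and> E x y))"

text \<open>Only the first \<open>L\<close> entries of a tuple count. Colors are absent from the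
  type because they are attached to the indices and travel with them; one type thus serves all
  colorings of a tuple.\<close>

definition same_type ::
  "('v \<Rightarrow> 'v \<Rightarrow> bool) \<Rightarrow> nat \<Rightarrow> 'v set \<Rightarrow> (nat \<Rightarrow> 'v) \<Rightarrow> (nat \<Rightarrow> 'v) \<Rightarrow> bool" where
  "same_type E L P X X' \<longleftrightarrow>
     (\<forall>l<L. (\<forall>z\<in>P. (X l = z \<longleftrightarrow> X' l = z) \<and> (E (X l) z \<longleftrightarrow> E (X' l) z)) \<and>
            (\<forall>l'<L. (X l = X l' \<longleftrightarrow> X' l = X' l') \<and> (E (X l) (X l') \<longleftrightarrow> E (X' l) (X' l'))))"

text \<open>\<open>Q\<close> is the pool between the two halves of a round. Counting neighbors in
  \<open>Q\<close> rather than in \<open>P\<close> lets the fresh tuple entries contribute at once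
  to the absorption of a vertex.\<close>

definition saturates ::
  "('v \<Rightarrow> 'v \<Rightarrow> bool) \<Rightarrow> nat \<Rightarrow> nat \<Rightarrow> 'v set \<Rightarrow> (nat \<Rightarrow> 'v) set \<Rightarrow> 'v set \<Rightarrow> 'v set \<Rightarrow> bool" where
  "saturates E L j V F P P' \<longleftrightarrow>
     (\<exists>Q. finite Q \<and> P \<subseteq> Q \<and> Q \<subseteq> P' \<and>
        (\<forall>X\<in>F. \<exists>X'. same_type E L P X X' \<and> (\<forall>l<L. X' l \<in> Q)) \<and>
        (\<forall>y\<in>V. j \<le> card {w \<in> Q. E y w} \<longrightarrow> y \<in> P'))"

lemma conflict_free_Un_left:
  "conflict_free E (A \<union> B) C \<longleftrightarrow> conflict_free E A C \<and> conflict_free E B C"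
  unfolding conflict_free_def by blast

lemma conflict_free_Un_right:
  "conflict_free E A (B \<union> C) \<longleftrightarrow> conflict_free E A B \<and> conflict_free E A C"
  unfolding conflict_free_def by blast

lemma conflict_free_mono:
  "conflict_free E A B \<Longrightarrow> A' \<subseteq> A \<Longrightarrow> B' \<subseteq> B \<Longrightarrow> conflict_free E A' B'"
  unfolding conflict_free_def by blast

lemma conflict_free_commute:
  assumes "symp E"
  shows "conflict_free E A B \<longleftrightarrow> conflict_free E B A"
  unfolding conflict_free_def using sympD[OF assms] by metis

lemma conflict_freeD:
  "conflict_free E A B \<Longrightarrow> (x, c) \<in> A \<Longrightarrow> (y, c) \<in> B \<Longrightarrow> \<not> E x y"
  "conflict_free E A B \<Longrightarrow> (x, c) \<in> A \<Longrightarrow> (x, d) \<in> B \<Longrightarrow> c = d"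
  unfolding conflict_free_def by auto

lemma grundy_set_Un:
  assumes "symp E" "grundy_set E A" "grundy_set E B" "conflict_free E A B"
  shows "grundy_set E (A \<union> B)"
proof -
  have "conflict_free E B A" using assms conflict_free_commute by blast
  then have "conflict_free E (A \<union> B) (A \<union> B)"
    using assms(2-4) unfolding grundy_set_def conflict_free_Un_left conflict_free_Un_right by blast
  moreover have "1 \<le> c \<and> (\<forall>s\<in>{1..<c}. \<exists>y. (y, s) \<in> A \<union> B \<and> E x y)" if "(x, c) \<in> A \<union> B" for x c
    using that assms(2,3) unfolding grundy_set_def by blast
  ultimately show ?thesis unfolding grundy_set_def by blast
qed

text \<open>All pieces are cut out of \<open>W\<close>, so no conflict can arise between them; the
  size solves T(c) = 1 + T(1) + ... + T(c - 1).\<close>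

lemma grundy_set_small:
  assumes "grundy_set E W" "(v, c) \<in> W"
  shows "\<exists>W' \<subseteq> W. finite W' \<and> grundy_set E W' \<and> (v, c) \<in> W' \<and> card W' \<le> 2 ^ (c - 1)"
  using assms(2)
proof (induction c arbitrary: v rule: less_induct)
  case (less c)
  have c: "1 \<le> c" and sup: "\<forall>s \<in> {1..<c}. \<exists>y. (y, s) \<in> W \<and> E v y"
    using assms(1) less.prems unfolding grundy_set_def by auto
  have "\<forall>s \<in> {1..<c}. \<exists>y W'. E v y \<and> W' \<subseteq> W \<and> finite W' \<and> grundy_set E W' \<and> (y, s) \<in> W' \<and>
      card W' \<le> 2 ^ (s - 1)"
    using sup less.IH by (metis atLeastLessThan_iff)
  then obtain y U where U: "\<And>s. s \<in> {1..<c} \<Longrightarrow> E v (y s) \<and> U s \<subseteq> W \<and> finite (U s) \<and>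
      grundy_set E (U s) \<and> (y s, s) \<in> U s \<and> card (U s) \<le> 2 ^ (s - 1)"
    by metis
  define W' where "W' = insert (v, c) (\<Union>s\<in>{1..<c}. U s)"
  have sub: "W' \<subseteq> W" unfolding W'_def using U less.prems by blast
  have fin: "finite W'" unfolding W'_def using U by blast
  have sum2: "(\<Sum>s\<in>{1..<c}. 2 ^ (s - 1)) + 1 = (2::nat) ^ (c - 1)" using c
  proof (induction c rule: dec_induct)
    case (step m)
    then show ?case by (cases m) (auto simp: atLeastLessThanSuc)
  qed simp
  have "card W' \<le> Suc (card (\<Union>s\<in>{1..<c}. U s))"
    unfolding W'_def by (simp add: card_insert_le_m1 card_insert_if U)
  also have "card (\<Union>s\<in>{1..<c}. U s) \<le> (\<Sum>s\<in>{1..<c}. card (U s))"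
    by (rule card_UN_le) simp
  also have "\<dots> \<le> (\<Sum>s\<in>{1..<c}. 2 ^ (s - 1))" by (rule sum_mono) (use U in blast)
  finally have card: "card W' \<le> 2 ^ (c - 1)" using sum2 by simp
  have "grundy_set E W'"
    unfolding grundy_set_def
  proof (intro conjI allI impI)
    show "conflict_free E W' W'"
      using assms(1) sub conflict_free_mono unfolding grundy_set_def by blast
    fix x d assume p: "(x, d) \<in> W'"
    then show "1 \<le> d" using assms(1) sub unfolding grundy_set_def by blast
    show "\<forall>s\<in>{1..<d}. \<exists>y. (y, s) \<in> W' \<and> E x y"
    proof (cases "(x, d) = (v, c)")
      case True
      have "\<exists>y. (y, s) \<in> W' \<and> E v y" if "s \<in> {1..<c}" for s
        using U[OF that] that unfolding W'_def by blast
      then show ?thesis using True c by simp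
    next
      case False
      then obtain s where s: "s \<in> {1..<c}" "(x, d) \<in> U s" using p unfolding W'_def by auto
      have "grundy_set E (U s)" using U s by blast
      then have "\<forall>t\<in>{1..<d}. \<exists>y. (y, t) \<in> U s \<and> E x y"
        using s(2) unfolding grundy_set_def by blast
      moreover have "U s \<subseteq> W'" using s(1) unfolding W'_def by blast
      ultimately show ?thesis by blast
    qed
  qed
  then show ?case using sub fin card unfolding W'_def by blast
qed

definition colored_tuple :: "nat \<Rightarrow> (nat \<Rightarrow> nat) \<Rightarrow> (nat \<Rightarrow> 'v) \<Rightarrow> ('v \<times> nat) set" where
  "colored_tuple L h X = (\<lambda>l. (X l, h l)) ` {..<L}"

text \<open>Properness and support speak only of equalities and edges between entries; these belong
  to the type, and colors stay with their indices.\<close>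

lemma same_type_grundy_set:
  assumes "same_type E L P X X'" "grundy_set E (colored_tuple L h X)"
  shows "grundy_set E (colored_tuple L h X')"
proof -
  have eq: "X l = X l' \<longleftrightarrow> X' l = X' l'" "E (X l) (X l') \<longleftrightarrow> E (X' l) (X' l')" if "l < L" "l' < L" for l l'
    using assms(1) that unfolding same_type_def by blast+
  have mem: "(x, c) \<in> colored_tuple L h Z \<longleftrightarrow> (\<exists>l<L. x = Z l \<and> c = h l)" for x c Z
    unfolding colored_tuple_def by auto
  show ?thesis
    unfolding grundy_set_def
  proof (intro conjI allI impI ballI)
    show "conflict_free E (colored_tuple L h X') (colored_tuple L h X')"
      unfolding conflict_free_def mem
    proof (intro allI impI; elim exE conjE)
      fix x c y d l l' assume *: "l < L" "x = X' l" "c = h l" "l' < L" "y = X' l'" "d = h l'"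
      have "(X l, c) \<in> colored_tuple L h X" "(X l', d) \<in> colored_tuple L h X" using * unfolding mem by blast+
      then have "(c = d \<longrightarrow> \<not> E (X l) (X l')) \<and> (c \<noteq> d \<longrightarrow> X l \<noteq> X l')"
        using assms(2) unfolding grundy_set_def conflict_free_def by blast
      then show "(c = d \<longrightarrow> \<not> E x y) \<and> (c \<noteq> d \<longrightarrow> x \<noteq> y)" using eq * by blast
    qed
    fix x c assume "(x, c) \<in> colored_tuple L h X'"
    then obtain l where l: "l < L" "x = X' l" "c = h l" unfolding mem by blast
    then have "(X l, c) \<in> colored_tuple L h X" unfolding mem by blast
    then have *: "1 \<le> c" "\<And>s. s \<in> {1..<c} \<Longrightarrow> \<exists>y. (y, s) \<in> colored_tuple L h X \<and> E (X l) y"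
      using assms(2) unfolding grundy_set_def by blast+
    show "1 \<le> c" by fact
    show "\<exists>y. (y, s) \<in> colored_tuple L h X' \<and> E x y" if "s \<in> {1..<c}" for s
      using *(2)[OF that] eq(2) l unfolding mem by blast
  qed
qed

text \<open>
  Over a pool \<open>P r\<close>, a tuple of the same type can conflict with \<open>Y\<close> only at a vertex of \<open>Y\<close> outside
  \<open>P r\<close>, through an entry outside \<open>P r\<close>. A vertex of \<open>Y\<close> causing this in \<open>j\<close> different rounds has \<open>j\<close>
  neighbors in the pool and is then itself absorbed, after which it causes no more conflicts.
\<close>
lemma exchange:
  fixes E :: "'v \<Rightarrow> 'v \<Rightarrow> bool"
  assumes sym: "symp E" and j: "0 < j"
    and sat: "\<And>r. r < R \<Longrightarrow> saturates E L j V F (P r) (P (Suc r))"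
    and Y: "finite Y" "fst ` Y \<subseteq> V" "card Y * j < R"
    and X: "X \<in> F" "conflict_free E (colored_tuple L h X) Y"
  shows "\<exists>X'. same_type E L (P 0) X X' \<and> (\<forall>l<L. X' l \<in> P R) \<and> conflict_free E (colored_tuple L h X') Y"
proof (rule ccontr)
  assume no: "\<not> ?thesis"
  have P_step: "P r \<subseteq> P (Suc r)" if "r < R" for r
    using sat[OF that] unfolding saturates_def by blast
  have P_mono: "P r \<subseteq> P r'" if "r \<le> r'" "r' \<le> R" for r r'
    using that
  proof (induction rule: dec_induct)
    case (step r')
    then show ?case using P_step[of r'] by simp
  qed simp
  \<comment> \<open>The set \<open>Q\<close> of the round is stored along with the blame, because
    the final contradiction counts neighbors in the \<open>Q\<close> of the last relevant
    round.\<close>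
  define absorbed where "absorbed r x y \<longleftrightarrow> E y x \<and> x \<notin> P r \<and>
      (\<exists>Q. finite Q \<and> Q \<subseteq> P (Suc r) \<and> P r \<subseteq> Q \<and> x \<in> Q \<and>
           (\<forall>y\<in>V. j \<le> card {w \<in> Q. E y w} \<longrightarrow> y \<in> P (Suc r)))" for r x y
  \<comment> \<open>A failing round blames a vertex \<open>y\<close> of \<open>Y\<close>. It lies
    outside \<open>P r\<close>, because over \<open>P r\<close> the replacement looks like
    \<open>X\<close>, which has no conflict with \<open>Y\<close>. If \<open>y\<close> is itself an
    entry of the replacement, it has just entered the pool; otherwise a monochromatic edge gives it
    a new neighbor in \<open>Q\<close>.\<close>
  have "\<exists>x y c. (y, c) \<in> Y \<and> y \<notin> P r \<and> (absorbed r x y \<or> y \<in> P (Suc r))" if r: "r < R" for r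
  proof -
    obtain Q X' where Q: "finite Q" "P r \<subseteq> Q" "Q \<subseteq> P (Suc r)"
        "\<forall>y\<in>V. j \<le> card {w \<in> Q. E y w} \<longrightarrow> y \<in> P (Suc r)"
      and X': "same_type E L (P r) X X'" "\<forall>l<L. X' l \<in> Q"
      using sat[OF r] X(1) unfolding saturates_def by blast
    have "same_type E L (P 0) X X'" using X'(1) P_mono[of 0 r] r unfolding same_type_def by auto
    moreover have "\<forall>l<L. X' l \<in> P R" using X'(2) Q(3) P_mono[of "Suc r" R] r by auto
    ultimately have "\<not> conflict_free E (colored_tuple L h X') Y" using no by blast
    then obtain l y c where l: "l < L" "(y, c) \<in> Y" "h l = c \<and> E (X' l) y \<or> h l \<noteq> c \<and> X' l = y"
      unfolding conflict_free_def colored_tuple_def by auto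
    have Xl: "h l = c \<longrightarrow> \<not> E (X l) y" "h l \<noteq> c \<longrightarrow> X l \<noteq> y"
      using X(2) l(1,2) unfolding conflict_free_def colored_tuple_def by auto
    have "y \<notin> P r" using X'(1) l Xl unfolding same_type_def by blast
    show ?thesis
    proof (cases "X' l = y")
      case True
      then have "y \<in> P (Suc r)" using l(1) X'(2) Q(3) by blast
      then show ?thesis using l(2) \<open>y \<notin> P r\<close> by blast
    next
      case False
      then have E: "E (X' l) y" "h l = c" using l(3) by auto
      have "X' l \<notin> P r"
      proof
        assume "X' l \<in> P r"
        then have "X l = X' l" using X'(1) l(1) unfolding same_type_def by blast
        then show False using E Xl by simp
      qed
      moreover have "E y (X' l)" using E(1) sympD[OF sym] by blast
      moreover have "X' l \<in> Q" using X'(2) l(1) by blast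
      ultimately have "absorbed r (X' l) y" unfolding absorbed_def using Q by blast
      then show ?thesis using l(2) \<open>y \<notin> P r\<close> by blast
    qed
  qed
  then obtain x y c where xy:
    "\<And>r. r < R \<Longrightarrow> (y r, c r) \<in> Y \<and> y r \<notin> P r \<and> (absorbed r (x r) (y r) \<or> y r \<in> P (Suc r))"
    by metis
  have yY: "y ` {..<R} \<subseteq> fst ` Y" using xy by force
  \<comment> \<open>Pigeonhole: more than \<open>card Y * j\<close> failing rounds share at most
    \<open>card Y\<close> blamed vertices.\<close>
  obtain y0 where "y0 \<in> fst ` Y" and big: "j < card {r \<in> {..<R}. y r = y0}"
  proof -
    have "\<exists>z\<in>fst ` Y. j < card {r \<in> {..<R}. y r = z}"
    proof (rule ccontr)
      assume "\<not> ?thesis"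
      then have le: "card {r \<in> {..<R}. y r = z} \<le> j" if "z \<in> fst ` Y" for z using that by (meson not_le)
      have "{..<R} \<subseteq> (\<Union>z\<in>fst ` Y. {r \<in> {..<R}. y r = z})" using yY by auto
      then have "card {..<R} \<le> card (\<Union>z\<in>fst ` Y. {r \<in> {..<R}. y r = z})"
        by (rule card_mono[rotated]) (use Y(1) in auto)
      also have "\<dots> \<le> (\<Sum>z\<in>fst ` Y. card {r \<in> {..<R}. y r = z})"
        by (rule card_UN_le) (use Y(1) in simp)
      also have "\<dots> \<le> card (fst ` Y) * j" using sum_bounded_above[OF le] by simp
      also have "\<dots> \<le> card Y * j" by (rule mult_le_mono1[OF card_image_le[OF Y(1)]])
      finally show False using Y(3) by simp
    qed
    then show ?thesis using that by blast
  qed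
  define J where "J = {r \<in> {..<R}. y r = y0}"
  define r1 where "r1 = Max J"
  have "J \<noteq> {}"
  proof
    assume "J = {}"
    then show False using big unfolding J_def by (metis card.empty not_less0)
  qed
  then have fJ: "finite J" "J \<noteq> {}" unfolding J_def by auto
  then have r1: "r1 \<in> J" "\<And>r. r \<in> J \<Longrightarrow> r \<le> r1" unfolding r1_def by auto
  \<comment> \<open>The reason for more than \<open>j\<close> rounds: the last one only certifies
    that \<open>y0\<close> is still outside the pool, so that in at least \<open>j\<close> earlier
    ones the blame must come from a new neighbor.\<close>
  define J' where "J' = J - {r1}"
  have "card J' \<ge> j" using big r1 fJ unfolding J'_def J_def by simp
  have y0: "y0 \<notin> P r1" "r1 < R" using r1(1) xy unfolding J_def by auto
  have J': "r < r1" "r < R" "y r = y0" if "r \<in> J'" for r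
    using that r1(2) unfolding J'_def J_def by force+
  have notP: "y0 \<notin> P (Suc r)" if "r \<in> J'" for r
    using J'[OF that] y0 P_mono[of "Suc r" r1] by auto
  have ab: "absorbed r (x r) y0" if "r \<in> J'" for r
    using xy[of r] J'[OF that] notP[OF that] by blast
  have P_suc: "x r \<in> P (Suc r)" "x r \<notin> P r" "E y0 (x r)" if "r \<in> J'" for r
    using ab[OF that] unfolding absorbed_def by blast+
  \<comment> \<open>\<open>x r\<close> enters the pool exactly in round \<open>r\<close>, so
    different rounds give different neighbors of \<open>y0\<close>.\<close>
  have "inj_on x J'"
  proof (rule linorder_inj_onI)
    fix r r' assume "r < r'" "r \<in> J'" "r' \<in> J'"
    then show "x r \<noteq> x r'" using P_suc[of r] P_suc[of r'] P_mono[of "Suc r" r'] J'[of r'] by auto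
  qed auto
  have fJ': "finite J'" "J' \<noteq> {}" using fJ \<open>card J' \<ge> j\<close> j unfolding J'_def by (simp, fastforce)
  \<comment> \<open>The \<open>Q\<close> of the last of these rounds contains all the neighbors
    found, so \<open>y0\<close> is absorbed there, no later than the start of round
    \<open>r1\<close>.\<close>
  define r2 where "r2 = Max J'"
  have r2: "r2 \<in> J'" "\<And>r. r \<in> J' \<Longrightarrow> r \<le> r2" using fJ' unfolding r2_def by auto
  obtain Q where Q: "finite Q" "P r2 \<subseteq> Q" "x r2 \<in> Q"
      "\<forall>y\<in>V. j \<le> card {w \<in> Q. E y w} \<longrightarrow> y \<in> P (Suc r2)"
    using ab[OF r2(1)] unfolding absorbed_def by blast
  have "x r \<in> Q" if "r \<in> J'" for r
  proof (cases "r = r2")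
    case False
    then have "Suc r \<le> r2" using r2(2)[OF that] by simp
    then show ?thesis using P_mono[of "Suc r" r2] P_suc[OF that] J'[OF r2(1)] Q(2) by auto
  qed (use Q in simp)
  then have "x ` J' \<subseteq> {w \<in> Q. E y0 w}" using P_suc by auto
  then have "card (x ` J') \<le> card {w \<in> Q. E y0 w}" by (rule card_mono[rotated]) (use Q(1) in simp)
  then have "j \<le> card {w \<in> Q. E y0 w}" using card_image[OF \<open>inj_on x J'\<close>] \<open>card J' \<ge> j\<close> by simp
  then have "y0 \<in> P (Suc r2)" using Q(4) \<open>y0 \<in> fst ` Y\<close> Y(2) by auto
  then show False using notP[OF r2(1)] by simp
qed


text \<open>The context \<open>Y\<close> is arbitrary, as it is unknown when \<open>S\<close> is
  built. The replacement obeys the same size bound as the original, so that it can become part of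
  the context of later replacements without exceeding \<open>L\<close>.\<close>

definition represents :: "('v \<Rightarrow> 'v \<Rightarrow> bool) \<Rightarrow> 'v set \<Rightarrow> nat \<Rightarrow> nat \<Rightarrow> 'v \<Rightarrow> 'v set \<Rightarrow> bool" where
  "represents E V L t v S \<longleftrightarrow>
     (\<forall>c Y W. c \<le> t \<longrightarrow> finite Y \<longrightarrow> fst ` Y \<subseteq> V \<longrightarrow> grundy_set E W \<longrightarrow> fst ` W \<subseteq> V \<longrightarrow> finite W \<longrightarrow>
        (v, c) \<in> W \<longrightarrow> card W \<le> 2 ^ (c - 1) \<longrightarrow> conflict_free E W Y \<longrightarrow> card Y + 2 ^ (c - 1) \<le> L \<longrightarrow>
        (\<exists>W'. grundy_set E W' \<and> fst ` W' \<subseteq> S \<and> finite W' \<and> (v, c) \<in> W' \<and> card W' \<le> 2 ^ (c - 1) \<and>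
              conflict_free E W' Y))"

text \<open>Padding by repetition turns witnesses of all sizes into tuples of the single length
  \<open>L\<close> that the rounds enumerate.\<close>

lemma colored_tuple_exists:
  assumes "finite W" "W \<noteq> {}" "card W \<le> L"
  shows "\<exists>X h. colored_tuple L h X = W"
proof -
  obtain ws where ws: "set ws = W" "length ws = card W"
    using assms(1) by (metis distinct_card finite_distinct_list)
  define f where "f l = (if l < length ws then ws ! l else ws ! 0)" for l
  have "length ws > 0" using ws assms(2) by auto
  have "f ` {..<L} = W"
  proof
    have "f l \<in> W" for l using \<open>length ws > 0\<close> ws(1) unfolding f_def by auto
    then show "f ` {..<L} \<subseteq> W" by blast
    show "W \<subseteq> f ` {..<L}"
    proof
      fix w assume "w \<in> W"
      then obtain l where "l < length ws" "w = ws ! l" using ws(1) by (metis in_set_conv_nth)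
      then have "l < L" "w = f l" using ws(2) assms(3) unfolding f_def by auto
      then show "w \<in> f ` {..<L}" by blast
    qed
  qed
  then have "colored_tuple L (snd \<circ> f) (fst \<circ> f) = W"
    unfolding colored_tuple_def by simp
  then show ?thesis by blast
qed

text \<open>Equal entries of \<open>X\<close> are equal in \<open>X'\<close>, so sending
  \<open>X l\<close> to \<open>X' l\<close> is a well-defined map from one colored set onto the
  other.\<close>

lemma same_type_card:
  assumes "same_type E L P X X'"
  shows "card (colored_tuple L h X') \<le> card (colored_tuple L h X)"
proof -
  define f where "f p = (X' (SOME l. l < L \<and> X l = fst p), snd p)" for p :: "'a \<times> nat"
  have "f (X l, h l) = (X' l, h l)" if "l < L" for l
  proof -
    have "\<exists>l'. l' < L \<and> X l' = X l" using that by blast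
    from someI_ex[OF this] have "X' (SOME l'. l' < L \<and> X l' = X l) = X' l"
      using assms that unfolding same_type_def by blast
    then show ?thesis unfolding f_def by simp
  qed
  then have "colored_tuple L h X' = f ` colored_tuple L h X"
    unfolding colored_tuple_def by (auto simp: image_iff)
  then show ?thesis by (simp add: card_image_le colored_tuple_def)
qed

text \<open>Two replacements in a row: the pool \<open>S\<close> of \<open>u\<close> offers a
  witness compatible with \<open>Y\<close>, and \<open>exchange\<close> carries it into the pool of
  \<open>v\<close>. As \<open>v\<close> is in that pool from the start, the type records adjacency
  to \<open>v\<close>, so the copy of \<open>u\<close> is again a neighbor of
  \<open>v\<close>.\<close>

lemma replace_subwitness:
  assumes sym: "symp E" and j: "0 < j"
    and sat: "\<And>r. r < R \<Longrightarrow> saturates E L j V F (P r) (P (Suc r))"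
    and R: "L * j < R" and v: "v \<in> P 0"
    and F: "\<And>X. (\<forall>l<L. X l \<in> S) \<Longrightarrow> X \<in> F"
    and rep: "represents E V L t u S" and s: "s \<le> t" and u: "E v u"
    and W: "grundy_set E W" "fst ` W \<subseteq> V" "finite W" "(u, s) \<in> W" "card W \<le> 2 ^ (s - 1)"
    and Y: "finite Y" "fst ` Y \<subseteq> V" "conflict_free E W Y" "card Y + 2 ^ (s - 1) \<le> L"
  shows "\<exists>W' u'. grundy_set E W' \<and> fst ` W' \<subseteq> P R \<and> finite W' \<and> (u', s) \<in> W' \<and> E v u' \<and>
     card W' \<le> 2 ^ (s - 1) \<and> conflict_free E W' Y"
proof -
  obtain U where U: "grundy_set E U" "fst ` U \<subseteq> S" "finite U" "(u, s) \<in> U" "card U \<le> 2 ^ (s - 1)"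
      "conflict_free E U Y"
    using rep s W Y unfolding represents_def by meson
  obtain X h where X: "colored_tuple L h X = U"
    using colored_tuple_exists[of U L] U Y(4) by fastforce
  have "X \<in> F" using F U(2) X unfolding colored_tuple_def by force
  have "card Y * j \<le> L * j" by (rule mult_le_mono1) (use Y(4) in simp)
  then have "card Y * j < R" using R by (rule le_less_trans)
  then obtain X' where X': "same_type E L (P 0) X X'" "\<forall>l<L. X' l \<in> P R"
      "conflict_free E (colored_tuple L h X') Y"
    using exchange[where P = P and R = R and h = h, OF sym j sat Y(1,2) \<open>card Y * j < R\<close> \<open>X \<in> F\<close>] U(6) X
    by blast
  obtain l where l: "l < L" "X l = u" "h l = s" using U(4) X unfolding colored_tuple_def by auto
  have "E u v" using u sym by (meson sympD)
  then have "E (X' l) v" using X'(1) l v unfolding same_type_def by blast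
  then have "E v (X' l)" using sym by (meson sympD)
  moreover have "(X' l, s) \<in> colored_tuple L h X'" using l unfolding colored_tuple_def by blast
  moreover have "card (colored_tuple L h X') \<le> 2 ^ (s - 1)"
    using same_type_card[OF X'(1), of h] U(5) X by simp
  moreover have "grundy_set E (colored_tuple L h X')"
    using same_type_grundy_set X'(1) U(1) X by blast
  moreover have "fst ` colored_tuple L h X' \<subseteq> P R" "finite (colored_tuple L h X')"
    using X'(2) unfolding colored_tuple_def by auto
  ultimately show ?thesis using X'(3) by blast
qed

text \<open>The subwitnesses are moved into the pool one color at a time, in increasing order. The
  context of each move is \<open>Y\<close>, \<open>v\<close>, the copies already made and the
  originals not yet moved; hence all copies end up compatible with each other.\<close>

lemma represents_step:
  assumes sym: "symp E" and irr: "irreflp E" and j: "0 < j"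
    and sat: "\<And>r. r < R \<Longrightarrow> saturates E L j V {X. \<exists>u\<in>V - {v}. \<forall>l<L. X l \<in> S u} (P r) (P (Suc r))"
    and R: "L * j < R" and v: "v \<in> P 0" and PV: "P R \<subseteq> V"
    and rep: "\<And>u. u \<in> V \<Longrightarrow> u \<noteq> v \<Longrightarrow> represents E V L t u (S u)"
  shows "represents E V L (Suc t) v (P R)"
  unfolding represents_def
proof (intro allI impI)
  fix c Y W
  assume c: "c \<le> Suc t" and Y: "finite Y" "fst ` Y \<subseteq> V"
    and W: "grundy_set E W" "fst ` W \<subseteq> V" "finite W" "(v, c) \<in> W" "card W \<le> 2 ^ (c - 1)"
    and WY: "conflict_free E W Y" and card: "card Y + 2 ^ (c - 1) \<le> L"
  have c1: "1 \<le> c" and sup: "\<forall>s\<in>{1..<c}. \<exists>y. (y, s) \<in> W \<and> E v y"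
    using W(1,4) unfolding grundy_set_def by blast+
  have "\<forall>s\<in>{1..<c}. \<exists>y U. E v y \<and> U \<subseteq> W \<and> grundy_set E U \<and> (y, s) \<in> U \<and> card U \<le> 2 ^ (s - 1)"
    using sup grundy_set_small[OF W(1)] by metis
  then obtain y U where U: "\<And>s. s \<in> {1..<c} \<Longrightarrow> E v (y s) \<and> U s \<subseteq> W \<and> grundy_set E (U s) \<and> (y s, s) \<in> U s \<and>
      card (U s) \<le> 2 ^ (s - 1)"
    by metis
  have finU: "finite (U s)" if "s \<in> {1..<c}" for s using U[OF that] W(3) finite_subset by blast
  have P_mono: "P r \<subseteq> P R" if "r \<le> R" for r
    using that
  proof (induction rule: inc_induct)
    case (step m)
    then show ?case using sat[of m] unfolding saturates_def by blast
  qed simp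
  have WW: "conflict_free E W W" using W(1) unfolding grundy_set_def by blast
  define rest where "rest m = Y \<union> {(v, c)} \<union> (\<Union>s\<in>{Suc m..<c}. U s)" for m
  have rest_W: "rest m \<subseteq> Y \<union> W" for m 
  proof -
    have "(\<Union>s\<in>{Suc m..<c}. U s) \<subseteq> W" using U by (intro UN_least) auto
    then show ?thesis unfolding rest_def using W(4) by blast
  qed
  have rest_V: "fst ` rest m \<subseteq> V" for m using rest_W[of m] Y(2) W(2) by blast
  have rest_fin: "finite (rest m)" for m using rest_W[of m] Y(1) W(3) finite_subset by blast
  \<comment> \<open>The originals of color above \<open>m\<close> take at most
    \<open>2 ^ (c - 1) - 2 ^ m\<close> elements; the \<open>+ 1\<close> is
    \<open>(v, c)\<close>.\<close>
  have rest_card: "card (rest m) + 2 ^ m \<le> L + 1" if "m < c" for m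
  proof -
    have sum2: "(\<Sum>s\<in>{Suc m..<c}. 2 ^ (s - 1)) + 2 ^ m = (2::nat) ^ (c - 1)"
      using Suc_leI[OF that]
    proof (induction c rule: dec_induct)
      case (step d)
      then show ?case by (cases d) (auto simp: atLeastLessThanSuc)
    qed simp
    have "card (rest m) \<le> card Y + 1 + card (\<Union>s\<in>{Suc m..<c}. U s)"
      unfolding rest_def using card_Un_le[of "Y \<union> {(v, c)}" "\<Union>s\<in>{Suc m..<c}. U s"] card_Un_le[of Y "{(v, c)}"]
      by simp
    also have "card (\<Union>s\<in>{Suc m..<c}. U s) \<le> (\<Sum>s\<in>{Suc m..<c}. card (U s))"
      by (rule card_UN_le) simp
    also have "\<dots> \<le> (\<Sum>s\<in>{Suc m..<c}. 2 ^ (s - 1))"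
      by (rule sum_mono) (use U in auto)
    finally show ?thesis using sum2 card by simp
  qed
  \<comment> \<open>\<open>A\<close> collects the copies made so far. One of the
    \<open>2 ^ m\<close> places stays free, in the end for \<open>(v, c)\<close>.\<close>
  have "\<exists>A. grundy_set E A \<and> fst ` A \<subseteq> P R \<and> finite A \<and> card A + 1 \<le> 2 ^ m \<and>
          conflict_free E A (rest m) \<and> (\<forall>s\<in>{1..m}. \<exists>u. (u, s) \<in> A \<and> E v u)" if "m < c" for m
    using that
  proof (induction m)
    case 0
    show ?case by (rule exI[of _ "{}"]) (simp add: grundy_set_def conflict_free_def)
  next
    case (Suc m)
    then obtain A where A: "grundy_set E A" "fst ` A \<subseteq> P R" "finite A" "card A + 1 \<le> 2 ^ m"
        "conflict_free E A (rest m)" "\<forall>s\<in>{1..m}. \<exists>u. (u, s) \<in> A \<and> E v u" by auto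
    define s where "s = Suc m"
    have s: "s \<in> {1..<c}" "s \<le> t" using Suc.prems c unfolding s_def by auto
    have rest_m: "rest m = rest (Suc m) \<union> U s"
    proof -
      have "{Suc m..<c} = insert s {Suc (Suc m)..<c}" using Suc.prems unfolding s_def by auto
      then show ?thesis unfolding rest_def by auto
    qed
    let ?Y = "rest (Suc m) \<union> A"
    \<comment> \<open>A neighbor of \<open>v\<close> differs from \<open>v\<close>, so its pool is
      not the one under construction.\<close>
    have "y s \<in> V" "y s \<noteq> v" using U[OF s(1)] W(2) irr by (force, metis irreflpD)
    then have rep_y: "represents E V L t (y s) (S (y s))" by (rule rep)
    have cf: "conflict_free E (U s) ?Y"
      unfolding conflict_free_Un_right
    proof
      have "conflict_free E W (Y \<union> W)" using WY WW conflict_free_Un_right by blast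
      then show "conflict_free E (U s) (rest (Suc m))"
        using conflict_free_mono U[OF s(1)] rest_W by blast
      show "conflict_free E (U s) A"
        using A(5) rest_m conflict_free_Un_right conflict_free_commute[OF sym] by metis
    qed
    \<comment> \<open>The budget is just met: \<open>rest (Suc m)\<close> takes at most
      \<open>L + 1 - 2 ^ Suc m\<close>, the copies \<open>2 ^ m - 1\<close> and the subwitness
      \<open>2 ^ m\<close>.\<close>
    have "card ?Y + 2 ^ (s - 1) \<le> L"
    proof -
      have "card ?Y \<le> card (rest (Suc m)) + card A" by (rule card_Un_le)
      then show ?thesis using rest_card[of "Suc m"] Suc.prems A(4) unfolding s_def by simp
    qed
    moreover have "fst ` ?Y \<subseteq> V" using rest_V[of "Suc m"] A(2) PV by blast
    moreover have "fst ` U s \<subseteq> V" using U[OF s(1)] W(2) by blast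
    ultimately obtain W' u' where W': "grundy_set E W'" "fst ` W' \<subseteq> P R" "finite W'" "(u', s) \<in> W'" "E v u'"
        "card W' \<le> 2 ^ (s - 1)" "conflict_free E W' ?Y"
      using replace_subwitness[OF sym j sat R v _ rep_y s(2), of "U s" ?Y]
        U[OF s(1)] finU[OF s(1)] \<open>y s \<in> V\<close> \<open>y s \<noteq> v\<close> cf rest_fin A(3) by blast
    show ?case
    proof (intro exI[of _ "A \<union> W'"] conjI)
      show "grundy_set E (A \<union> W')"
        using grundy_set_Un[OF sym A(1) W'(1)] W'(7) conflict_free_Un_right conflict_free_commute[OF sym] by metis
      show "fst ` (A \<union> W') \<subseteq> P R" "finite (A \<union> W')" using A W' by auto
      show "card (A \<union> W') + 1 \<le> 2 ^ Suc m"
        using card_Un_le[of A W'] A(4) W'(6) unfolding s_def by simp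
      show "conflict_free E (A \<union> W') (rest (Suc m))"
        using A(5) W'(7) unfolding rest_m conflict_free_Un_left conflict_free_Un_right by blast
      show "\<forall>s\<in>{1..Suc m}. \<exists>u. (u, s) \<in> A \<union> W' \<and> E v u"
      proof
        fix s' assume "s' \<in> {1..Suc m}"
        then have "s' \<in> {1..m} \<or> s' = s" unfolding s_def by auto
        then show "\<exists>u. (u, s') \<in> A \<union> W' \<and> E v u" using A(6) W'(4,5) by blast
      qed
    qed
  qed
  moreover have "rest (c - 1) = Y \<union> {(v, c)}" "{1..c - 1} = {1..<c}" "c - 1 < c"
    using c1 unfolding rest_def by auto
  ultimately obtain A where A: "grundy_set E A" "fst ` A \<subseteq> P R" "finite A" "card A + 1 \<le> 2 ^ (c - 1)"
      "conflict_free E A (Y \<union> {(v, c)})" "\<forall>s\<in>{1..<c}. \<exists>u. (u, s) \<in> A \<and> E v u"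
    by metis
  let ?W = "A \<union> {(v, c)}"
  have vv: "conflict_free E {(v, c)} {(v, c)}" using irr unfolding conflict_free_def by (auto dest: irreflpD)
  have "conflict_free E ?W ?W"
    using A(1,5) vv conflict_free_commute[OF sym]
    unfolding grundy_set_def conflict_free_Un_left conflict_free_Un_right by blast
  moreover have "1 \<le> d \<and> (\<forall>s\<in>{1..<d}. \<exists>y. (y, s) \<in> ?W \<and> E x y)" if "(x, d) \<in> ?W" for x d
    using that A(1,6) c1 unfolding grundy_set_def by blast
  ultimately have "grundy_set E ?W" unfolding grundy_set_def by blast
  moreover have "conflict_free E ?W Y"
    using A(5) conflict_free_mono[OF WY, of "{(v, c)}" Y] W(4)
    unfolding conflict_free_Un_left conflict_free_Un_right by blast
  moreover have "fst ` ?W \<subseteq> P R" using A(2) v P_mono[of 0] by auto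
  moreover have "card ?W \<le> 2 ^ (c - 1)" using A(3,4) by (simp add: card_insert_if)
  ultimately show "\<exists>W'. grundy_set E W' \<and> fst ` W' \<subseteq> P R \<and> finite W' \<and> (v, c) \<in> W' \<and> card W' \<le> 2 ^ (c - 1) \<and>
        conflict_free E W' Y"
    using A(3) by (intro exI[of _ ?W]) simp
qed

section \<open>Grundy colorings of graphs\<close>

definition adj :: "'a pair_pre_digraph \<Rightarrow> 'a \<Rightarrow> 'a \<Rightarrow> bool" where
  "adj G x y \<longleftrightarrow> (x, y) \<in> parcs G"

lemma (in pair_graph) adj_graph:
  "symp (adj G)" "irreflp (adj G)"
  using arcs_symmetric no_loops
  by (auto simp: adj_def symp_def irreflp_def) blast

text \<open>Without loops, two completely joined sides are disjoint, so with all edges between them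
  they form a complete bipartite subgraph.\<close>

lemma biclique_free_no_biclique:
  assumes G: "pair_graph G" and bf: "biclique_free i j G"
    and UT: "U \<subseteq> pverts G" "T \<subseteq> pverts G" "card U = i" "card T = j"
  shows "\<exists>u\<in>U. \<exists>w\<in>T. \<not> adj G u w"
proof (rule ccontr)
  assume "\<not> ?thesis"
  then have all: "(u, w) \<in> parcs G" if "u \<in> U" "w \<in> T" for u w using that unfolding adj_def by blast
  interpret pair_graph G by fact
  define H where "H = \<lparr>pverts = U \<union> T, parcs = U \<times> T \<union> T \<times> U\<rparr>"
  have disj: "U \<inter> T = {}" using all no_loops by fastforce
  have "finite (pverts G)" using finite_verts by simp
  then have "finite (U \<union> T)" using UT(1,2) by (metis finite_subset sup.bounded_iff)
  then have K: "K\<^bsub>i,j\<^esub> (with_proj H)"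
    unfolding complete_bipartite_digraph_pair_def using UT(3,4) disj unfolding H_def by auto
  have "pair_graph H" using K by (rule pair_graphI_complete_bipartite)
  then have "wf_digraph (with_proj H)"
    by (simp add: wf_digraph_wp_iff pair_graph_def pair_digraph_def pair_fin_digraph_def)
  moreover have "parcs H \<subseteq> parcs G" unfolding H_def using all arcs_symmetric by auto
  ultimately have "subgraph (with_proj H) (with_proj G)"
    using UT(1,2) unfolding H_def by (intro subgraphI) (auto intro: wf_digraph)
  then show False using bf K unfolding biclique_free_def by blast
qed

text \<open>A vertex with \<open>j\<close> neighbors in \<open>Q\<close> is a common neighbor of
  some \<open>j\<close>-subset of \<open>Q\<close>. Each such subset has at most \<open>i\<close>
  common neighbors, and there are at most \<open>2 ^ card Q\<close> subsets.\<close>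

lemma card_many_neighbors_le:
  assumes G: "pair_graph G" and bf: "biclique_free i j G" and "Q \<subseteq> pverts G"
  shows "card {y \<in> pverts G. j \<le> card {w \<in> Q. adj G y w}} \<le> i * 2 ^ card Q"
proof -
  interpret pair_graph G by fact
  have fV: "finite (pverts G)" using finite_verts by simp
  then have fQ: "finite Q" using assms(3) finite_subset by blast
  define fiber where "fiber T = {y \<in> pverts G. \<forall>w\<in>T. adj G y w}" for T
  have fiber: "card (fiber T) \<le> i" if "T \<subseteq> Q" "card T = j" for T
  proof (rule ccontr)
    assume "\<not> ?thesis"
    then have "i \<le> card (fiber T)" by simp
    then obtain U where "U \<subseteq> fiber T" "card U = i" by (meson obtain_subset_with_card_n)
    then show False
      using biclique_free_no_biclique[OF G bf, of U T] that assms(3) unfolding fiber_def by blast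
  qed
  let ?H = "{y \<in> pverts G. j \<le> card {w \<in> Q. adj G y w}}" and ?T = "{T. T \<subseteq> Q \<and> card T = j}"
  have "?H \<subseteq> (\<Union>T\<in>?T. fiber T)"
  proof
    fix y assume y: "y \<in> ?H"
    then obtain T where "T \<subseteq> {w \<in> Q. adj G y w}" "card T = j"
      by (metis (no_types, lifting) mem_Collect_eq obtain_subset_with_card_n)
    then show "y \<in> (\<Union>T\<in>?T. fiber T)" using y unfolding fiber_def by blast
  qed
  moreover have fT: "finite ?T" using fQ by (auto intro: finite_subset[of _ "Pow Q"])
  ultimately have "card ?H \<le> card (\<Union>T\<in>?T. fiber T)"
    by (intro card_mono) (auto simp: fiber_def fV)
  also have "\<dots> \<le> (\<Sum>T\<in>?T. card (fiber T))" by (rule card_UN_le[OF fT])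
  also have "\<dots> \<le> (\<Sum>T\<in>?T. i)" by (rule sum_mono) (use fiber in auto)
  also have "\<dots> = i * card ?T" by simp
  also have "card ?T \<le> card (Pow Q)" by (rule card_mono) (use fQ in auto)
  finally show ?thesis using fQ by (simp add: card_Pow)
qed

text \<open>First-fit gives an uncolored vertex the least positive color absent from its colored
  neighbors; all smaller colors are then present, and earlier vertices keep their supports.\<close>

lemma partial_grundy_extends:
  assumes G: "pair_graph G" and W: "grundy_set (adj G) W" "fst ` W \<subseteq> pverts G"
  shows "\<exists>c. grundy_set (adj G) {(x, c x) |x. x \<in> pverts G} \<and> (\<forall>(x, d) \<in> W. c x = d)"
proof -
  interpret pair_graph G by fact
  have fV: "finite (pverts G)" using finite_verts by simp
  have main: "\<exists>W'. W \<subseteq> W' \<and> grundy_set (adj G) W' \<and> fst ` W' = pverts G"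
    using W
  proof (induction "card (pverts G - fst ` W)" arbitrary: W rule: less_induct)
    case less
    show ?case
    proof (cases "fst ` W = pverts G")
      case True
      then show ?thesis using less.prems by blast
    next
      case False
      then obtain x where x: "x \<in> pverts G" "x \<notin> fst ` W" using less.prems by blast
      define N where "N = {d. \<exists>y. (y, d) \<in> W \<and> adj G x y}"
      \<comment> \<open>Each vertex carries at most one color, so finitely many vertices leave some
        color free.\<close>
      have "N \<subseteq> (\<lambda>y. THE d. (y, d) \<in> W) ` pverts G"
      proof
        fix d assume "d \<in> N"
        then obtain y where y: "(y, d) \<in> W" unfolding N_def by blast
        then have "d' = d" if "(y, d') \<in> W" for d'
          using less.prems(1) that unfolding grundy_set_def by (metis conflict_freeD(2))
        then have "(THE d. (y, d) \<in> W) = d" using y by blast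
        then show "d \<in> (\<lambda>y. THE d. (y, d) \<in> W) ` pverts G" using y less.prems(2) by force
      qed
      then have "finite N" using fV finite_subset by blast
      then have "\<exists>c. 1 \<le> c \<and> c \<notin> N"
        by (metis One_nat_def add.commute finite_nat_set_iff_bounded le_add1 not_less plus_1_eq_Suc
            less_imp_le_nat)
      define c where "c = (LEAST c. 1 \<le> c \<and> c \<notin> N)"
      have c: "1 \<le> c" "c \<notin> N" unfolding c_def by (rule LeastI2_ex[OF \<open>\<exists>c. _\<close>], simp)+
      have least: "s \<in> N" if "s \<in> {1..<c}" for s
        using not_less_Least[of s "\<lambda>c. 1 \<le> c \<and> c \<notin> N"] that unfolding c_def by auto
      let ?W = "W \<union> {(x, c)}"
      have cf: "conflict_free (adj G) W {(x, c)}"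
        unfolding conflict_free_def using x(2) c(2) adj_graph(1)
        by (auto simp: N_def symp_def image_iff)
      have "conflict_free (adj G) {(x, c)} {(x, c)}"
        using adj_graph(2) unfolding conflict_free_def by (auto dest: irreflpD)
      then have "conflict_free (adj G) ?W ?W"
        using cf less.prems(1) conflict_free_commute[OF adj_graph(1)]
        unfolding grundy_set_def conflict_free_Un_left conflict_free_Un_right by blast
      moreover have "1 \<le> d \<and> (\<forall>s\<in>{1..<d}. \<exists>z. (z, s) \<in> ?W \<and> adj G y z)" if "(y, d) \<in> ?W" for y d
      proof (cases "(y, d) \<in> W")
        case True
        then show ?thesis using less.prems(1) unfolding grundy_set_def by blast
      next
        case False
        then have "y = x" "d = c" using that by auto
        then show ?thesis using c(1) least unfolding N_def by blast
      qed
      ultimately have "grundy_set (adj G) ?W" unfolding grundy_set_def by blast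
      moreover have "fst ` ?W \<subseteq> pverts G" using x(1) less.prems(2) by simp
      moreover have "card (pverts G - fst ` ?W) < card (pverts G - fst ` W)"
        by (rule psubset_card_mono) (use fV x in auto)
      ultimately show ?thesis using less.hyps[of ?W] by blast
    qed
  qed
  then obtain W' where W': "W \<subseteq> W'" "grundy_set (adj G) W'" "fst ` W' = pverts G" by blast
  define c where "c x = (THE d. (x, d) \<in> W')" for x
  have c: "c x = d" if "(x, d) \<in> W'" for x d
  proof -
    have "d' = d" if "(x, d') \<in> W'" for d'
      using W'(2) that \<open>(x, d) \<in> W'\<close> unfolding grundy_set_def by (metis conflict_freeD(2))
    then show ?thesis unfolding c_def using that by blast
  qed
  have "{(x, c x) |x. x \<in> pverts G} = W'"
  proof (intro set_eqI iffI)
    fix p assume "p \<in> W'"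
    then show "p \<in> {(x, c x) |x. x \<in> pverts G}" using c W'(3) by (cases p) force
  next
    fix p assume "p \<in> {(x, c x) |x. x \<in> pverts G}"
    then obtain x where x: "p = (x, c x)" "x \<in> pverts G" by blast
    then obtain d where "(x, d) \<in> W'" using W'(3) by force
    then show "p \<in> W'" using c x by simp
  qed
  then show ?thesis using W'(1,2) c by (intro exI[of _ c]) auto
qed

text \<open>One vertex of color \<open>k\<close> suffices because the extension may use more colors.
  The extended coloring has no gaps: a vertex of maximal color sees every smaller color.\<close>

lemma grundy_at_least_iff:
  assumes G: "pair_graph G" and k: "0 < k"
  shows "grundy_at_least G k \<longleftrightarrow> (\<exists>W v. grundy_set (adj G) W \<and> fst ` W \<subseteq> pverts G \<and> (v, k) \<in> W)"
proof
  assume "grundy_at_least G k"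
  then obtain k' c where c: "k \<le> k'" "c ` pverts G = {1..k'}" "proper_coloring G c"
      "\<forall>v \<in> pverts G. \<forall>s \<in> {1..<c v}. \<exists>u \<in> pverts G. (v, u) \<in> parcs G \<and> c u = s"
    unfolding grundy_at_least_def grundy_coloring_def by blast
  let ?W = "{(x, c x) |x. x \<in> pverts G}"
  have "k \<in> c ` pverts G" using c(1,2) k by auto
  then obtain v where v: "(v, k) \<in> ?W" by blast
  have "conflict_free (adj G) ?W ?W"
    using c(3) unfolding conflict_free_def proper_coloring_def adj_def by fastforce
  moreover have "1 \<le> c x" if "x \<in> pverts G" for x using that c(2) by auto
  ultimately have "grundy_set (adj G) ?W"
    using c(4) unfolding grundy_set_def adj_def by (simp, metis One_nat_def)
  then show "\<exists>W v. grundy_set (adj G) W \<and> fst ` W \<subseteq> pverts G \<and> (v, k) \<in> W"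
    using v by (intro exI[of _ ?W]) auto
next
  assume "\<exists>W v. grundy_set (adj G) W \<and> fst ` W \<subseteq> pverts G \<and> (v, k) \<in> W"
  then obtain W v where W: "grundy_set (adj G) W" "fst ` W \<subseteq> pverts G" "(v, k) \<in> W" by blast
  interpret pair_graph G by fact
  obtain c where c: "grundy_set (adj G) {(x, c x) |x. x \<in> pverts G}" "c v = k"
    using partial_grundy_extends[OF G W(1,2)] W(3) by fastforce
  have v: "v \<in> pverts G" using W(2,3) by force
  have sup: "1 \<le> c x \<and> (\<forall>s \<in> {1..<c x}. \<exists>u \<in> pverts G. (x, u) \<in> parcs G \<and> c u = s)" if "x \<in> pverts G" for x
    using c(1) that unfolding grundy_set_def adj_def by fastforce
  define k' where "k' = Max (c ` pverts G)"
  have fin: "finite (c ` pverts G)" "c ` pverts G \<noteq> {}" using finite_verts v by auto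
  have le: "c x \<le> k'" if "x \<in> pverts G" for x unfolding k'_def using fin that by simp
  obtain x where x: "x \<in> pverts G" "c x = k'" using Max_in[OF fin] unfolding k'_def by auto
  have "c ` pverts G = {1..k'}"
  proof
    show "c ` pverts G \<subseteq> {1..k'}" using le sup by auto
    show "{1..k'} \<subseteq> c ` pverts G"
    proof
      fix s assume s: "s \<in> {1..k'}"
      show "s \<in> c ` pverts G"
      proof (cases "s = k'")
        case True
        then show ?thesis using x by blast
      next
        case False
        then have "s \<in> {1..<c x}" using s x by auto
        then show ?thesis using sup[OF x(1)] by (metis imageI)
      qed
    qed
  qed
  moreover have "proper_coloring G c"
    unfolding proper_coloring_def
  proof (clarify)
    fix u w assume uw: "(u, w) \<in> parcs G" "c u = c w"
    have "u \<in> pverts G" "w \<in> pverts G" using uw(1) in_arcsD1 in_arcsD2 by auto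
    then show False using c(1) uw unfolding grundy_set_def conflict_free_def adj_def by blast
  qed
  ultimately have "grundy_coloring G k' c" using sup unfolding grundy_coloring_def by blast
  moreover have "k \<le> k'" using le[OF v] c(2) by simp
  ultimately show "grundy_at_least G k" unfolding grundy_at_least_def by blast
qed

text \<open>Color 0 stands for a vertex outside the witness. Thus a total function encodes a partial
  coloring, and the search space has \<open>(k + 1) ^ card S\<close> elements.\<close>

definition pool_coloring :: "('v \<Rightarrow> 'v \<Rightarrow> bool) \<Rightarrow> nat \<Rightarrow> 'v set \<Rightarrow> ('v \<Rightarrow> nat) \<Rightarrow> bool" where
  "pool_coloring E k S c \<longleftrightarrow>
     (\<forall>x\<in>S. \<forall>y\<in>S. 0 < c x \<longrightarrow> c x = c y \<longrightarrow> \<not> E x y) \<and>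
     (\<forall>x\<in>S. \<forall>s\<in>{1..<c x}. \<exists>y\<in>S. c y = s \<and> E x y) \<and> (\<exists>x\<in>S. c x = k)"

text \<open>Completeness uses the pools against the empty context; for soundness, the positively
  colored vertices of any \<open>pool_coloring\<close> form a Grundy set of the whole graph.\<close>

lemma grundy_at_least_iff_pool_coloring:
  assumes G: "pair_graph G" and k: "0 < k" and L: "2 ^ (k - 1) \<le> L"
    and rep: "\<And>v. v \<in> pverts G \<Longrightarrow> represents (adj G) (pverts G) L k v (S v)"
    and S: "\<And>v. v \<in> pverts G \<Longrightarrow> S v \<subseteq> pverts G"
  shows "grundy_at_least G k \<longleftrightarrow>
     (\<exists>v\<in>pverts G. \<exists>c. pool_coloring (adj G) k (S v) c \<and> (\<forall>x. c x \<le> k))"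
proof
  assume "grundy_at_least G k"
  then obtain W v where W: "grundy_set (adj G) W" "fst ` W \<subseteq> pverts G" "(v, k) \<in> W"
    using grundy_at_least_iff[OF G k] by blast
  obtain U where U: "U \<subseteq> W" "finite U" "grundy_set (adj G) U" "(v, k) \<in> U" "card U \<le> 2 ^ (k - 1)"
    using grundy_set_small[OF W(1,3)] by blast
  have v: "v \<in> pverts G" using W(2,3) by force
  have cf: "conflict_free (adj G) U {}" unfolding conflict_free_def by simp
  have UV: "fst ` U \<subseteq> pverts G" using U(1) W(2) by blast
  obtain W' where W': "grundy_set (adj G) W'" "fst ` W' \<subseteq> S v" "(v, k) \<in> W'"
    using rep[OF v, unfolded represents_def, rule_format, OF le_refl _ _ U(3) UV U(2,4,5) cf] L by auto
  \<comment> \<open>Vertices of color above \<open>k\<close> are reset to 0. Supports only go down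
    in color, so what is left is still supported.\<close>
  define c where "c x = (if \<exists>d\<le>k. (x, d) \<in> W' then THE d. (x, d) \<in> W' else 0)" for x
  have uniq: "d' = d" if "(x, d) \<in> W'" "(x, d') \<in> W'" for x d d'
    using W'(1) that unfolding grundy_set_def by (metis conflict_freeD(2))
  have c: "c x = d" if "(x, d) \<in> W'" "d \<le> k" for x d
  proof -
    have "(THE d. (x, d) \<in> W') = d" using that uniq by blast
    then show ?thesis unfolding c_def using that by auto
  qed
  have c_le: "c x \<le> k" for x
  proof (cases "\<exists>d\<le>k. (x, d) \<in> W'")
    case True
    then show ?thesis using c by blast
  next
    case False
    then show ?thesis unfolding c_def by (simp only: if_False)
  qed
  have cW: "(x, c x) \<in> W'" if "0 < c x" for x
  proof (cases "\<exists>d\<le>k. (x, d) \<in> W'")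
    case True
    then show ?thesis using c by blast
  next
    case False
    then have "c x = 0" unfolding c_def by (simp only: if_False)
    then show ?thesis using that by simp
  qed
  have "pool_coloring (adj G) k (S v) c"
    unfolding pool_coloring_def
  proof (intro conjI ballI impI)
    fix x y assume "0 < c x" "c x = c y"
    then have "(x, c x) \<in> W'" "(y, c x) \<in> W'" using cW[of x] cW[of y] by auto
    then show "\<not> adj G x y" using W'(1) unfolding grundy_set_def by (meson conflict_freeD(1))
  next
    fix x s assume s: "s \<in> {1..<c x}"
    then have "(x, c x) \<in> W'" using cW by auto
    then obtain y where y: "(y, s) \<in> W'" "adj G x y" using W'(1) s unfolding grundy_set_def by blast
    have "s \<le> k" using s c_le[of x] by auto
    then show "\<exists>y\<in>S v. c y = s \<and> adj G x y" using y c W'(2) by force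
  next
    show "\<exists>x\<in>S v. c x = k" using W'(2,3) c by force
  qed
  then show "\<exists>v\<in>pverts G. \<exists>c. pool_coloring (adj G) k (S v) c \<and> (\<forall>x. c x \<le> k)" using v c_le by blast
next
  assume "\<exists>v\<in>pverts G. \<exists>c. pool_coloring (adj G) k (S v) c \<and> (\<forall>x. c x \<le> k)"
  then obtain v c where v: "v \<in> pverts G" and c: "pool_coloring (adj G) k (S v) c" by blast
  let ?W = "{(x, c x) |x. x \<in> S v \<and> 0 < c x}"
  have "conflict_free (adj G) ?W ?W"
    using c unfolding conflict_free_def pool_coloring_def by auto
  moreover have "1 \<le> d \<and> (\<forall>s\<in>{1..<d}. \<exists>y. (y, s) \<in> ?W \<and> adj G x y)" if "(x, d) \<in> ?W" for x d
  proof (intro conjI ballI)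
    show "1 \<le> d" using that by auto
    fix s assume "s \<in> {1..<d}"
    moreover have "x \<in> S v" "d = c x" using that by auto
    ultimately obtain y where "y \<in> S v" "c y = s" "adj G x y"
      using c unfolding pool_coloring_def by blast
    then show "\<exists>y. (y, s) \<in> ?W \<and> adj G x y" using \<open>s \<in> {1..<d}\<close> by auto
  qed
  ultimately have "grundy_set (adj G) ?W" unfolding grundy_set_def by blast
  moreover have "fst ` ?W \<subseteq> pverts G" using S[OF v] by auto
  moreover have "\<exists>x. (x, k) \<in> ?W" using c k unfolding pool_coloring_def by auto
  ultimately show "grundy_at_least G k" using grundy_at_least_iff[OF G k] by blast
qed

section \<open>A loop language and its compilation to the random access machine\<close>

text \<open>\<open>Seen\<close> maps a type code to the stamp of the last round that met it; an
  increasing stamp spares clearing the array. \<open>Tup\<close> holds the tuple at hand and, in the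
  final search, a coloring.\<close>

datatype arr = Pool | Len | Tup | Seen

datatype exp =
    Const nat
  | Var nat
  | Plus exp exp
  | Minus exp exp
  | Times exp exp
  | Input exp
  | Get arr exp

text \<open>Loops are counted, with the count evaluated once on entry, so every program terminates
  and its time can be bounded through its nesting depth.\<close>

datatype com =
    Nop
  | Assign nat exp
  | Put arr exp exp
  | Semi com com
  | Cond exp com com
  | For nat exp com

type_synonym store = "(nat \<Rightarrow> nat) \<times> (arr \<Rightarrow> nat \<Rightarrow> nat)"

fun eval :: "(nat \<Rightarrow> nat) \<Rightarrow> exp \<Rightarrow> store \<Rightarrow> nat" where
  "eval inp (Const a) s = a"
| "eval inp (Var x) s = fst s x"
| "eval inp (Plus e f) s = eval inp e s + eval inp f s"
| "eval inp (Minus e f) s = eval inp e s - eval inp f s"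
| "eval inp (Times e f) s = eval inp e s * eval inp f s"
| "eval inp (Input e) s = inp (eval inp e s)"
| "eval inp (Get A e) s = snd s A (eval inp e s)"

text \<open>Multiplication is compiled to repeated addition driven by its left factor.
  \<open>Z\<close> bounds whatever drives a loop, not all values.\<close>

fun exp_ok :: "(nat \<Rightarrow> nat) \<Rightarrow> nat \<Rightarrow> exp \<Rightarrow> store \<Rightarrow> bool" where
  "exp_ok inp Z (Const a) s = True"
| "exp_ok inp Z (Var x) s = True"
| "exp_ok inp Z (Plus e f) s = (exp_ok inp Z e s \<and> exp_ok inp Z f s)"
| "exp_ok inp Z (Minus e f) s = (exp_ok inp Z e s \<and> exp_ok inp Z f s)"
| "exp_ok inp Z (Times e f) s = (exp_ok inp Z e s \<and> exp_ok inp Z f s \<and> eval inp e s \<le> Z)"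
| "exp_ok inp Z (Input e) s = exp_ok inp Z e s"
| "exp_ok inp Z (Get A e) s = exp_ok inp Z e s"

fun for_loop :: "nat \<Rightarrow> (nat \<Rightarrow> 's \<Rightarrow> 's) \<Rightarrow> 's \<Rightarrow> 's" where
  "for_loop 0 f s = s"
| "for_loop (Suc b) f s = f b (for_loop b f s)"

definition set_var :: "nat \<Rightarrow> nat \<Rightarrow> store \<Rightarrow> store" where
  "set_var x b s = ((fst s)(x := b), snd s)"

fun sem :: "(nat \<Rightarrow> nat) \<Rightarrow> com \<Rightarrow> store \<Rightarrow> store" where
  "sem inp Nop s = s"
| "sem inp (Assign x e) s = set_var x (eval inp e s) s"
| "sem inp (Put A e f) s = (fst s, (snd s)(A := (snd s A)(eval inp e s := eval inp f s)))"
| "sem inp (Semi c d) s = sem inp d (sem inp c s)"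
| "sem inp (Cond e c d) s = (if eval inp e s > 0 then sem inp c s else sem inp d s)"
| "sem inp (For x e c) s = for_loop (eval inp e s) (\<lambda>b s. sem inp c (set_var x b s)) s"

fun com_ok :: "(nat \<Rightarrow> nat) \<Rightarrow> nat \<Rightarrow> com \<Rightarrow> store \<Rightarrow> bool" where
  "com_ok inp Z Nop s = True"
| "com_ok inp Z (Assign x e) s = exp_ok inp Z e s"
| "com_ok inp Z (Put A e f) s = (exp_ok inp Z e s \<and> exp_ok inp Z f s)"
| "com_ok inp Z (Semi c d) s = (com_ok inp Z c s \<and> com_ok inp Z d (sem inp c s))"
| "com_ok inp Z (Cond e c d) s = (exp_ok inp Z e s \<and>
     (if eval inp e s > 0 then com_ok inp Z c s else com_ok inp Z d s))"
| "com_ok inp Z (For x e c) s = (exp_ok inp Z e s \<and> eval inp e s \<le> Z \<and>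
     (\<forall>b < eval inp e s. com_ok inp Z c
        (set_var x b (for_loop b (\<lambda>b s. sem inp c (set_var x b s)) s))))"

text \<open>
  Variable \<open>x\<close> lives in register \<open>2 * x\<close>. The odd registers are temporaries, except that register 1
  holds \<open>n * n\<close>, where the input ends. The arrays are interleaved in the memory above the input,
  so that none of them needs a size limit.
\<close>

definition tmp :: "nat \<Rightarrow> reg" where "tmp d = 2 * d + 1"

lemma tmp_simps [simp]: "tmp d = tmp d' \<longleftrightarrow> d = d'" "2 * x \<noteq> tmp d" "tmp d \<noteq> 2 * x"
  "x * 2 \<noteq> tmp d" "tmp d \<noteq> x * 2"
  unfolding tmp_def by presburger+

fun offset :: "arr \<Rightarrow> nat" where
  "offset Pool = 0" | "offset Len = 1" | "offset Tup = 2" | "offset Seen = 3"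

definition array_address :: "arr \<Rightarrow> nat \<Rightarrow> prog" where
  "array_address A d = SEQ (ADD (tmp d) (tmp d) (tmp d)) (SEQ (ADD (tmp d) (tmp d) (tmp d))
     (SEQ (LIT (tmp (Suc d)) (offset A)) (SEQ (ADD (tmp d) (tmp d) (tmp (Suc d)))
     (ADD (tmp d) (tmp d) (tmp 0)))))"

text \<open>The temporaries form a stack: the result appears in \<open>tmp d\<close>, and lower ones
  survive. \<open>Input\<close> carries a guard because the cells above the input belong to the
  arrays, while the input function is 0 there.\<close>

fun compile_exp :: "exp \<Rightarrow> nat \<Rightarrow> prog" where
  "compile_exp (Const a) d = LIT (tmp d) a"
| "compile_exp (Var x) d = SEQ (LIT (tmp d) 0) (ADD (tmp d) (2 * x) (tmp d))"
| "compile_exp (Plus e f) d =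
     SEQ (compile_exp e d) (SEQ (compile_exp f (Suc d)) (ADD (tmp d) (tmp d) (tmp (Suc d))))"
| "compile_exp (Minus e f) d =
     SEQ (compile_exp e d) (SEQ (compile_exp f (Suc d)) (SUB (tmp d) (tmp d) (tmp (Suc d))))"
| "compile_exp (Times e f) d =
     SEQ (compile_exp e d) (SEQ (compile_exp f (Suc d))
       (SEQ (LIT (tmp (Suc (Suc d))) 0) (SEQ (LIT (tmp (Suc (Suc (Suc d)))) 1)
       (SEQ (WHILENZ (tmp d) (SEQ (ADD (tmp (Suc (Suc d))) (tmp (Suc (Suc d))) (tmp (Suc d)))
                                  (SUB (tmp d) (tmp d) (tmp (Suc (Suc (Suc d)))))))
       (ADD (tmp d) (tmp d) (tmp (Suc (Suc d))))))))"
| "compile_exp (Input e) d =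
     SEQ (compile_exp e d) (SEQ (SUB (tmp (Suc d)) (tmp 0) (tmp d))
       (IFNZ (tmp (Suc d)) (LOAD (tmp d) (tmp d)) (LIT (tmp d) 0)))"
| "compile_exp (Get A e) d =
     SEQ (compile_exp e d) (SEQ (array_address A d) (LOAD (tmp d) (tmp d)))"

text \<open>A loop counts down in \<open>tmp d\<close> and up in \<open>tmp (Suc d)\<close>. The
  program variable is refreshed from the latter in every iteration, so assignments to it in the body
  cannot disturb the loop.\<close>

fun compile :: "com \<Rightarrow> nat \<Rightarrow> prog" where
  "compile Nop d = SKIP"
| "compile (Assign x e) d =
     SEQ (compile_exp e d) (SEQ (LIT (tmp (Suc d)) 0) (ADD (2 * x) (tmp d) (tmp (Suc d))))"
| "compile (Put A e f) d =
     SEQ (compile_exp e d) (SEQ (array_address A d)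
       (SEQ (compile_exp f (Suc d)) (STORE (tmp d) (tmp (Suc d)))))"
| "compile (Semi c1 c2) d = SEQ (compile c1 d) (compile c2 d)"
| "compile (Cond e c1 c2) d = SEQ (compile_exp e d) (IFNZ (tmp d) (compile c1 d) (compile c2 d))"
| "compile (For x e c) d =
     SEQ (compile_exp e d) (SEQ (LIT (tmp (Suc d)) 0)
       (WHILENZ (tmp d) (SEQ (LIT (tmp (Suc (Suc d))) 0) (SEQ (ADD (2 * x) (tmp (Suc d)) (tmp (Suc (Suc d))))
          (SEQ (compile c (Suc (Suc d))) (SEQ (LIT (tmp (Suc (Suc d))) 1)
          (SEQ (ADD (tmp (Suc d)) (tmp (Suc d)) (tmp (Suc (Suc d))))
               (SUB (tmp d) (tmp d) (tmp (Suc (Suc d)))))))))))"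

text \<open>These are coefficients of \<open>Z + 1\<close>, not step counts; the 7 for a product
  covers three steps for each of at most \<open>Z\<close> additions and the four steps around
  them.\<close>

fun exp_cost :: "exp \<Rightarrow> nat" where
  "exp_cost (Const a) = 1"
| "exp_cost (Var x) = 2"
| "exp_cost (Plus e f) = exp_cost e + exp_cost f + 1"
| "exp_cost (Minus e f) = exp_cost e + exp_cost f + 1"
| "exp_cost (Times e f) = exp_cost e + exp_cost f + 7"
| "exp_cost (Input e) = exp_cost e + 3"
| "exp_cost (Get A e) = exp_cost e + 6"

fun com_cost :: "com \<Rightarrow> nat" where
  "com_cost Nop = 1"
| "com_cost (Assign x e) = exp_cost e + 2"
| "com_cost (Put A e f) = exp_cost e + exp_cost f + 6"
| "com_cost (Semi c d) = com_cost c + com_cost d"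
| "com_cost (Cond e c d) = exp_cost e + com_cost c + com_cost d + 1"
| "com_cost (For x e c) = exp_cost e + com_cost c + 8"

text \<open>The exponent of \<open>Z + 1\<close> in the running time. Atomic commands count 1
  because their expressions may multiply.\<close>

fun depth :: "com \<Rightarrow> nat" where
  "depth (Semi c d) = max (depth c) (depth d)"
| "depth (Cond e c d) = max (depth c) (depth d)"
| "depth (For x e c) = Suc (depth c)"
| "depth _ = 1"

text \<open>A weakest precondition with the step count visible. As the machine is deterministic, the
  existential quantifier expresses total correctness.\<close>

definition runs :: "prog \<Rightarrow> state \<Rightarrow> (nat \<Rightarrow> state \<Rightarrow> bool) \<Rightarrow> bool" where
  "runs p s Q \<longleftrightarrow> (\<exists>t s'. exec p s t s' \<and> Q t s')"

lemma runs_mono: "runs p s Q \<Longrightarrow> (\<And>t s'. Q t s' \<Longrightarrow> Q' t s') \<Longrightarrow> runs p s Q'"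
  unfolding runs_def by blast

inductive_simps exec_simps:
  "exec SKIP s t s'" "exec (LIT x a) s t s'" "exec (ADD x y z) s t s'" "exec (SUB x y z) s t s'"
  "exec (LOAD x y) s t s'" "exec (STORE x y) s t s'" "exec (SEQ p q) s t s'" "exec (IFNZ x p q) s t s'"

lemma runs_simps [simp]:
  "runs SKIP s Q \<longleftrightarrow> Q 1 s"
  "runs (LIT x a) (r, m) Q \<longleftrightarrow> Q 1 (r(x := a), m)"
  "runs (ADD x y z) (r, m) Q \<longleftrightarrow> Q 1 (r(x := r y + r z), m)"
  "runs (SUB x y z) (r, m) Q \<longleftrightarrow> Q 1 (r(x := r y - r z), m)"
  "runs (LOAD x y) (r, m) Q \<longleftrightarrow> Q 1 (r(x := m (r y)), m)"
  "runs (STORE x y) (r, m) Q \<longleftrightarrow> Q 1 (r, m(r x := r y))"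
  "runs (SEQ p q) s Q \<longleftrightarrow> runs p s (\<lambda>t s'. runs q s' (\<lambda>t'. Q (t + t')))"
  "runs (IFNZ x p q) s Q \<longleftrightarrow>
     (if fst s x > 0 then runs p s (\<lambda>t. Q (t + 1)) else runs q s (\<lambda>t. Q (t + 1)))"
  unfolding runs_def exec_simps by (simp_all add: ex_simps, blast+)

text \<open>The shape of all compiled loops: \<open>b\<close> iterations are done when the control
  register holds \<open>B - b\<close>. The 1 added to \<open>T\<close> is the test of the
  condition.\<close>

lemma runs_countdown:
  assumes "I 0 s"
    and "\<And>b s. I b s \<Longrightarrow> fst s x = B - b"
    and "\<And>b s. I b s \<Longrightarrow> b < B \<Longrightarrow> runs p s (\<lambda>t s'. t \<le> T \<and> I (Suc b) s')"
  shows "runs (WHILENZ x p) s (\<lambda>t s'. t \<le> B * (T + 1) + 1 \<and> I B s')"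
proof -
  have "runs (WHILENZ x p) s (\<lambda>t s'. t \<le> (B - b) * (T + 1) + 1 \<and> I B s')" if "I b s" "b \<le> B" for b s
    using that(2,1)
  proof (induction arbitrary: s rule: inc_induct)
    case base
    then show ?case using assms(2)[OF base] exec.LoopF[of s x p] unfolding runs_def by fastforce
  next
    case (step b)
    obtain t s' where 1: "exec p s t s'" "t \<le> T" "I (Suc b) s'"
      using assms(3)[OF step.prems step.hyps(2)] unfolding runs_def by blast
    obtain t' s'' where 2: "exec (WHILENZ x p) s' t' s''" "t' \<le> (B - Suc b) * (T + 1) + 1" "I B s''"
      using step.IH[OF 1(3)] unfolding runs_def by blast
    have "fst s x > 0" using assms(2)[OF step.prems] step.hyps(2) by simp
    then have "exec (WHILENZ x p) s (t + t' + 1) s''" using 1(1) 2(1) by (rule exec.LoopT)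
    moreover have "B - b = Suc (B - Suc b)" using step.hyps(2) by simp
    then have "t + t' + 1 \<le> (B - b) * (T + 1) + 1" using 1(2) 2(2) by simp
    ultimately show ?case using 2(3) unfolding runs_def by blast
  qed
  from this[OF assms(1)] show ?thesis by simp
qed

definition rep :: "nat \<Rightarrow> (nat \<Rightarrow> nat) \<Rightarrow> store \<Rightarrow> state \<Rightarrow> bool" where
  "rep N inp s \<sigma> \<longleftrightarrow> (\<forall>x. fst \<sigma> (2 * x) = fst s x) \<and> fst \<sigma> (tmp 0) = N \<and>
     (\<forall>a<N. snd \<sigma> a = inp a) \<and> (\<forall>A b. snd \<sigma> (N + 4 * b + offset A) = snd s A b)"

lemma rep_cong: "rep N inp s (r, m) \<Longrightarrow> (\<And>x. r' (2 * x) = r (2 * x)) \<Longrightarrow> r' (tmp 0) = r (tmp 0) \<Longrightarrow> rep N inp s (r', m)"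
  unfolding rep_def by auto

lemma address_eq_iff: "N + 4 * b + offset A = N + 4 * b' + offset A' \<longleftrightarrow> b = b' \<and> A = A'"
  by (cases A; cases A') (simp; presburger)+

lemma runs_array_address:
  assumes "r (tmp 0) = N" "0 < d"
  shows "runs (array_address A d) (r, m) (\<lambda>t s'. \<exists>r'. s' = (r', m) \<and> t = 5 \<and> r' (tmp d) = N + 4 * r (tmp d) + offset A \<and>
     (\<forall>x. r' (2 * x) = r (2 * x)) \<and> (\<forall>d'<d. r' (tmp d') = r (tmp d')))"
  using assms unfolding array_address_def by (auto)

lemma compile_exp_correct:
  assumes "\<And>a. N \<le> a \<Longrightarrow> inp a = 0"
    and "rep N inp s (r, m)" "exp_ok inp Z e s" "0 < d"
  shows "runs (compile_exp e d) (r, m) (\<lambda>t s'. \<exists>r'. s' = (r', m) \<and> t \<le> exp_cost e * (Z + 1) \<and>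
     r' (tmp d) = eval inp e s \<and> (\<forall>x. r' (2 * x) = r (2 * x)) \<and> (\<forall>d'<d. r' (tmp d') = r (tmp d')))"
  using assms(2-4)
proof (induction e arbitrary: d r)
  case (Const a)
  then show ?case by (auto)
next
  case (Var x)
  then show ?case by (auto simp: rep_def)
next
  case (Plus e f)
  show ?case
    unfolding compile_exp.simps runs_simps(7)
    apply (rule runs_mono[OF Plus.IH(1)])
    using Plus.prems apply simp_all[3]
    apply clarify
    apply (rule runs_mono[OF Plus.IH(2)])
    using Plus.prems apply (auto intro: rep_cong)[3]
    apply (auto simp: algebra_simps)
    done
next
  case (Minus e f)
  show ?case
    unfolding compile_exp.simps runs_simps(7)
    apply (rule runs_mono[OF Minus.IH(1)])
    using Minus.prems apply simp_all[3]
    apply clarify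
    apply (rule runs_mono[OF Minus.IH(2)])
    using Minus.prems apply (auto intro: rep_cong)[3]
    apply (auto simp: algebra_simps)
    done
next
  case (Times e f)
  have loop: "runs (WHILENZ (tmp d) (SEQ (ADD (tmp (Suc (Suc d))) (tmp (Suc (Suc d))) (tmp (Suc d)))
                                  (SUB (tmp d) (tmp d) (tmp (Suc (Suc (Suc d))))))) (r, m)
      (\<lambda>t s'. t \<le> r (tmp d) * 3 + 1 \<and>
         (\<exists>r'. s' = (r', m) \<and> r' (tmp d) = 0 \<and> r' (tmp (Suc (Suc d))) = r (tmp d) * r (tmp (Suc d)) \<and>
           (\<forall>x. r' (2 * x) = r (2 * x)) \<and> (\<forall>d'<d. r' (tmp d') = r (tmp d'))))"
    if "r (tmp (Suc (Suc (Suc d)))) = 1" "r (tmp (Suc (Suc d))) = 0" for r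
  proof -
    define I where "I b s' \<longleftrightarrow> (\<exists>r'. s' = (r', m) \<and> r' (tmp d) = r (tmp d) - b \<and>
        r' (tmp (Suc (Suc d))) = b * r (tmp (Suc d)) \<and> r' (tmp (Suc d)) = r (tmp (Suc d)) \<and> r' (tmp (Suc (Suc (Suc d)))) = 1 \<and>
        (\<forall>x. r' (2 * x) = r (2 * x)) \<and> (\<forall>d'<d. r' (tmp d') = r (tmp d')))" for b and s' :: state
    have "I 0 (r, m)" unfolding I_def using that by simp
    then have "runs (WHILENZ (tmp d) (SEQ (ADD (tmp (Suc (Suc d))) (tmp (Suc (Suc d))) (tmp (Suc d)))
                                  (SUB (tmp d) (tmp d) (tmp (Suc (Suc (Suc d))))))) (r, m)
      (\<lambda>t s'. t \<le> r (tmp d) * (2 + 1) + 1 \<and> I (r (tmp d)) s')"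
      by (rule runs_countdown) (auto simp: I_def)
    then show ?thesis by (rule runs_mono) (auto simp: I_def)
  qed
  have le: "eval inp e s \<le> Z" using Times.prems by simp
  show ?case
    unfolding compile_exp.simps runs_simps(7)
    apply (rule runs_mono[OF Times.IH(1)])
    using Times.prems apply simp_all[3]
    apply clarify
    apply (rule runs_mono[OF Times.IH(2)])
    using Times.prems apply (auto intro: rep_cong)[3]
    apply clarify
    apply (simp only: runs_simps(2))
    apply (rule runs_mono[OF loop])
    using le apply (auto simp: algebra_simps)
    done
next
  case (Input e)
  show ?case
    unfolding compile_exp.simps runs_simps(7)
    apply (rule runs_mono[OF Input.IH])
    using Input.prems apply simp_all[3]
    using Input.prems(1,3) assms(1) apply (auto simp: rep_def add_mult_distrib)
    done
next
  case (Get A e)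
  show ?case
    unfolding compile_exp.simps runs_simps(7)
    apply (rule runs_mono[OF Get.IH])
    using Get.prems apply simp_all[3]
    apply clarify
    apply (rule runs_mono[OF runs_array_address[where N = N]])
    using Get.prems(1,3) apply (auto simp: rep_def add_mult_distrib)
    done
qed


lemma depth_pos: "0 < depth c"
  by (induction c) auto

lemma compile_correct:
  assumes inp: "\<And>a. N \<le> a \<Longrightarrow> inp a = 0"
    and "rep N inp s \<sigma>" "com_ok inp Z c s" "0 < d"
  shows "runs (compile c d) \<sigma> (\<lambda>t s'. t \<le> com_cost c * (Z + 1) ^ depth c \<and> rep N inp (sem inp c s) s' \<and>
     (\<forall>d'<d. fst s' (tmp d') = fst \<sigma> (tmp d')))"
  using assms(2-4)
proof (induction c arbitrary: d s \<sigma>)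
  case Nop
  then show ?case by simp
next
  case (Assign x e)
  obtain r m where [simp]: "\<sigma> = (r, m)" by (cases \<sigma>)
  show ?case
    unfolding compile.simps runs_simps(7) \<open>\<sigma> = _\<close>
    apply (rule runs_mono[OF compile_exp_correct[where N = N and s = s and Z = Z and inp = inp]])
    using inp Assign.prems apply simp_all[4]
    using Assign.prems apply (auto simp: rep_def set_var_def)
    done
next
  case (Put A e f)
  obtain r m where [simp]: "\<sigma> = (r, m)" by (cases \<sigma>)
  have upd: "rep N inp (fst s, (snd s)(A := (snd s A)(b := w))) (r', m(N + 4 * b + offset A := w))"
    if "rep N inp s (r', m)" for r' b w
    using that unfolding rep_def by (auto simp: address_eq_iff[of N])
  show ?case
    unfolding compile.simps runs_simps(7) \<open>\<sigma> = _\<close>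
    apply (rule runs_mono[OF compile_exp_correct[where N = N and s = s and Z = Z and inp = inp]])
    using inp Put.prems apply simp_all[4]
    apply clarify
    apply (rule runs_mono[OF runs_array_address[where N = N]])
    using Put.prems apply (simp_all add: rep_def)[2]
    apply clarify
    apply (rule runs_mono[OF compile_exp_correct[where N = N and s = s and Z = Z and inp = inp]])
    using inp Put.prems apply (auto intro: rep_cong)[4]
    apply clarify
    using Put.prems apply (auto intro!: upd intro: rep_cong simp: add_mult_distrib)
    done
next
  case (Semi c1 c2)
  have le: "com_cost c1 * (Z + 1) ^ depth c1 + com_cost c2 * (Z + 1) ^ depth c2 \<le>
      com_cost (Semi c1 c2) * (Z + 1) ^ depth (Semi c1 c2)"
    by (simp add: add_mult_distrib add_mono mult_le_mono2 power_increasing)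
  show ?case
    unfolding compile.simps runs_simps(7)
    apply (rule runs_mono[OF Semi.IH(1)])
    using Semi.prems apply simp_all[3]
    apply clarify
    apply (rule runs_mono[OF Semi.IH(2)])
    using Semi.prems apply simp_all[3]
    using le apply auto
    done
next
  case (Cond e c1 c2)
  obtain r m where [simp]: "\<sigma> = (r, m)" by (cases \<sigma>)
  let ?D = "(Z + 1) ^ depth (Cond e c1 c2)"
  have D: "Z + 1 \<le> ?D" using self_le_power[of "Z + 1" "depth (Cond e c1 c2)"] depth_pos[of c1] by simp
  have le: "exp_cost e * (Z + 1) \<le> exp_cost e * ?D" by (rule mult_le_mono2[OF D])
  have "com_cost c1 * (Z + 1) ^ depth c1 \<le> com_cost c1 * ?D" "com_cost c2 * (Z + 1) ^ depth c2 \<le> com_cost c2 * ?D"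
    by (intro mult_le_mono2 power_increasing; simp)+
  note le = this le D
  have le2: "exp_cost e * (Z + 1) + com_cost c1 * (Z + 1) ^ depth c1 + 1 \<le> com_cost (Cond e c1 c2) * ?D"
      "exp_cost e * (Z + 1) + com_cost c2 * (Z + 1) ^ depth c2 + 1 \<le> com_cost (Cond e c1 c2) * ?D"
    using le unfolding com_cost.simps add_mult_distrib mult_1 by linarith+
  show ?case
    unfolding compile.simps runs_simps(7) \<open>\<sigma> = _\<close>
    apply (rule runs_mono[OF compile_exp_correct[where N = N and s = s and Z = Z and inp = inp]])
    using inp Cond.prems apply simp_all[4]
    apply clarify
    apply (simp only: runs_simps(8))
    apply (cases "eval inp e s > 0")
     apply (simp only: fst_conv if_True)
     apply (rule runs_mono[OF Cond.IH(1)])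
    using Cond.prems apply (auto intro: rep_cong)[3]
    using le2(1) apply (auto simp: Cond.prems)[1]
    apply (simp only: fst_conv if_False)
    apply (rule runs_mono[OF Cond.IH(2)])
    using Cond.prems apply (auto intro: rep_cong)[3]
    using le2(2) apply (auto simp: Cond.prems)[1]
    done
next
  case (For x e c)
  obtain r m where [simp]: "\<sigma> = (r, m)" by (cases \<sigma>)
  define B where "B = eval inp e s"
  define st where "st b = for_loop b (\<lambda>b s. sem inp c (set_var x b s)) s" for b
  define T where "T = com_cost c * (Z + 1) ^ depth c + 5"
  let ?D = "(Z + 1) ^ depth (For x e c)"
  have B: "B \<le> Z" and ok: "\<And>b. b < B \<Longrightarrow> com_ok inp Z c (set_var x b (st b))"
    using For.prems unfolding B_def st_def by auto
  define body where "body = SEQ (LIT (tmp (Suc (Suc d))) 0) (SEQ (ADD (2 * x) (tmp (Suc d)) (tmp (Suc (Suc d))))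
          (SEQ (compile c (Suc (Suc d))) (SEQ (LIT (tmp (Suc (Suc d))) 1)
          (SEQ (ADD (tmp (Suc d)) (tmp (Suc d)) (tmp (Suc (Suc d))))
               (SUB (tmp d) (tmp d) (tmp (Suc (Suc d))))))))"
  define I where "I b s' \<longleftrightarrow> rep N inp (st b) s' \<and> fst s' (tmp d) = B - b \<and> fst s' (tmp (Suc d)) = b \<and>
     (\<forall>d'<d. fst s' (tmp d') = r (tmp d'))" for b and s' :: state
  have loop: "runs (WHILENZ (tmp d) body) s' (\<lambda>t s'. t \<le> B * (T + 1) + 1 \<and> I B s')" if "I 0 s'" for s'
    using that
  proof (rule runs_countdown)
    fix b and s' :: state assume I: "I b s'" and b: "b < B"
    obtain r' m' where [simp]: "s' = (r', m')" by (cases s')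
    have "rep N inp (set_var x b (st b)) (r'(tmp (Suc (Suc d)) := 0, 2 * x := b), m')"
      using I For.prems(3) unfolding I_def rep_def set_var_def by auto
    from For.IH[OF this ok[OF b], of "Suc (Suc d)"]
    show "runs body s' (\<lambda>t s'. t \<le> T \<and> I (Suc b) s')"
      unfolding body_def using I For.prems(3) b
      apply (simp add: I_def)
      apply (erule runs_mono)
      apply (auto simp: rep_def st_def T_def)
      done
  qed (simp add: I_def)
  \<comment> \<open>An iteration costs the body and 6 further steps, and the loop has 2 steps
    besides; the 8 in \<open>com_cost\<close> pays for both.\<close>
  have le: "exp_cost e * (Z + 1) + (1 + (B * (T + 1) + 1)) \<le> com_cost (For x e c) * ?D"
  proof -
    have D: "Z + 1 \<le> ?D" using self_le_power[of "Z + 1" "depth (For x e c)"] by simp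
    have "B * (T + 1) \<le> Z * (T + 1)" using B by (rule mult_le_mono1)
    also have "\<dots> = com_cost c * (Z * (Z + 1) ^ depth c) + 6 * Z" unfolding T_def by (simp add: algebra_simps)
    also have "\<dots> \<le> com_cost c * ?D + 6 * Z" by simp
    finally have "B * (T + 1) + 2 \<le> com_cost c * ?D + 8 * ?D" using D by linarith
    moreover have "exp_cost e * (Z + 1) \<le> exp_cost e * ?D" using D by (rule mult_le_mono2)
    ultimately show ?thesis by (simp add: add_mult_distrib del: power_Suc)
  qed
  show ?case
    unfolding compile.simps runs_simps(7) body_def[symmetric] \<open>\<sigma> = _\<close>
    apply (rule runs_mono[OF compile_exp_correct[where N = N and s = s and Z = Z and inp = inp]])
    using inp For.prems apply simp_all[4]
    apply clarify
    apply (simp only: runs_simps(2))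
    apply (rule runs_mono[OF loop])
    using For.prems apply (auto simp: I_def st_def B_def rep_def)[1]
    using le apply (auto simp: I_def st_def B_def)
    done
qed

section \<open>Verification of loop programs, with the conditions for the time bound
  included\<close>

definition wp :: "(nat \<Rightarrow> nat) \<Rightarrow> nat \<Rightarrow> com \<Rightarrow> (store \<Rightarrow> bool) \<Rightarrow> store \<Rightarrow> bool" where
  "wp inp Z c Q s \<longleftrightarrow> com_ok inp Z c s \<and> Q (sem inp c s)"

fun writes :: "com \<Rightarrow> nat set" where
  "writes Nop = {}"
| "writes (Assign x e) = {x}"
| "writes (Put A e f) = {}"
| "writes (Semi c d) = writes c \<union> writes d"
| "writes (Cond e c d) = writes c \<union> writes d"
| "writes (For x e c) = insert x (writes c)"

fun array_writes :: "com \<Rightarrow> arr set" where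
  "array_writes Nop = {}"
| "array_writes (Assign x e) = {}"
| "array_writes (Put A e f) = {A}"
| "array_writes (Semi c d) = array_writes c \<union> array_writes d"
| "array_writes (Cond e c d) = array_writes c \<union> array_writes d"
| "array_writes (For x e c) = array_writes c"

definition agree :: "nat set \<Rightarrow> arr set \<Rightarrow> store \<Rightarrow> store \<Rightarrow> bool" where
  "agree X AS s s' \<longleftrightarrow> (\<forall>x. x \<notin> X \<longrightarrow> fst s' x = fst s x) \<and> (\<forall>A. A \<notin> AS \<longrightarrow> snd s' A = snd s A)"

lemma sem_agree: "agree (writes c) (array_writes c) s (sem inp c s)"
proof (induction c arbitrary: s)
  case (For x e c)
  have "agree (insert x (writes c)) (array_writes c) s (for_loop b (\<lambda>b s. sem inp c (set_var x b s)) s)" for b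
  proof (induction b)
    case (Suc b)
    then show ?case
      using For[of "set_var x b (for_loop b (\<lambda>b s. sem inp c (set_var x b s)) s)"]
      by (auto simp: agree_def set_var_def)
  qed (simp add: agree_def)
  then show ?case by simp
qed (auto simp: agree_def set_var_def)

text \<open>The syntactic frame comes for free, so postconditions mention only what a command is
  meant to change.\<close>

lemma wp_mono: "wp inp Z c Q s \<Longrightarrow> (\<And>s'. Q s' \<Longrightarrow> agree (writes c) (array_writes c) s s' \<Longrightarrow> Q' s') \<Longrightarrow> wp inp Z c Q' s"
  unfolding wp_def using sem_agree by blast

lemma wp_simps:
  "wp inp Z Nop Q s \<longleftrightarrow> Q s"
  "wp inp Z (Assign x e) Q s \<longleftrightarrow> exp_ok inp Z e s \<and> Q (set_var x (eval inp e s) s)"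
  "wp inp Z (Put A e f) Q s \<longleftrightarrow> exp_ok inp Z e s \<and> exp_ok inp Z f s \<and>
     Q (fst s, (snd s)(A := (snd s A)(eval inp e s := eval inp f s)))"
  "wp inp Z (Semi c d) Q s \<longleftrightarrow> wp inp Z c (wp inp Z d Q) s"
  "wp inp Z (Cond e c d) Q s \<longleftrightarrow> exp_ok inp Z e s \<and> (if eval inp e s > 0 then wp inp Z c Q s else wp inp Z d Q s)"
  unfolding wp_def by auto

text \<open>\<open>I b\<close> describes the state after \<open>b\<close> iterations. The frame
  relative to the entry state is supplied again at every iteration and at the exit, which keeps
  constant variables out of the invariants.\<close>

lemma wp_For:
  assumes "exp_ok inp Z e s" "eval inp e s \<le> Z" "I 0 s"
    and "\<And>b s'. b < eval inp e s \<Longrightarrow> I b s' \<Longrightarrow> agree (insert x (writes c)) (array_writes c) s s' \<Longrightarrow>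
           wp inp Z c (I (Suc b)) (set_var x b s')"
    and "\<And>s'. I (eval inp e s) s' \<Longrightarrow> agree (insert x (writes c)) (array_writes c) s s' \<Longrightarrow> Q s'"
  shows "wp inp Z (For x e c) Q s"
proof -
  define st where "st b = for_loop b (\<lambda>b s. sem inp c (set_var x b s)) s" for b
  have agr: "agree (insert x (writes c)) (array_writes c) s (st b)" for b
    using sem_agree[of "For x (Const b) c" s inp] unfolding st_def by simp
  have I: "I b (st b)" if "b \<le> eval inp e s" for b
    using that
  proof (induction b)
    case 0
    then show ?case using assms(3) unfolding st_def by simp
  next
    case (Suc b)
    then have "wp inp Z c (I (Suc b)) (set_var x b (st b))" using assms(4) agr by simp
    then show ?case unfolding wp_def st_def by simp
  qed
  then have "com_ok inp Z c (set_var x b (st b))" if "b < eval inp e s" for b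
    using assms(4)[OF that I agr] that unfolding wp_def by simp
  then have "com_ok inp Z (For x e c) s" using assms(1,2) unfolding st_def by simp
  moreover have "Q (sem inp (For x e c) s)"
    using assms(5)[OF I[OF le_refl] agr] unfolding st_def by simp
  ultimately show ?thesis unfolding wp_def by blast
qed

section \<open>The program\<close>

text \<open>Variable 0 is register 0, which receives \<open>n\<close> and finally the answer.
  Variable 2 is register 4, where the prelude puts \<open>k\<close>, since register 1 is reserved
  for \<open>n * n\<close>.\<close>

abbreviation (input) vN :: nat where "vN \<equiv> 0"
abbreviation (input) vK :: nat where "vK \<equiv> 2"
abbreviation (input) vL :: nat where "vL \<equiv> 3"
abbreviation (input) vR :: nat where "vR \<equiv> 4"
abbreviation (input) vStamp :: nat where "vStamp \<equiv> 5"
abbreviation (input) vT :: nat where "vT \<equiv> 6"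
abbreviation (input) vV :: nat where "vV \<equiv> 7"
abbreviation (input) vRound :: nat where "vRound \<equiv> 8"
abbreviation (input) vU :: nat where "vU \<equiv> 9"
abbreviation (input) vIt :: nat where "vIt \<equiv> 10"
abbreviation (input) vM :: nat where "vM \<equiv> 11"
abbreviation (input) vP :: nat where "vP \<equiv> 12"
abbreviation (input) vB :: nat where "vB \<equiv> 13"
abbreviation (input) vQ :: nat where "vQ \<equiv> 14"
abbreviation (input) vD :: nat where "vD \<equiv> 15"
abbreviation (input) vI :: nat where "vI \<equiv> 16"
abbreviation (input) vZ :: nat where "vZ \<equiv> 17"
abbreviation (input) vC :: nat where "vC \<equiv> 18"
abbreviation (input) vX :: nat where "vX \<equiv> 19"
abbreviation (input) vF :: nat where "vF \<equiv> 20"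
abbreviation (input) vY :: nat where "vY \<equiv> 21"
abbreviation (input) vW :: nat where "vW \<equiv> 22"
abbreviation (input) vBad :: nat where "vBad \<equiv> 23"
abbreviation (input) vHas :: nat where "vHas \<equiv> 24"
abbreviation (input) vS :: nat where "vS \<equiv> 25"
abbreviation (input) vAns :: nat where "vAns \<equiv> 26"

text \<open>With truncated subtraction the inner sum is the distance of the two values.\<close>

definition eqE :: "exp \<Rightarrow> exp \<Rightarrow> exp" where
  "eqE e f = Minus (Const 1) (Plus (Minus e f) (Minus f e))"

definition leE :: "exp \<Rightarrow> exp \<Rightarrow> exp" where
  "leE e f = Minus (Plus f (Const 1)) e"

text \<open>The pools are the columns of a table with \<open>n\<close> columns, so that each can
  grow without limit.\<close>

definition poolE :: "exp \<Rightarrow> exp \<Rightarrow> exp" where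
  "poolE z v = Get Pool (Plus (Times z (Var vN)) v)"

definition adjE :: "exp \<Rightarrow> exp \<Rightarrow> exp" where
  "adjE x y = Input (Plus (Times x (Var vN)) y)"

definition bitE :: "exp \<Rightarrow> exp \<Rightarrow> exp" where
  "bitE x y = Plus (eqE x y) (Plus (adjE x y) (adjE x y))"

lemma exp_simps [simp]:
  "eval inp (eqE e f) s = (if eval inp e s = eval inp f s then 1 else 0)"
  "eval inp (poolE e f) s = snd s Pool (eval inp e s * fst s vN + eval inp f s)"
  "eval inp (adjE e f) s = inp (eval inp e s * fst s vN + eval inp f s)"
  "eval inp (leE e f) s = eval inp f s + 1 - eval inp e s"
  "exp_ok inp Z (eqE e f) s \<longleftrightarrow> exp_ok inp Z e s \<and> exp_ok inp Z f s"
  "exp_ok inp Z (leE e f) s \<longleftrightarrow> exp_ok inp Z e s \<and> exp_ok inp Z f s"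
  "exp_ok inp Z (poolE e f) s \<longleftrightarrow> exp_ok inp Z e s \<and> exp_ok inp Z f s \<and> eval inp e s \<le> Z"
  "exp_ok inp Z (adjE e f) s \<longleftrightarrow> exp_ok inp Z e s \<and> exp_ok inp Z f s \<and> eval inp e s \<le> Z"
  unfolding eqE_def poolE_def adjE_def leE_def by auto

definition power_com :: "exp \<Rightarrow> com" where
  "power_com e = Semi (Assign vP (Const 1)) (For vW e (Assign vP (Times (Var vB) (Var vP))))"

text \<open>Division by repeated subtraction. The dividend is a crude loop count; once the remainder
  is below the divisor, iterations do nothing.\<close>

definition divmod_com :: com where
  "divmod_com = Semi (Assign vD (Var vQ)) (Semi (Assign vQ (Const 0))
     (For vW (Var vD) (Cond (leE (Var vB) (Var vD))
        (Semi (Assign vD (Minus (Var vD) (Var vB))) (Assign vQ (Plus (Var vQ) (Const 1)))) Nop)))"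

text \<open>A tuple is read off as the base-\<open>vB\<close> digits of a counter, so that one
  counted loop enumerates all tuples.\<close>

definition decode_com :: "nat \<Rightarrow> com" where
  "decode_com x = Semi (Assign vQ (Var vIt)) (For vI (Var x) (Semi divmod_com (Put Tup (Var vI) (Var vD))))"

definition append_com :: com where
  "append_com = Semi (Assign vF (Const 0))
     (Semi (For vZ (Get Len (Var vV))
        (Assign vF (Plus (Var vF) (eqE (poolE (Var vZ) (Var vV)) (Var vX)))))
     (Cond (Var vF) Nop
        (Semi (Put Pool (Plus (Times (Get Len (Var vV)) (Var vN)) (Var vV)) (Var vX))
              (Put Len (Var vV) (Plus (Get Len (Var vV)) (Const 1))))))"

definition append_tuple_com :: com where
  "append_tuple_com = For vI (Var vL) (Semi (Assign vX (Get Tup (Var vI))) append_com)"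

definition digit_com :: "exp \<Rightarrow> com" where
  "digit_com e = Assign vC (Plus (Times (Const 4) (Var vC)) (bitE (Get Tup (Var vI)) e))"

definition code_com :: com where
  "code_com = Semi (Assign vC (Const 0)) (For vI (Var vL)
     (Semi (For vZ (Var vM) (digit_com (poolE (Var vZ) (Var vV))))
           (For vZ (Var vL) (digit_com (Get Tup (Var vZ))))))"

definition pick_com :: com where
  "pick_com = Semi code_com (Cond (eqE (Get Seen (Var vC)) (Var vStamp)) Nop
     (Semi (Put Seen (Var vC) (Var vStamp)) append_tuple_com))"

definition lookup_com :: com where
  "lookup_com = For vI (Var vL) (Put Tup (Var vI) (poolE (Get Tup (Var vI)) (Var vU)))"

text \<open>\<open>v\<close> is skipped: its pool is the one that changes during the
  enumeration.\<close>

definition tuples_com :: com where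
  "tuples_com = For vU (Var vN) (Cond (eqE (Var vU) (Var vV)) Nop
     (Semi (Assign vB (Get Len (Var vU))) (Semi (power_com (Var vL))
     (For vIt (Var vP) (Semi (decode_com vL) (Semi lookup_com pick_com))))))"

text \<open>\<open>vM\<close> freezes the length before the loop appends anything: neighbors are
  counted in the pool as left by the tuples, which is the \<open>Q\<close> of
  \<open>saturates\<close>.\<close>

definition heavy_com :: "nat \<Rightarrow> com" where
  "heavy_com j = Semi (Assign vM (Get Len (Var vV))) (For vY (Var vN) (Semi (Assign vC (Const 0))
     (Semi (For vZ (Var vM) (Assign vC (Plus (Var vC) (adjE (Var vY) (poolE (Var vZ) (Var vV))))))
     (Cond (leE (Const j) (Var vC)) (Semi (Assign vX (Var vY)) append_com) Nop))))"

text \<open>Raising the stamp makes all marks of earlier rounds expire. Here \<open>vM\<close> is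
  the length at entry: types are taken over the pool before the round, although it grows
  meanwhile.\<close>

definition round_com :: "nat \<Rightarrow> com" where
  "round_com j = Semi (Assign vStamp (Plus (Var vStamp) (Const 1)))
     (Semi (Assign vM (Get Len (Var vV))) (Semi tuples_com (heavy_com j)))"

definition build_com :: "nat \<Rightarrow> com" where
  "build_com j = Semi (Put Pool (Var vV) (Var vV)) (Semi (Put Len (Var vV) (Const 1))
     (For vRound (Var vR) (round_com j)))"

text \<open>\<open>vBad\<close> counts violations. Starting \<open>vF\<close> at
  \<open>1 - s\<close> exempts color 0 from the search for a supporting neighbor; the color as a
  factor exempts uncolored vertices from properness.\<close>

definition check_com :: com where
  "check_com = Semi (Assign vBad (Const 0)) (Semi (Assign vHas (Const 0)) (For vI (Var vM)
     (Semi (Assign vHas (Plus (Var vHas) (eqE (Get Tup (Var vI)) (Var vK))))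
     (Semi (For vZ (Var vM) (Assign vBad (Plus (Var vBad)
        (Times (Get Tup (Var vI)) (Times (eqE (Get Tup (Var vI)) (Get Tup (Var vZ)))
           (adjE (poolE (Var vI) (Var vV)) (poolE (Var vZ) (Var vV))))))))
     (For vS (Get Tup (Var vI)) (Semi (Assign vF (Minus (Const 1) (Var vS)))
        (Semi (For vZ (Var vM) (Assign vF (Plus (Var vF) (Times (eqE (Get Tup (Var vZ)) (Var vS))
           (adjE (poolE (Var vI) (Var vV)) (poolE (Var vZ) (Var vV)))))))
        (Assign vBad (Plus (Var vBad) (Minus (Const 1) (Var vF))))))))))) "

definition decide_com :: com where
  "decide_com = For vV (Var vN) (Semi (Assign vM (Get Len (Var vV))) (Semi (Assign vB (Plus (Var vK) (Const 1)))
     (Semi (power_com (Var vM)) (For vIt (Var vP) (Semi (decode_com vM) (Semi check_com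
        (Cond (Times (Minus (Const 1) (Var vBad)) (Var vHas)) (Assign vAns (Const 1)) Nop)))))))"

definition main_com :: "nat \<Rightarrow> com" where
  "main_com j = Semi (Semi (Assign vB (Const 2)) (Semi (power_com (Var vK)) (Semi (Assign vL (Var vP))
       (Assign vR (Plus (Times (Const j) (Var vL)) (Const 1))))))
     (Semi (For vT (Var vK) (For vV (Var vN) (build_com j)))
     (Semi decide_com (Assign vN (Var vAns))))"

section \<open>Arithmetic subroutines\<close>

lemma wp_power:
  assumes "exp_ok inp Z e (set_var vP 1 s)" "eval inp e (set_var vP 1 s) \<le> Z" "fst s vB \<le> Z"
  shows "wp inp Z (power_com e) (\<lambda>s'. fst s' vP = fst s vB ^ eval inp e (set_var vP 1 s)) s"
proof -
  show ?thesis
    unfolding power_com_def wp_simps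
    apply (simp del: One_nat_def)
    apply (rule wp_For[where I = "\<lambda>b s'. fst s' vP = fst s vB ^ b"])
    using assms apply (simp_all add: wp_simps set_var_def agree_def del: One_nat_def)
    done
qed

lemma wp_divmod:
  assumes "fst s vQ \<le> Z" "0 < fst s vB"
  shows "wp inp Z divmod_com (\<lambda>s'. fst s' vQ = fst s vQ div fst s vB \<and> fst s' vD = fst s vQ mod fst s vB) s"
proof -
  define q B where "q = fst s vQ" and "B = fst s vB"
  \<comment> \<open>\<open>x = q\<close> means that every iteration has subtracted;
    \<open>q * B + d = q\<close> with positive \<open>B\<close> then forces
    \<open>d = 0\<close>.\<close>
  have unique: "x = q div B \<and> d = q mod B" if "x * B + d = q" "x = q \<or> d < B" for x d
  proof -
    have "d < B" using that assms(2) unfolding B_def[symmetric] by (cases B) auto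
    then show ?thesis using that(1) by auto
  qed
  let ?I = "\<lambda>b s'. fst s' vQ * B + fst s' vD = q \<and> (fst s' vQ = b \<or> fst s' vD < B)"
  show ?thesis
    unfolding divmod_com_def wp_simps set_var_def
  proof (simp, rule wp_For[where I = ?I])
    fix b and s' :: store
    assume I: "?I b s'" and "agree (insert vW (writes (Cond (leE (Var vB) (Var vD))
        (Semi (Assign vD (Minus (Var vD) (Var vB))) (Assign vQ (Plus (Var vQ) (Const (Suc 0))))) Nop)))
      (array_writes (Cond (leE (Var vB) (Var vD))
        (Semi (Assign vD (Minus (Var vD) (Var vB))) (Assign vQ (Plus (Var vQ) (Const (Suc 0))))) Nop))
      ((fst s)(vD := fst s vQ, vQ := 0), snd s) s'"
    then have B: "fst s' vB = B" unfolding agree_def B_def by simp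
    show "wp inp Z (Cond (leE (Var vB) (Var vD))
        (Semi (Assign vD (Minus (Var vD) (Var vB))) (Assign vQ (Plus (Var vQ) (Const (Suc 0))))) Nop) (?I (Suc b))
        (set_var vW b s')"
      using I by (auto simp: wp_simps set_var_def B algebra_simps)
  qed (use assms unique in \<open>auto simp: q_def B_def\<close>)
qed

lemma wp_decode:
  assumes "fst s vIt \<le> Z" "0 < fst s vB" "fst s x \<le> Z" "x \<notin> {vQ, vI, vD, vW}"
  shows "wp inp Z (decode_com x) (\<lambda>s'. \<forall>l < fst s x. snd s' Tup l = fst s vIt div fst s vB ^ l mod fst s vB) s"
  unfolding decode_com_def wp_simps
  apply (simp add: set_var_def)
  apply (rule wp_For[where I = "\<lambda>b s'. fst s' vQ = fst s vIt div fst s vB ^ b \<and>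
      (\<forall>l < b. snd s' Tup l = fst s vIt div fst s vB ^ l mod fst s vB)"])
  using assms apply (simp_all)[3]
  subgoal for b s'
    unfolding wp_simps
    apply (rule wp_mono[OF wp_divmod])
    using assms apply (auto simp: set_var_def agree_def divmod_com_def intro: le_trans[OF div_le_dividend])[2]
    using assms apply (auto simp: set_var_def agree_def divmod_com_def less_Suc_eq div_mult2_eq[symmetric] mult.commute)
    done
  subgoal for s' using assms by auto
  done

section \<open>Pools and type codes\<close>

lemmas com_defs = power_com_def divmod_com_def decode_com_def append_com_def append_tuple_com_def digit_com_def
  code_com_def pick_com_def lookup_com_def tuples_com_def heavy_com_def round_com_def build_com_def
  check_com_def decide_com_def main_com_def

definition snoc_new :: "'a list \<Rightarrow> 'a \<Rightarrow> 'a list" where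
  "snoc_new xs x = (if x \<in> set xs then xs else xs @ [x])"

text \<open>The old list stays a prefix, so positions below a length recorded earlier keep their
  meaning while the pool grows.\<close>

lemma foldl_snoc_new:
  "set (foldl snoc_new xs ys) = set xs \<union> set ys"
  "distinct xs \<Longrightarrow> distinct (foldl snoc_new xs ys)"
  "length (foldl snoc_new xs ys) \<le> length xs + length ys"
  "take (length xs) (foldl snoc_new xs ys) = xs"
  "length xs \<le> length (foldl snoc_new xs ys)"
proof (induction ys rule: rev_induct)
  case (snoc y ys)
  {
    case 1 then show ?case using snoc(1) by (auto simp: snoc_new_def)
  next
    case 2 then show ?case using snoc(2) by (auto simp: snoc_new_def)
  next
    case 3 then show ?case using snoc(3) by (auto simp: snoc_new_def)
  next
    case 4 then show ?case using snoc(4,5) by (auto simp: snoc_new_def)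
  next
    case 5 then show ?case using snoc(5) by (auto simp: snoc_new_def)
  }
qed auto

definition pool :: "nat \<Rightarrow> (arr \<Rightarrow> nat \<Rightarrow> nat) \<Rightarrow> nat \<Rightarrow> nat list" where
  "pool n a v = map (\<lambda>z. a Pool (z * n + v)) [0..<a Len v]"

lemma length_pool [simp]: "length (pool n a v) = a Len v"
  unfolding pool_def by simp

lemma nth_pool: "z < a Len v \<Longrightarrow> pool n a v ! z = a Pool (z * n + v)"
  unfolding pool_def by simp

lemma pool_cong: "a' Pool = a Pool \<Longrightarrow> a' Len = a Len \<Longrightarrow> pool n a' = pool n a"
  unfolding pool_def by (rule ext) simp

lemma row_col_eq_iff:
  fixes n :: nat
  assumes "u < n" "v < n"
  shows "z * n + u = z' * n + v \<longleftrightarrow> z = z' \<and> u = v"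
proof
  assume eq: "z * n + u = z' * n + v"
  have "u = v" using arg_cong[OF eq, of "\<lambda>x. x mod n"] assms by simp
  then show "z = z' \<and> u = v" using eq assms by simp
qed simp

lemma pool_append:
  assumes "u < n" "v < n"
  shows "pool n (a(Pool := (a Pool)(a Len v * n + v := x), Len := (a Len)(v := Suc (a Len v)))) u =
     (if u = v then pool n a v @ [x] else pool n a u)"
proof (cases "u = v")
  case True
  then show ?thesis
    using row_col_eq_iff[OF assms(2,2)] by (simp add: pool_def)
next
  case False
  then have "z * n + u \<noteq> a Len v * n + v" for z using row_col_eq_iff[OF assms] by simp
  then show ?thesis using False by (simp add: pool_def)
qed

definition pools_upd :: "nat \<Rightarrow> nat \<Rightarrow> nat list \<Rightarrow> store \<Rightarrow> store \<Rightarrow> bool" where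
  "pools_upd n v xs s s' \<longleftrightarrow> pool n (snd s') v = xs \<and> (\<forall>u<n. u \<noteq> v \<longrightarrow> pool n (snd s') u = pool n (snd s) u)"

definition pair_code :: "(nat \<Rightarrow> nat \<Rightarrow> bool) \<Rightarrow> nat \<Rightarrow> nat \<Rightarrow> nat" where
  "pair_code E x y = of_bool (x = y) + 2 * of_bool (E x y)"

definition horner :: "nat \<Rightarrow> nat list \<Rightarrow> nat" where
  "horner = foldl (\<lambda>c b. 4 * c + b)"

definition type_word :: "(nat \<Rightarrow> nat \<Rightarrow> bool) \<Rightarrow> nat \<Rightarrow> nat list \<Rightarrow> (nat \<Rightarrow> nat) \<Rightarrow> nat \<Rightarrow> nat list" where
  "type_word E L xs X l = map (\<lambda>z. pair_code E (X l) z) xs @ map (\<lambda>l'. pair_code E (X l) (X l')) [0..<L]"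

definition type_code :: "(nat \<Rightarrow> nat \<Rightarrow> bool) \<Rightarrow> nat \<Rightarrow> nat list \<Rightarrow> (nat \<Rightarrow> nat) \<Rightarrow> nat" where
  "type_code E L xs X = horner 0 (concat (map (type_word E L xs X) [0..<L]))"

lemma horner_simps [simp]: "horner c [] = c" "horner c (ys @ zs) = horner (horner c ys) zs"
    "horner c [b] = 4 * c + b"
  unfolding horner_def by simp_all

lemma horner_less:
  "\<forall>b\<in>set bs. b < 4 \<Longrightarrow> horner 0 bs < 4 ^ length bs"
proof (induction bs rule: rev_induct)
  case (snoc b bs)
  then have "horner 0 bs < 4 ^ length bs" "b < 4" by auto
  then show ?case by (simp del: One_nat_def)
qed simp

text \<open>Leading zeros do not show in the value, hence the equal lengths; digits are then peeled
  off from the right.\<close>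

lemma horner_inj:
  assumes "length bs = length bs'" "\<forall>b\<in>set bs. b < 4" "\<forall>b\<in>set bs'. b < 4" "horner 0 bs = horner 0 bs'"
  shows "bs = bs'"
  using assms
proof (induction bs arbitrary: bs' rule: rev_induct)
  case (snoc b bs)
  then obtain cs c where [simp]: "bs' = cs @ [c]" by (cases bs' rule: rev_cases) auto
  have "4 * horner 0 bs + b = 4 * horner 0 cs + c" "b < 4" "c < 4" using snoc.prems by auto
  then have "horner 0 bs = horner 0 cs" "b = c" by presburger+
  then show ?case using snoc.IH[of cs] snoc.prems by auto
qed simp

lemma pair_code_less: "pair_code E x y < 4"
  unfolding pair_code_def by simp

lemma pair_code_eq_iff: "pair_code E x y = pair_code E x' y' \<longleftrightarrow> (x = y \<longleftrightarrow> x' = y') \<and> (E x y \<longleftrightarrow> E x' y')"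
  unfolding pair_code_def by (auto simp: of_bool_def)

lemma length_type_word [simp]: "length (type_word E L xs X l) = length xs + L"
  unfolding type_word_def by simp

lemma length_concat_type_word:
  "length (concat (map (type_word E L xs X) ls)) = length ls * (length xs + L)"
  by (induction ls) auto

lemma type_word_less: "b \<in> set (concat (map (type_word E L xs X) ls)) \<Longrightarrow> b < 4"
  unfolding type_word_def by (auto simp: pair_code_less)

lemma type_code_less: "type_code E L xs X < 4 ^ (L * (length xs + L))"
proof -
  have "horner 0 (concat (map (type_word E L xs X) [0..<L])) < 4 ^ length (concat (map (type_word E L xs X) [0..<L]))"
    by (rule horner_less) (blast dest: type_word_less)
  then show ?thesis by (simp add: type_code_def length_concat_type_word)
qed

text \<open>All words have length \<open>length xs + L\<close>, so their concatenation splits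
  uniquely into the words of the single entries.\<close>

lemma type_code_same_type:
  assumes "type_code E L xs X = type_code E L xs X'"
  shows "same_type E L (set xs) X X'"
proof -
  have eq: "concat (map (type_word E L xs X) [0..<L]) = concat (map (type_word E L xs X') [0..<L])"
    using assms unfolding type_code_def
    by (intro horner_inj) (use type_word_less length_concat_type_word in \<open>auto simp del: set_concat\<close>)
  have "map (type_word E L xs X) [0..<L] = map (type_word E L xs X') [0..<L]"
    by (rule iffD1[OF concat_eq_concat_iff eq]) (auto simp: set_zip)
  then have eq: "type_word E L xs X l = type_word E L xs X' l" if "l < L" for l
    using that by (simp add: list_eq_iff_nth_eq[of "map _ _"])
  have "pair_code E (X l) z = pair_code E (X' l) z" if "l < L" "z \<in> set xs" for l z
    using eq[OF that(1)] that(2) unfolding type_word_def by auto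
  moreover have "pair_code E (X l) (X l') = pair_code E (X' l) (X' l')" if "l < L" "l' < L" for l l'
    using eq[OF that(1)] that(2) unfolding type_word_def by auto
  ultimately show ?thesis unfolding same_type_def pair_code_eq_iff by blast
qed

lemma type_code_cong:
  "(\<And>l. l < L \<Longrightarrow> X l = X' l) \<Longrightarrow> type_code E L xs X = type_code E L xs X'"
  unfolding type_code_def type_word_def by (intro arg_cong[where f = "horner 0"] arg_cong[where f = concat]) auto

lemma digits_exist:
  fixes B :: nat
  assumes "\<And>l. l < L \<Longrightarrow> d l < B"
  shows "\<exists>b < B ^ L. \<forall>l<L. b div B ^ l mod B = d l"
  using assms
proof (induction L arbitrary: d)
  case (Suc L)
  obtain b where b: "b < B ^ L" "\<forall>l<L. b div B ^ l mod B = d (Suc l)"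
    using Suc.IH[of "\<lambda>l. d (Suc l)"] Suc.prems by auto
  have d0: "d 0 < B" using Suc.prems by simp
  show ?case
  proof (intro exI conjI allI impI)
    have "B * b + d 0 < B * b + B" using d0 by simp
    also have "\<dots> = B * Suc b" by simp
    also have "\<dots> \<le> B * B ^ L" by (rule mult_le_mono2) (use b in simp)
    finally show "B * b + d 0 < B ^ Suc L" by simp
    fix l assume "l < Suc L"
    then show "(B * b + d 0) div B ^ l mod B = d l"
      using b d0 by (cases l) (auto simp: div_mult2_eq)
  qed
qed simp

text \<open>A single \<open>Z\<close> bounds all loop counts and left factors;
  \<open>4 \<le> Z\<close> admits the multiplication by 4 in the type codes.\<close>

locale pool_machine =
  fixes n Z :: nat and inp :: "nat \<Rightarrow> nat" and E :: "nat \<Rightarrow> nat \<Rightarrow> bool"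
  assumes inp: "\<And>x y. x < n \<Longrightarrow> y < n \<Longrightarrow> inp (x * n + y) = of_bool (E x y)"
    and n_le: "n \<le> Z" and four_le: "4 \<le> Z"
begin

lemma wp_append:
  assumes "fst s vN = n" "fst s vV = v" "v < n" "length (pool n (snd s) v) \<le> Z"
  shows "wp inp Z append_com (pools_upd n v (snoc_new (pool n (snd s) v) (fst s vX)) s) s"
proof -
  have mem: "fst s vX \<in> set (pool n (snd s) v) \<longleftrightarrow> (\<exists>z < snd s Len v. snd s Pool (z * n + v) = fst s vX)"
    unfolding in_set_conv_nth by (auto simp: nth_pool)
  show ?thesis
    unfolding append_com_def wp_simps
    apply (simp add: set_var_def)
    apply (rule wp_For[where I = "\<lambda>b s'. fst s' vF > 0 \<longleftrightarrow> (\<exists>z<b. snd s Pool (z * n + v) = fst s vX)"])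
    using assms apply simp_all[3]
    subgoal for b s'
      using assms by (auto simp: wp_simps set_var_def agree_def less_Suc_eq)
    subgoal premises prems for s'
    proof -
      have eq: "snd s' = snd s" using prems(2) by (auto simp: agree_def)
      have "fst s' vN = n" "fst s' vV = v" "fst s' vX = fst s vX" using prems(2) assms by (auto simp: agree_def)
      then show ?thesis
        using assms mem prems(1) pool_append[of _ n v "snd s" "fst s vX"]
        by (auto simp: wp_simps pools_upd_def snoc_new_def eq)
    qed
    done
qed

lemma wp_append_tuple:
  assumes "fst s vN = n" "fst s vV = v" "v < n" "fst s vL = L" "length (pool n (snd s) v) + L \<le> Z"
  shows "wp inp Z append_tuple_com (pools_upd n v (foldl snoc_new (pool n (snd s) v) (map (snd s Tup) [0..<L])) s) s"
  unfolding append_tuple_com_def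
  apply (rule wp_For[where I = "\<lambda>b. pools_upd n v (foldl snoc_new (pool n (snd s) v) (map (snd s Tup) [0..<b])) s"])
  using assms apply (simp_all add: pools_upd_def)[3]
  subgoal premises prems for b s'
  proof -
    let ?xs = "foldl snoc_new (pool n (snd s) v) (map (snd s Tup) [0..<b])"
    have ag: "fst s' vN = n" "fst s' vV = v" "snd s' Tup = snd s Tup"
      using prems(3) assms by (auto simp: agree_def append_com_def)
    have xs: "pool n (snd s') v = ?xs" using prems(2) by (simp add: pools_upd_def)
    have "length (pool n (snd s') v) \<le> length (pool n (snd s) v) + length (map (snd s Tup) [0..<b])"
      unfolding xs by (rule foldl_snoc_new)
    then have "length (pool n (snd s') v) \<le> Z" using assms prems(1) by simp
    then show ?thesis
      unfolding wp_simps set_var_def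
      apply (simp)
      apply (rule wp_mono[OF wp_append])
      using assms ag xs prems(2) by (auto simp: pools_upd_def)
  qed
  subgoal using assms by simp
  done

lemma wp_digit:
  assumes "exp_ok inp Z e s" "fst s vN = n" "snd s Tup (fst s vI) < n" "eval inp e s < n"
  shows "wp inp Z (digit_com e) (\<lambda>s'. fst s' vC = horner (fst s vC) [pair_code E (snd s Tup (fst s vI)) (eval inp e s)]) s"
  using assms inp[OF assms(3,4)] n_le four_le
  by (simp add: digit_com_def wp_simps set_var_def bitE_def pair_code_def)

text \<open>The type is taken over the first \<open>m\<close> entries only, since the pool may
  already be longer than at the start of the round.\<close>

lemma wp_code:
  assumes s: "fst s vN = n" "fst s vV = v" "fst s vL = L" "fst s vM = m" and v: "v < n"
    and m: "m \<le> snd s Len v" "m \<le> Z" "L \<le> Z"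
    and p: "set (pool n (snd s) v) \<subseteq> {..<n}" and X: "\<And>l. l < L \<Longrightarrow> snd s Tup l < n"
  shows "wp inp Z code_com (\<lambda>s'. fst s' vC = type_code E L (take m (pool n (snd s) v)) (snd s Tup)) s"
proof -
  define xs where "xs = take m (pool n (snd s) v)"
  have len: "length xs = m" using m unfolding xs_def by simp
  have nth: "xs ! z = snd s Pool (z * n + v)" "xs ! z < n" if "z < m" for z
  proof -
    show 1: "xs ! z = snd s Pool (z * n + v)" using that m unfolding xs_def by (simp add: nth_pool)
    have "xs ! z \<in> set (pool n (snd s) v)" unfolding xs_def using that m by (simp add: nth_mem)
    then show "xs ! z < n" using p by blast
  qed
  let ?w = "\<lambda>b. concat (map (type_word E L xs (snd s Tup)) [0..<b])"
  let ?w1 = "\<lambda>b z. map (\<lambda>z. pair_code E (snd s Tup b) (xs ! z)) [0..<z]"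
  let ?w2 = "\<lambda>b z. map (\<lambda>l'. pair_code E (snd s Tup b) (snd s Tup l')) [0..<z]"
  have word: "type_word E L xs (snd s Tup) b = ?w1 b m @ ?w2 b L" for b
    unfolding type_word_def using len by (auto intro: nth_equalityI)
  show ?thesis
    unfolding code_com_def wp_simps set_var_def
    apply (simp)
    apply (rule wp_For[where I = "\<lambda>b s'. fst s' vC = horner 0 (?w b)"])
    using s m apply simp_all[3]
    subgoal premises prems for b s'
    proof -
      have b: "b < L" using prems(1) s by simp
      have ag: "fst s' vN = n" "fst s' vV = v" "fst s' vL = L" "fst s' vM = m" "snd s' = snd s"
        using prems(3) s by (auto simp: agree_def digit_com_def)
      show ?thesis
        unfolding wp_simps
        apply (rule wp_For[where I = "\<lambda>z s'. fst s' vC = horner 0 (?w b @ ?w1 b z)"])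
        using ag m prems(2) apply (simp_all add: set_var_def)[3]
        subgoal premises prems2 for z s2
        proof -
          have ag2: "fst s2 vN = n" "fst s2 vV = v" "fst s2 vI = b" "snd s2 = snd s"
            using prems2(3) ag by (auto simp: agree_def digit_com_def set_var_def)
          have "z < m" using prems2(1) ag by (simp add: set_var_def)
          then show ?thesis
            apply (intro wp_mono[OF wp_digit])
            using ag2 nth X[OF b] m prems2(2) by (auto simp: set_var_def)
        qed
        subgoal premises prems2 for s2
        proof -
          have ag2: "fst s2 vN = n" "fst s2 vL = L" "fst s2 vI = b" "snd s2 = snd s"
            using prems2(2) ag by (auto simp: agree_def digit_com_def set_var_def)
          have c2: "fst s2 vC = horner 0 (?w b @ ?w1 b m)" using prems2(1) ag by (simp add: set_var_def)
          show ?thesis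
            apply (rule wp_For[where I = "\<lambda>z s'. fst s' vC = horner 0 (?w b @ ?w1 b m @ ?w2 b z)"])
            using ag2 m c2 apply (simp_all)[3]
            subgoal premises prems3 for z s3
            proof -
              have ag3: "fst s3 vN = n" "fst s3 vI = b" "snd s3 = snd s"
                using prems3(3) ag2 by (auto simp: agree_def digit_com_def set_var_def)
              have "z < L" using prems3(1) ag2 by simp
              then show ?thesis
                apply (intro wp_mono[OF wp_digit])
                using ag3 X[OF b] X[of z] prems3(2) by (auto simp: set_var_def)
            qed
            subgoal for s3 using ag2 by (simp add: word)
            done
        qed
        done
    qed
    subgoal for s' using s by (simp add: type_code_def xs_def)
    done
qed

end

section \<open>First half of a round: one tuple for each type\<close>

context pool_machine
begin

text \<open>The state in the middle of the first half, where \<open>xs\<close> is the pool at the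
  start of the round. The growth is charged to the codes marked so far, \<open>L\<close> vertices
  for each, and every marked code is realized inside the current pool.\<close>

definition picking :: "nat \<Rightarrow> nat list \<Rightarrow> nat \<Rightarrow> store \<Rightarrow> store \<Rightarrow> bool" where
  "picking L xs v s0 s \<longleftrightarrow>
     (\<forall>u<n. u \<noteq> v \<longrightarrow> pool n (snd s) u = pool n (snd s0) u) \<and>
     take (length xs) (pool n (snd s) v) = xs \<and> length xs \<le> snd s Len v \<and>
     distinct (pool n (snd s) v) \<and> set (pool n (snd s) v) \<subseteq> {..<n} \<and>
     {c. snd s Seen c = fst s0 vStamp} \<subseteq> {..<4 ^ (L * (length xs + L))} \<and>
     snd s Len v \<le> length xs + L * card {c. snd s Seen c = fst s0 vStamp} \<and>
     (\<forall>c. snd s Seen c \<le> fst s0 vStamp) \<and>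
     (\<forall>c. snd s Seen c = fst s0 vStamp \<longrightarrow>
        (\<exists>X. type_code E L xs X = c \<and> (\<forall>l<L. X l \<in> set (pool n (snd s) v))))"

lemma wp_pick:
  assumes pick: "picking L xs v s0 s"
    and s: "fst s vN = n" "fst s vV = v" "v < n" "fst s vL = L" "fst s vM = length xs" "fst s vStamp = fst s0 vStamp"
    and Z: "length xs + L * 4 ^ (L * (length xs + L)) \<le> Z" "L \<le> Z"
    and X: "\<And>l. l < L \<Longrightarrow> snd s Tup l < n"
  shows "wp inp Z pick_com (\<lambda>s'. picking L xs v s0 s' \<and> snd s' Seen (type_code E L xs (snd s Tup)) = fst s0 vStamp \<and>
     (\<forall>c. snd s Seen c = fst s0 vStamp \<longrightarrow> snd s' Seen c = fst s0 vStamp)) s"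
proof -
  note pk = pick[unfolded picking_def]
  define c where "c = type_code E L xs (snd s Tup)"
  define D where "D = {c. snd s Seen c = fst s0 vStamp}"
  have "wp inp Z code_com (\<lambda>s'. fst s' vC = type_code E L (take (length xs) (pool n (snd s) v)) (snd s Tup)) s"
    by (rule wp_code) (use pk s Z X in auto)
  then have code: "wp inp Z code_com (\<lambda>s'. fst s' vC = c) s"
    using pk unfolding c_def by simp
  show ?thesis
    unfolding pick_com_def wp_simps
  proof (rule wp_mono[OF code])
    fix s1 assume c1: "fst s1 vC = c" and ag: "agree (writes code_com) (array_writes code_com) s s1"
    have s1: "fst s1 vN = n" "fst s1 vV = v" "fst s1 vL = L" "fst s1 vStamp = fst s0 vStamp" "snd s1 = snd s"
      using ag s by (auto simp: agree_def code_com_def digit_com_def)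
    let ?Q = "\<lambda>s'. picking L xs v s0 s' \<and> snd s' Seen (type_code E L xs (snd s Tup)) = fst s0 vStamp \<and>
     (\<forall>c. snd s Seen c = fst s0 vStamp \<longrightarrow> snd s' Seen c = fst s0 vStamp)"
    show "exp_ok inp Z (eqE (Get Seen (Var vC)) (Var vStamp)) s1 \<and>
      (if 0 < eval inp (eqE (Get Seen (Var vC)) (Var vStamp)) s1 then ?Q s1
       else exp_ok inp Z (Var vC) s1 \<and> exp_ok inp Z (Var vStamp) s1 \<and>
            wp inp Z append_tuple_com ?Q
             (fst s1, (snd s1)(Seen := (snd s1 Seen)(eval inp (Var vC) s1 := eval inp (Var vStamp) s1))))"
    proof (cases "snd s Seen c = fst s0 vStamp")
      case True
      moreover have "picking L xs v s0 s1" using pick s1 unfolding picking_def by simp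
      ultimately show ?thesis using s1 c1 by (simp add: c_def)
    next
      case False
      let ?s2 = "(fst s1, (snd s1)(Seen := (snd s1 Seen)(c := fst s0 vStamp)))"
      let ?ys = "foldl snoc_new (pool n (snd s) v) (map (snd s Tup) [0..<L])"
      have pool2: "pool n (snd ?s2) = pool n (snd s)" by (rule pool_cong) (simp_all add: s1)
      have fin: "finite D" unfolding D_def using pk finite_subset by blast
      \<comment> \<open>The unmarked code \<open>c\<close> shows that not all codes are used up, so
        another \<open>L\<close> vertices still fit below \<open>Z\<close>.\<close>
      have ins: "insert c D \<subseteq> {..<4 ^ (L * (length xs + L))}"
        using pk type_code_less unfolding D_def c_def by auto
      have "c \<notin> D" using False unfolding D_def by simp
      then have cD: "card (insert c D) = Suc (card D)" using fin by simp
      have "Suc (card D) \<le> 4 ^ (L * (length xs + L))"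
        using card_mono[OF _ ins] cD by simp
      then have "L * Suc (card D) \<le> L * 4 ^ (L * (length xs + L))" by (rule mult_le_mono2)
      moreover have len: "snd s Len v \<le> length xs + L * card D" using pk unfolding D_def by blast
      ultimately have "length (pool n (snd ?s2) v) + L \<le> Z" using Z(1) unfolding pool2 by simp
      then have ap: "wp inp Z append_tuple_com
          (pools_upd n v (foldl snoc_new (pool n (snd ?s2) v) (map (snd ?s2 Tup) [0..<L])) ?s2) ?s2"
        by (intro wp_append_tuple) (use s1 s(3) in simp_all)
      have "wp inp Z append_tuple_com ?Q ?s2"
      proof (rule wp_mono[OF ap])
        fix s3
        assume "pools_upd n v (foldl snoc_new (pool n (snd ?s2) v) (map (snd ?s2 Tup) [0..<L])) ?s2 s3"
          and ag3: "agree (writes append_tuple_com) (array_writes append_tuple_com) ?s2 s3"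
        then have p3: "pool n (snd s3) v = ?ys" "\<And>u. u < n \<Longrightarrow> u \<noteq> v \<Longrightarrow> pool n (snd s3) u = pool n (snd s0) u"
          using pk unfolding pools_upd_def pool2 by (auto simp: s1)
        have seen3: "snd s3 Seen = (snd s Seen)(c := fst s0 vStamp)"
          using ag3 by (simp add: agree_def append_tuple_com_def append_com_def s1)
        have D3: "{b. snd s3 Seen b = fst s0 vStamp} = insert c D" unfolding seen3 D_def by auto
        have len3: "snd s3 Len v = length ?ys" using arg_cong[OF p3(1), of length] by simp
        have set3: "set ?ys = set (pool n (snd s) v) \<union> snd s Tup ` {..<L}"
          unfolding foldl_snoc_new by (auto simp: atLeast0LessThan)
        have "picking L xs v s0 s3"
          unfolding picking_def
        proof (intro conjI allI impI)
          show "take (length xs) (pool n (snd s3) v) = xs"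
          proof -
            have "take (length xs) ?ys = take (length xs) (take (length (pool n (snd s) v)) ?ys)"
              using pk by (simp add: min_absorb1)
            then show ?thesis using pk unfolding p3(1) foldl_snoc_new by simp
          qed
          show "length xs \<le> snd s3 Len v"
            unfolding len3 using pk foldl_snoc_new(5)[of "pool n (snd s) v" "map (snd s Tup) [0..<L]"] by simp
          show "distinct (pool n (snd s3) v)" unfolding p3(1) using pk by (intro foldl_snoc_new) simp
          show "set (pool n (snd s3) v) \<subseteq> {..<n}" unfolding p3(1) set3 using pk X by auto
          show "{b. snd s3 Seen b = fst s0 vStamp} \<subseteq> {..<4 ^ (L * (length xs + L))}"
            unfolding D3 by (rule ins)
          have "length ?ys \<le> length (pool n (snd s) v) + length (map (snd s Tup) [0..<L])"
            by (rule foldl_snoc_new)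
          then show "snd s3 Len v \<le> length xs + L * card {b. snd s3 Seen b = fst s0 vStamp}"
            unfolding len3 D3 cD using len by simp
          show "snd s3 Seen b \<le> fst s0 vStamp" for b unfolding seen3 using pk by simp
          show "\<exists>X. type_code E L xs X = b \<and> (\<forall>l<L. X l \<in> set (pool n (snd s3) v))"
            if "snd s3 Seen b = fst s0 vStamp" for b
          proof (cases "b = c")
            case True
            then show ?thesis unfolding p3(1) set3 c_def by blast
          next
            case False
            then have "snd s Seen b = fst s0 vStamp" using that unfolding seen3 by simp
            then show ?thesis using pk unfolding p3(1) set3 by blast
          qed
        qed (rule p3(2))
        then show "?Q s3" unfolding seen3 c_def by simp
      qed
      then show ?thesis using False s1 c1 by simp
    qed
  qed
qed

lemma wp_lookup:
  assumes s: "fst s vN = n" "fst s vU = u" "fst s vL = L" and L: "L \<le> Z"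
    and d: "\<And>l. l < L \<Longrightarrow> snd s Tup l < snd s Len u" and Z: "snd s Len u \<le> Z"
  shows "wp inp Z lookup_com (\<lambda>s'. \<forall>l<L. snd s' Tup l = pool n (snd s) u ! snd s Tup l) s"
  unfolding lookup_com_def
  apply (rule wp_For[where I = "\<lambda>b s'. \<forall>l<L. snd s' Tup l = (if l < b then pool n (snd s) u ! snd s Tup l else snd s Tup l)"])
  using s L apply simp_all[3]
  subgoal premises prems for b s'
  proof -
    have "snd s' Tup b = snd s Tup b" using prems(1,2) s by simp
    moreover have "fst s' vN = n" "fst s' vU = u" "snd s' Pool = snd s Pool" using prems(3) s by (auto simp: agree_def)
    moreover have "snd s Tup b < snd s Len u" using d prems(1) s by simp
    ultimately show ?thesis
      using prems Z s by (auto simp: wp_simps set_var_def nth_pool less_Suc_eq)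
  qed
  subgoal using s by simp
  done

lemma wp_tuples:
  assumes pick: "picking L xs v s0 s0"
    and s: "fst s0 vN = n" "fst s0 vV = v" "v < n" "fst s0 vL = L" "fst s0 vM = length xs"
    and Z: "length xs + L * 4 ^ (L * (length xs + L)) \<le> Z" "L \<le> Z" "0 < L"
    and pools: "\<And>u. u < n \<Longrightarrow> set (pool n (snd s0) u) \<subseteq> {..<n}"
      "\<And>u. u < n \<Longrightarrow> snd s0 Len u \<le> Z" "\<And>u. u < n \<Longrightarrow> snd s0 Len u ^ L \<le> Z"
  shows "wp inp Z tuples_com (\<lambda>s'. picking L xs v s0 s' \<and>
     (\<forall>u<n. u \<noteq> v \<longrightarrow> (\<forall>X. (\<forall>l<L. X l \<in> set (pool n (snd s0) u)) \<longrightarrow>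
        snd s' Seen (type_code E L xs X) = fst s0 vStamp))) s0"
proof -
  let ?done = "\<lambda>u s'. (\<forall>X. (\<forall>l<L. X l \<in> set (pool n (snd s0) u)) \<longrightarrow>
        snd s' Seen (type_code E L xs X) = fst s0 vStamp)"
  let ?I = "\<lambda>b s'. picking L xs v s0 s' \<and> (\<forall>u<b. u \<noteq> v \<longrightarrow> ?done u s')"
  show ?thesis
    unfolding tuples_com_def
    apply (rule wp_For[where I = ?I])
    using pick s n_le apply simp_all[3]
    subgoal premises prems for u s1
    proof -
      have u: "u < n" using prems(1) s by simp
      have s1: "fst s1 vN = n" "fst s1 vV = v" "fst s1 vL = L" "fst s1 vM = length xs" "fst s1 vStamp = fst s0 vStamp"
        using prems(3) s by (auto simp: agree_def com_defs)
      show ?thesis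
      proof (cases "u = v")
        case True
        have "picking L xs v s0 (set_var vU u s1)"
          using prems(2) unfolding picking_def by (simp add: set_var_def)
        then show ?thesis using True s1 prems(2) by (auto simp: wp_simps set_var_def less_Suc_eq)
      next
        case False
        define ys where "ys = pool n (snd s0) u"
        define B where "B = length ys"
        \<comment> \<open>Only the pool of \<open>v\<close> changes, so positions in the pool of
          \<open>u\<close> denote the same vertices throughout the enumeration.\<close>
        have pu: "pool n (snd s') u = ys" if "picking L xs v s0 s'" for s'
          using that u False unfolding picking_def ys_def by blast
        have lenu: "snd s' Len u = B" if "picking L xs v s0 s'" for s'
          using arg_cong[OF pu[OF that], of length] by (simp add: B_def)
        have B: "B \<le> Z" "B ^ L \<le> Z" using pools(2,3)[OF u] unfolding B_def ys_def by simp_all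
        have yn: "set ys \<subseteq> {..<n}" unfolding ys_def using pools(1)[OF u] .
        let ?X = "\<lambda>b l. ys ! (b div B ^ l mod B)"
        let ?s2 = "set_var vB B (set_var vU u s1)"
        have pk2: "picking L xs v s0 ?s2"
          using prems(2) unfolding picking_def by (simp add: set_var_def)
        let ?J = "\<lambda>b s'. picking L xs v s0 s' \<and> (\<forall>c. snd s1 Seen c = fst s0 vStamp \<longrightarrow> snd s' Seen c = fst s0 vStamp) \<and>
            (\<forall>it<b. snd s' Seen (type_code E L xs (?X it)) = fst s0 vStamp)"
        have "wp inp Z (Semi (power_com (Var vL))
           (For vIt (Var vP) (Semi (decode_com vL) (Semi lookup_com pick_com)))) (?I (Suc u)) ?s2"
          unfolding wp_simps
          apply (rule wp_mono[OF wp_power])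
          using s1 Z B apply (simp_all add: set_var_def)[3]
          subgoal premises pw for s3
          proof -
            have s3: "fst s3 vN = n" "fst s3 vV = v" "fst s3 vL = L" "fst s3 vM = length xs" "fst s3 vStamp = fst s0 vStamp"
              "fst s3 vU = u" "fst s3 vB = B" "snd s3 = snd s1" "fst s3 vP = B ^ L"
              using pw s1 by (auto simp: agree_def com_defs set_var_def)
            have pk3: "picking L xs v s0 s3" using pk2 s3(8) unfolding picking_def by (simp add: set_var_def)
            show ?thesis
              apply (rule wp_For[where I = ?J])
              using s3 B pk3 apply simp_all[3]
              subgoal premises it for b s4
              proof -
                have s4: "fst s4 vN = n" "fst s4 vV = v" "fst s4 vL = L" "fst s4 vM = length xs" "fst s4 vStamp = fst s0 vStamp"
                  "fst s4 vU = u" "fst s4 vB = B"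
                  using it(3) s3 by (auto simp: agree_def com_defs)
                have b: "b < B ^ L" using it(1) s3 by simp
                \<comment> \<open>As \<open>0 < L\<close>, an empty pool has no tuples and the loop
                  body is not reached; otherwise the base of the digits is positive.\<close>
                then have B0: "0 < B" using Z(3) by (cases B) (auto simp: zero_power)
                have pk4: "picking L xs v s0 s4" using it(2) by blast
                show ?thesis
                  unfolding wp_simps
                  apply (rule wp_mono[OF wp_decode])
                  using b B B0 s4 Z apply (simp_all add: set_var_def)[4]
                  subgoal premises dc for s5
                  proof -
                    have s5: "fst s5 vN = n" "fst s5 vV = v" "fst s5 vL = L" "fst s5 vM = length xs" "fst s5 vStamp = fst s0 vStamp"
                      "fst s5 vU = u" "\<And>A. A \<noteq> Tup \<Longrightarrow> snd s5 A = snd s4 A"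
                      using dc(2) s4 by (auto simp: agree_def com_defs set_var_def)
                    have tup5: "snd s5 Tup l = b div B ^ l mod B" "snd s5 Tup l < B" if "l < L" for l
                      using dc(1) s4 that B0 by (simp_all add: set_var_def)
                    have pl5: "pool n (snd s5) = pool n (snd s4)" by (rule pool_cong) (simp_all add: s5)
                    have len5: "snd s5 Len u = B" using lenu[OF pk4] s5(7) by simp
                    show ?thesis
                      apply (rule wp_mono[OF wp_lookup[where u = u and L = L]])
                      using s5 Z B len5 tup5 apply simp_all[6]
                      subgoal premises lk for s6
                      proof -
                        have s6: "fst s6 vN = n" "fst s6 vV = v" "fst s6 vL = L" "fst s6 vM = length xs" "fst s6 vStamp = fst s0 vStamp"
                          "\<And>A. A \<noteq> Tup \<Longrightarrow> snd s6 A = snd s4 A"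
                          using lk(2) s5 by (auto simp: agree_def com_defs)
                        have tup6: "snd s6 Tup l = ?X b l" if "l < L" for l
                          using lk(1) that pu[OF pk4] tup5 unfolding pl5 by simp
                        have pl6: "pool n (snd s6) = pool n (snd s4)" by (rule pool_cong) (simp_all add: s6)
                        have len6: "snd s6 Len = snd s4 Len" "snd s6 Seen = snd s4 Seen" using s6(6) by simp_all
                        have pk6: "picking L xs v s0 s6"
                          using pk4 unfolding picking_def pl6 len6 .
                        have tn: "snd s6 Tup l < n" if "l < L" for l
                        proof -
                          have "b div B ^ l mod B < length ys" using B0 unfolding B_def by simp
                          then have "?X b l \<in> set ys" by (rule nth_mem)
                          then show ?thesis using yn tup6[OF that] by auto
                        qed
                        have code: "type_code E L xs (snd s6 Tup) = type_code E L xs (?X b)"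
                          by (rule type_code_cong) (rule tup6)
                        show ?thesis
                          apply (rule wp_mono[OF wp_pick[OF pk6]])
                          using s6 s(3) Z tn apply simp_all[9]
                          using it(2) code len6 by (auto simp: less_Suc_eq)
                      qed
                      done
                  qed
                  done
              qed
              subgoal premises fin for s'
              proof -
                \<comment> \<open>The positions of the entries of \<open>X\<close> in the pool of
                  \<open>u\<close> are the digits of some counter value below
                  \<open>B ^ L\<close>.\<close>
                have "?done u s'"
                proof (intro allI impI)
                  fix X assume X: "\<forall>l<L. X l \<in> set (pool n (snd s0) u)"
                  then have "\<forall>l<L. \<exists>d<B. ys ! d = X l" unfolding ys_def[symmetric] B_def by (simp add: in_set_conv_nth)
                  then obtain d where d: "\<And>l. l < L \<Longrightarrow> d l < B \<and> ys ! d l = X l" by metis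
                  obtain b where b: "b < B ^ L" "\<forall>l<L. b div B ^ l mod B = d l"
                    using digits_exist[of L d B] d by blast
                  have "type_code E L xs X = type_code E L xs (?X b)"
                    by (rule type_code_cong) (use b d in simp)
                  then show "snd s' Seen (type_code E L xs X) = fst s0 vStamp" using fin(1) b(1) s3(9) by simp
                qed
                then show ?thesis using fin(1) prems(2) by (auto simp: less_Suc_eq)
              qed
              done
          qed
          done
        then show ?thesis
          using False s1 lenu[of s1] prems(2)
          unfolding wp_simps(5) by (simp add: wp_simps(2) wp_simps(4)[of _ _ "Assign _ _"] set_var_def)
      qed
    qed
    subgoal using s by simp
    done
qed

end

text \<open>\<open>m'\<close> bounds the length after the first half, with up to \<open>L\<close>
  vertices for each of \<open>4 ^ (L * (m + L))\<close> codes. The second half adds at most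
  \<open>i * 2 ^ m'\<close> vertices by \<open>card_many_neighbors_le\<close>.\<close>

definition grow :: "nat \<Rightarrow> nat \<Rightarrow> nat \<Rightarrow> nat" where
  "grow i L m = (let m' = m + L * 4 ^ (L * (m + L)) in m' + i * 2 ^ m')"

lemma card_nth_filter:
  assumes "distinct xs"
  shows "card {z. z < length xs \<and> P (xs ! z)} = card {w \<in> set xs. P w}"
proof -
  have "card {z. z < length xs \<and> P (xs ! z)} = length (filter P xs)" by (simp add: length_filter_conv_card)
  also have "\<dots> = card (set (filter P xs))" by (rule distinct_card[symmetric]) (use assms in simp)
  finally show ?thesis by simp
qed

section \<open>Second half of a round: vertices with many neighbors in the pool\<close>

context pool_machine
begin

lemma wp_heavy:
  assumes s: "fst s vN = n" "fst s vV = v" "v < n"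
    and xs: "pool n (snd s) v = xs" "distinct xs" "set xs \<subseteq> {..<n}"
    and Z: "length xs + card {y \<in> {..<n}. j \<le> card {w \<in> set xs. E y w}} \<le> Z"
  shows "wp inp Z (heavy_com j)
     (pools_upd n v (foldl snoc_new xs (filter (\<lambda>y. j \<le> card {w \<in> set xs. E y w}) [0..<n])) s) s"
proof -
  let ?H = "\<lambda>y. j \<le> card {w \<in> set xs. E y w}"
  let ?ys = "\<lambda>b. foldl snoc_new xs (filter ?H [0..<b])"
  have len: "snd s Len v = length xs" using arg_cong[OF xs(1), of length] by simp
  show ?thesis
    unfolding heavy_com_def wp_simps set_var_def
    apply (simp)
    apply (rule wp_For[where I = "\<lambda>b. pools_upd n v (?ys b) s"])
    using s xs n_le apply (simp_all add: pools_upd_def)[3]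
    subgoal premises prems for y s1
    proof -
      have y: "y < n" using prems(1) s by simp
      have s1: "fst s1 vN = n" "fst s1 vV = v" "fst s1 vM = length xs"
        using prems(3) s len by (auto simp: agree_def com_defs)
      have p1: "pool n (snd s1) v = ?ys y" using prems(2) unfolding pools_upd_def by simp
      \<comment> \<open>Appending keeps \<open>xs\<close> as a prefix, so neighbors are counted in
        the unchanged \<open>xs\<close> although the pool grows.\<close>
      have nth: "snd s1 Pool (z * n + v) = xs ! z" if "z < length xs" for z
      proof -
        have "length xs \<le> snd s1 Len v" using foldl_snoc_new(5)[of xs] arg_cong[OF p1, of length] by simp
        then have "snd s1 Pool (z * n + v) = pool n (snd s1) v ! z" using that by (simp add: nth_pool)
        also have "\<dots> = take (length xs) (?ys y) ! z" using that p1 by simp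
        also have "\<dots> = xs ! z" unfolding foldl_snoc_new ..
        finally show ?thesis .
      qed
      have xn: "xs ! z < n" if "z < length xs" for z using nth_mem[OF that] xs(3) by blast
      have len1: "length (?ys y) \<le> Z"
      proof -
        have "length (?ys y) \<le> length xs + length (filter ?H [0..<y])" by (rule foldl_snoc_new)
        also have "length (filter ?H [0..<y]) = card (set (filter ?H [0..<y]))" by (simp only: distinct_card distinct_filter distinct_upt)
        also have "\<dots> \<le> card {y \<in> {..<n}. ?H y}" by (rule card_mono) (use y in auto)
        finally show ?thesis using Z by simp
      qed
      then have len1: "snd s1 Len v \<le> Z" using arg_cong[OF p1, of length] by simp
      show ?thesis
        unfolding wp_simps(2,4)
        apply (rule conjI, simp)
        apply (rule wp_For[where I = "\<lambda>b s'. fst s' vC = card {z. z < b \<and> E y (xs ! z)}"])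
        using s1 Z apply (simp_all add: set_var_def)[3]
        subgoal premises cnt for z s2
        proof -
          have z: "z < length xs" using cnt(1) s1 by (simp add: set_var_def)
          have s2: "fst s2 vN = n" "fst s2 vV = v" "fst s2 vY = y" "snd s2 = snd s1"
            using cnt(3) s1 by (auto simp: agree_def set_var_def)
          have "{z'. z' < Suc z \<and> E y (xs ! z')} =
              (if E y (xs ! z) then insert z {z'. z' < z \<and> E y (xs ! z')} else {z'. z' < z \<and> E y (xs ! z')})"
            by (auto simp: less_Suc_eq)
          then have "card {z'. z' < Suc z \<and> E y (xs ! z')} = card {z'. z' < z \<and> E y (xs ! z')} + of_bool (E y (xs ! z))"
            by simp
          then show ?thesis
            using s2 cnt(2) nth[OF z] inp[OF y xn[OF z]] z Z n_le y by (simp add: wp_simps set_var_def)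
        qed
        subgoal premises fin for s2
        proof -
          have s2: "fst s2 vN = n" "fst s2 vV = v" "fst s2 vY = y" "snd s2 = snd s1"
            using fin(2) s1 by (auto simp: agree_def set_var_def)
          have c: "fst s2 vC = card {w \<in> set xs. E y w}"
            using fin(1) s1 card_nth_filter[OF xs(2)] by (simp add: set_var_def)
          show ?thesis
          proof (cases "?H y")
            case True
            have "wp inp Z append_com (pools_upd n v (?ys (Suc y)) s) (set_var vX y s2)"
              apply (rule wp_mono[OF wp_append])
              using s2 s p1 len1 prems(2) True by (auto simp: set_var_def pools_upd_def)
            then show ?thesis using True c s2 by (simp add: wp_simps)
          next
            case False
            then show ?thesis using c s2 prems(2) by (simp add: wp_simps pools_upd_def)
          qed
        qed
        done
    qed
    subgoal for s' using s by (simp add: pools_upd_def)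
    done
qed

text \<open>No mark exceeds the stamp, so raising the stamp invalidates all marks.\<close>

definition good :: "nat \<Rightarrow> store \<Rightarrow> bool" where
  "good M s \<longleftrightarrow> (\<forall>u<n. distinct (pool n (snd s) u) \<and> set (pool n (snd s) u) \<subseteq> {..<n} \<and> snd s Len u \<le> M) \<and>
     (\<forall>c. snd s Seen c \<le> fst s vStamp)"

definition tuples :: "nat \<Rightarrow> nat \<Rightarrow> store \<Rightarrow> (nat \<Rightarrow> nat) set" where
  "tuples L v s = {X. \<exists>u\<in>{..<n} - {v}. \<forall>l<L. X l \<in> set (pool n (snd s) u)}"

lemma wp_round:
  assumes s: "fst s vN = n" "fst s vV = v" "v < n" "fst s vL = L"
    and g: "good M s" and Z: "M \<le> Z" "M ^ L \<le> Z" "0 < L" "L \<le> Z"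
    and grow: "grow i L (snd s Len v) \<le> M"
    and bic: "\<And>Q. Q \<subseteq> {..<n} \<Longrightarrow> card {y \<in> {..<n}. j \<le> card {w \<in> Q. E y w}} \<le> i * 2 ^ card Q"
  shows "wp inp Z (round_com j) (\<lambda>s'. good M s' \<and> (\<forall>u<n. u \<noteq> v \<longrightarrow> pool n (snd s') u = pool n (snd s) u) \<and>
     snd s' Len v \<le> grow i L (snd s Len v) \<and>
     saturates E L j {..<n} (tuples L v s) (set (pool n (snd s) v)) (set (pool n (snd s') v))) s"
proof -
  define xs where "xs = pool n (snd s) v"
  have len: "snd s Len v = length xs" unfolding xs_def by simp
  define m' where "m' = length xs + L * 4 ^ (L * (length xs + L))"
  have gr: "grow i L (length xs) = m' + i * 2 ^ m'" unfolding grow_def m'_def Let_def ..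
  let ?s1 = "set_var vM (length xs) (set_var vStamp (Suc (fst s vStamp)) s)"
  have pool1: "pool n (snd ?s1) = pool n (snd s)" by (simp add: set_var_def)
  have seen: "snd ?s1 Seen c \<noteq> fst ?s1 vStamp" "snd ?s1 Seen c \<le> fst ?s1 vStamp" for c
  proof -
    have "snd s Seen c \<le> fst s vStamp" using g unfolding good_def by blast
    then show "snd ?s1 Seen c \<noteq> fst ?s1 vStamp" "snd ?s1 Seen c \<le> fst ?s1 vStamp" by (auto simp: set_var_def)
  qed
  have xs: "distinct xs" "set xs \<subseteq> {..<n}" using g s(3) unfolding good_def xs_def by auto
  have pk: "picking L xs v ?s1 ?s1"
    unfolding picking_def pool1 xs_def[symmetric] using seen xs len by (simp add: set_var_def)
  have m'Z: "m' \<le> Z" using grow gr len Z by simp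
  have tup: "wp inp Z tuples_com (\<lambda>s'. picking L xs v ?s1 s' \<and>
     (\<forall>u<n. u \<noteq> v \<longrightarrow> (\<forall>X. (\<forall>l<L. X l \<in> set (pool n (snd ?s1) u)) \<longrightarrow>
        snd s' Seen (type_code E L xs X) = fst ?s1 vStamp))) ?s1"
  proof (rule wp_tuples[OF pk])
    show "length xs + L * 4 ^ (L * (length xs + L)) \<le> Z" using m'Z unfolding m'_def .
    fix u assume "u < n"
    then have *: "set (pool n (snd s) u) \<subseteq> {..<n}" "snd s Len u \<le> M" using g unfolding good_def by auto
    then show "set (pool n (snd ?s1) u) \<subseteq> {..<n}" "snd ?s1 Len u \<le> Z" using Z by (auto simp: set_var_def)
    have "snd s Len u ^ L \<le> M ^ L" using * by (simp add: power_mono)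
    from le_trans[OF this Z(2)] show "snd ?s1 Len u ^ L \<le> Z" by (simp add: set_var_def)
  qed (use s Z in \<open>simp_all add: set_var_def\<close>)
  have "wp inp Z (Semi tuples_com (heavy_com j)) (\<lambda>s'. good M s' \<and> (\<forall>u<n. u \<noteq> v \<longrightarrow> pool n (snd s') u = pool n (snd s) u) \<and>
     snd s' Len v \<le> grow i L (snd s Len v) \<and>
     saturates E L j {..<n} (tuples L v s) (set (pool n (snd s) v)) (set (pool n (snd s') v))) ?s1"
    unfolding wp_simps
    apply (rule wp_mono[OF tup])
    subgoal premises prems for s2
    proof -
      note pk2 = conjunct1[OF prems(1), unfolded picking_def]
      have s2: "fst s2 vN = n" "fst s2 vV = v" "fst s2 vStamp = Suc (fst s vStamp)"
        using prems(2) s by (auto simp: agree_def com_defs set_var_def)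
      define ys where "ys = pool n (snd s2) v"
      have ys: "distinct ys" "set ys \<subseteq> {..<n}" unfolding ys_def using pk2 by blast+
      have "card {c. snd s2 Seen c = fst ?s1 vStamp} \<le> card {..<4 ^ (L * (length xs + L)) :: nat}"
        by (rule card_mono) (use pk2 in auto)
      then have "L * card {c. snd s2 Seen c = fst ?s1 vStamp} \<le> L * card {..<4 ^ (L * (length xs + L)) :: nat}"
        by (rule mult_le_mono2)
      moreover have "snd s2 Len v \<le> length xs + L * card {c. snd s2 Seen c = fst ?s1 vStamp}" using pk2 by blast
      ultimately have lys: "length ys \<le> m'" unfolding ys_def m'_def length_pool card_lessThan by linarith
      let ?H = "{y \<in> {..<n}. j \<le> card {w \<in> set ys. E y w}}"
      have "card ?H \<le> i * 2 ^ card (set ys)" by (rule bic[OF ys(2)])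
      also have "\<dots> \<le> i * 2 ^ m'" using lys distinct_card[OF ys(1)] by simp
      finally have H: "length ys + card ?H \<le> grow i L (length xs)" using lys gr by simp
      then have HZ: "length ys + card ?H \<le> Z" using grow len Z by simp
      show ?thesis
        apply (rule wp_mono[OF wp_heavy[where v = v and xs = ys and j = j]])
        using s2 s ys HZ apply (simp_all add: ys_def[symmetric])[7]
        subgoal premises hv for s3
        proof -
          let ?zs = "foldl snoc_new ys (filter (\<lambda>y. j \<le> card {w \<in> set ys. E y w}) [0..<n])"
          have p3: "pool n (snd s3) v = ?zs" "\<And>u. u < n \<Longrightarrow> u \<noteq> v \<Longrightarrow> pool n (snd s3) u = pool n (snd s) u"
            using hv(1) pk2 pool1 unfolding pools_upd_def by auto
          have s3: "fst s3 vStamp = Suc (fst s vStamp)" "snd s3 Seen = snd s2 Seen"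
            using hv(2) s2 by (auto simp: agree_def com_defs)
          have set3: "set ?zs = set ys \<union> ?H" unfolding foldl_snoc_new by auto
          have d3: "distinct ?zs" using ys(1) by (rule foldl_snoc_new)
          have "length ?zs = card (set ys \<union> ?H)" using distinct_card[OF d3] set3 by simp
          also have "\<dots> \<le> card (set ys) + card ?H" by (rule card_Un_le)
          finally have l3: "length ?zs \<le> grow i L (length xs)" using H distinct_card[OF ys(1)] by simp
          have len3: "snd s3 Len v = length ?zs" using arg_cong[OF p3(1), of length] by simp
          have "good M s3"
            unfolding good_def
          proof (intro conjI allI impI)
            fix u assume u: "u < n"
            show "distinct (pool n (snd s3) u)" "set (pool n (snd s3) u) \<subseteq> {..<n}"
              using d3 set3 ys(2) g u p3 unfolding good_def by (cases "u = v"; auto)+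
            show "snd s3 Len u \<le> M"
            proof (cases "u = v")
              case True
              then show ?thesis using len3 l3 grow len by simp
            next
              case False
              then have "snd s3 Len u = snd s Len u" using arg_cong[OF p3(2)[OF u], of length] by simp
              then show ?thesis using g u unfolding good_def by simp
            qed
          next
            fix c show "snd s3 Seen c \<le> fst s3 vStamp"
              using pk2 s3 by (simp add: set_var_def)
          qed
          moreover have "saturates E L j {..<n} (tuples L v s) (set xs) (set ?zs)"
            unfolding saturates_def
          \<comment> \<open>\<open>ys\<close>, the pool between the two halves, is the required
            \<open>Q\<close>.\<close>
          proof (intro exI[of _ "set ys"] conjI ballI impI)
            have "take (length xs) ys = xs" using pk2 unfolding ys_def by blast
            then show "set xs \<subseteq> set ys" by (metis set_take_subset)
            show "set ys \<subseteq> set ?zs" unfolding set3 by blast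
            fix X assume "X \<in> tuples L v s"
            then obtain u where "u < n" "u \<noteq> v" "\<forall>l<L. X l \<in> set (pool n (snd s) u)" unfolding tuples_def by blast
            then have "snd s2 Seen (type_code E L xs X) = fst ?s1 vStamp" using prems(1) unfolding pool1 by blast
            then obtain X' where "type_code E L xs X' = type_code E L xs X" "\<forall>l<L. X' l \<in> set ys"
              using pk2 unfolding ys_def by blast
            then show "\<exists>X'. same_type E L (set xs) X X' \<and> (\<forall>l<L. X' l \<in> set ys)"
              using type_code_same_type by metis
          qed (auto simp: set3)
          ultimately show ?thesis unfolding p3(1) len3 len xs_def[symmetric] using p3(2) l3 by blast
        qed
        done
    qed
    done
  then show ?thesis
    unfolding round_com_def wp_simps using s len by (simp add: wp_simps set_var_def fun_upd_twist)
qed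

end

lemma grow_mono: "m \<le> m' \<Longrightarrow> grow i L m \<le> grow i L m'"
  unfolding grow_def Let_def
  by (intro add_mono mult_le_mono order_refl power_increasing) auto

definition index_coloring :: "('v \<Rightarrow> 'v \<Rightarrow> bool) \<Rightarrow> nat \<Rightarrow> 'v list \<Rightarrow> (nat \<Rightarrow> nat) \<Rightarrow> bool" where
  "index_coloring E k xs d \<longleftrightarrow>
     (\<forall>z<length xs. (\<forall>y<length xs. 0 < d z \<longrightarrow> d z = d y \<longrightarrow> \<not> E (xs ! z) (xs ! y)) \<and>
        (\<forall>s<d z. s = 0 \<or> (\<exists>y<length xs. d y = s \<and> E (xs ! z) (xs ! y)))) \<and>
     (\<exists>z<length xs. d z = k)"

lemma index_coloring_cong:
  "(\<And>z. z < length xs \<Longrightarrow> d z = d' z) \<Longrightarrow> index_coloring E k xs d \<longleftrightarrow> index_coloring E k xs d'"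
  unfolding index_coloring_def by (intro arg_cong2[where f = "(\<and>)"] all_cong ex_cong) auto

lemma pool_coloring_index:
  "pool_coloring E k (set xs) c \<longleftrightarrow> index_coloring E k xs (\<lambda>z. c (xs ! z))"
proof -
  have *: "(\<forall>x\<in>set xs. P x) \<longleftrightarrow> (\<forall>z<length xs. P (xs ! z))" "(\<exists>x\<in>set xs. P x) \<longleftrightarrow> (\<exists>z<length xs. P (xs ! z))" for P
    by (metis in_set_conv_nth)+
  have "(\<forall>s\<in>{1..<m}. P s) \<longleftrightarrow> (\<forall>s<m. s = 0 \<or> P s)" for m :: nat and P by force
  then show ?thesis unfolding pool_coloring_def index_coloring_def * by (simp only:) blast
qed

text \<open>The search colors positions; as the entries are distinct, this is the same as coloring
  vertices.\<close>

lemma pool_coloring_digits: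
  assumes "distinct xs"
  shows "(\<exists>c. pool_coloring E k (set xs) c \<and> (\<forall>x. c x \<le> k)) \<longleftrightarrow>
     (\<exists>b<(k + 1) ^ length xs. index_coloring E k xs (\<lambda>z. b div (k + 1) ^ z mod (k + 1)))"
proof
  assume "\<exists>c. pool_coloring E k (set xs) c \<and> (\<forall>x. c x \<le> k)"
  then obtain c where c: "index_coloring E k xs (\<lambda>z. c (xs ! z))" "\<And>x. c x \<le> k"
    unfolding pool_coloring_index by blast
  obtain b where b: "b < (k + 1) ^ length xs" "\<forall>z<length xs. b div (k + 1) ^ z mod (k + 1) = c (xs ! z)"
    using digits_exist[of "length xs" "\<lambda>z. c (xs ! z)" "k + 1"] c(2) by (auto simp: less_Suc_eq_le)
  then have "index_coloring E k xs (\<lambda>z. b div (k + 1) ^ z mod (k + 1))"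
    using c(1) index_coloring_cong[of xs "\<lambda>z. b div (k + 1) ^ z mod (k + 1)" "\<lambda>z. c (xs ! z)" E k] by blast
  then show "\<exists>b<(k + 1) ^ length xs. index_coloring E k xs (\<lambda>z. b div (k + 1) ^ z mod (k + 1))"
    using b(1) by blast
next
  assume "\<exists>b<(k + 1) ^ length xs. index_coloring E k xs (\<lambda>z. b div (k + 1) ^ z mod (k + 1))"
  then obtain b where b: "index_coloring E k xs (\<lambda>z. b div (k + 1) ^ z mod (k + 1))" by blast
  define c where "c x = b div (k + 1) ^ (THE z. z < length xs \<and> xs ! z = x) mod (k + 1)" for x
  have "(THE z'. z' < length xs \<and> xs ! z' = xs ! z) = z" if "z < length xs" for z
    using that assms by (auto simp: nth_eq_iff_index_eq)
  then have "index_coloring E k xs (\<lambda>z. c (xs ! z))"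
    using b index_coloring_cong[of xs "\<lambda>z. c (xs ! z)" "\<lambda>z. b div (k + 1) ^ z mod (k + 1)" E k] unfolding c_def by simp
  moreover have "c x \<le> k" for x
    using mod_less_divisor[of "k + 1" "b div (k + 1) ^ (THE z. z < length xs \<and> xs ! z = x)"] unfolding c_def by simp
  ultimately show "\<exists>c. pool_coloring E k (set xs) c \<and> (\<forall>x. c x \<le> k)"
    unfolding pool_coloring_index by blast
qed

lemma represents_mono: "represents E V L t' v S \<Longrightarrow> t \<le> t' \<Longrightarrow> represents E V L t v S"
  unfolding represents_def by (meson le_trans)

text \<open>Colors of a Grundy set are positive, so this holds vacuously and the sweeps can start
  from arbitrary pools.\<close>

lemma represents_0: "represents E V L 0 v S"
  unfolding represents_def grundy_set_def by fastforce

section \<open>Building all pools in sweeps\<close>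

context pool_machine
begin

text \<open>The pool restarts from \<open>{v}\<close> whenever it is built, so its size bound
  depends on the number of rounds and does not accumulate over the sweeps.\<close>

lemma wp_build:
  assumes s: "fst s vN = n" "fst s vV = v" "v < n" "fst s vL = L" "fst s vR = R"
    and g: "good M s" and Z: "M \<le> Z" "M ^ L \<le> Z" "0 < L" "L \<le> Z" "R \<le> Z"
    and M: "\<And>b. b \<le> R \<Longrightarrow> (grow i L ^^ b) 1 \<le> M"
    and bic: "\<And>Q. Q \<subseteq> {..<n} \<Longrightarrow> card {y \<in> {..<n}. j \<le> card {w \<in> Q. E y w}} \<le> i * 2 ^ card Q"
  shows "wp inp Z (build_com j) (\<lambda>s'. good M s' \<and> (\<forall>u<n. u \<noteq> v \<longrightarrow> pool n (snd s') u = pool n (snd s) u) \<and>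
     (\<exists>P. P 0 = {v} \<and> P R = set (pool n (snd s') v) \<and>
        (\<forall>r<R. saturates E L j {..<n} (tuples L v s) (P r) (P (Suc r))))) s"
proof -
  let ?a = "(snd s)(Pool := (snd s Pool)(v := v), Len := (snd s Len)(v := 1))"
  have pv: "pool n ?a v = [v]" by (simp add: pool_def)
  have pu: "pool n ?a u = pool n (snd s) u" if "u < n" "u \<noteq> v" for u
  proof -
    have "z * n + u \<noteq> v" for z using row_col_eq_iff[OF that(1) s(3), of z 0] that(2) by simp
    then show ?thesis using that by (simp add: pool_def)
  qed
  let ?I = "\<lambda>b s'. good M s' \<and> (\<forall>u<n. u \<noteq> v \<longrightarrow> pool n (snd s') u = pool n (snd s) u) \<and>
     snd s' Len v \<le> (grow i L ^^ b) 1 \<and>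
     (\<exists>P. P 0 = {v} \<and> P b = set (pool n (snd s') v) \<and>
        (\<forall>r<b. saturates E L j {..<n} (tuples L v s) (P r) (P (Suc r))))"
  have g0: "good M (fst s, ?a)"
    unfolding good_def
  proof (intro conjI allI impI)
    fix u assume u: "u < n"
    show "distinct (pool n (snd (fst s, ?a)) u)" "set (pool n (snd (fst s, ?a)) u) \<subseteq> {..<n}"
      unfolding snd_conv using u pv pu[OF u] g s(3) unfolding good_def by (cases "u = v"; simp)+
    show "snd (fst s, ?a) Len u \<le> M"
      using u g M[of 0] unfolding good_def by simp
  next
    fix c show "snd (fst s, ?a) Seen c \<le> fst (fst s, ?a) vStamp" using g unfolding good_def by simp
  qed
  have I0: "?I 0 (fst s, ?a)"
    using g0 pv pu by (auto intro!: exI[of _ "\<lambda>_. {v}"])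
  have "wp inp Z (For vRound (Var vR) (round_com j)) (?I R) (fst s, ?a)"
    apply (rule wp_For[where I = ?I])
    using s Z I0 apply simp_all[3]
    subgoal premises prems for b s1
    proof -
      have b: "b < R" using prems(1) s by simp
      have s1: "fst s1 vN = n" "fst s1 vV = v" "fst s1 vL = L"
        using prems(3) s by (auto simp: agree_def com_defs)
      let ?s1 = "set_var vRound b s1"
      have sn: "snd ?s1 = snd s1" by (simp add: set_var_def)
      have g1: "good M ?s1" using prems(2) unfolding good_def by (simp add: set_var_def)
      have same: "\<And>u. u < n \<Longrightarrow> u \<noteq> v \<Longrightarrow> pool n (snd s1) u = pool n (snd s) u" using prems(2) by blast
      then have tup: "tuples L v ?s1 = tuples L v s" unfolding tuples_def sn by auto
      have gr: "grow i L (snd ?s1 Len v) \<le> (grow i L ^^ Suc b) 1"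
        using grow_mono[of "snd s1 Len v" "(grow i L ^^ b) 1" i L] prems(2) sn by simp
      show ?thesis
        apply (rule wp_mono[OF wp_round[where v = v and L = L and M = M and i = i and j = j]])
        using s1 s(3) Z g1 gr M[of "Suc b"] b bic apply (simp_all add: set_var_def)[11]
        subgoal premises rd for s2
        proof -
          obtain P where P: "P 0 = {v}" "P b = set (pool n (snd s1) v)"
            "\<And>r. r < b \<Longrightarrow> saturates E L j {..<n} (tuples L v s) (P r) (P (Suc r))" using prems(2) by blast
          have "saturates E L j {..<n} (tuples L v s) (P b) (set (pool n (snd s2) v))"
            using rd(1) P(2) unfolding tup sn by simp
          then have "\<exists>P. P 0 = {v} \<and> P (Suc b) = set (pool n (snd s2) v) \<and>
            (\<forall>r<Suc b. saturates E L j {..<n} (tuples L v s) (P r) (P (Suc r)))"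
            using P by (intro exI[of _ "P(Suc b := set (pool n (snd s2) v))"]) (auto simp: less_Suc_eq)
          then show ?thesis using rd(1) same gr sn by auto
        qed
        done
    qed
    subgoal using s by simp
    done
  then have "wp inp Z (For vRound (Var vR) (round_com j)) (\<lambda>s'. good M s' \<and>
     (\<forall>u<n. u \<noteq> v \<longrightarrow> pool n (snd s') u = pool n (snd s) u) \<and>
     (\<exists>P. P 0 = {v} \<and> P R = set (pool n (snd s') v) \<and>
        (\<forall>r<R. saturates E L j {..<n} (tuples L v s) (P r) (P (Suc r))))) (fst s, ?a)"
    by (rule wp_mono) blast
  then show ?thesis unfolding build_com_def wp_simps using s by simp
qed

lemma wp_pools:
  assumes s: "fst s vN = n" "fst s vK = k" "fst s vL = L" "fst s vR = R"
    and g: "good M s" and Z: "M \<le> Z" "M ^ L \<le> Z" "0 < L" "L \<le> Z" "R \<le> Z" "k \<le> Z"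
    and M: "\<And>b. b \<le> R \<Longrightarrow> (grow i L ^^ b) 1 \<le> M" and R: "L * j < R" and j: "0 < j"
    and bic: "\<And>Q. Q \<subseteq> {..<n} \<Longrightarrow> card {y \<in> {..<n}. j \<le> card {w \<in> Q. E y w}} \<le> i * 2 ^ card Q"
    and E: "symp E" "irreflp E"
  shows "wp inp Z (For vT (Var vK) (For vV (Var vN) (build_com j)))
     (\<lambda>s'. good M s' \<and> (\<forall>v<n. represents E {..<n} L k v (set (pool n (snd s') v)))) s"
proof -
  let ?rep = "\<lambda>t s' v. represents E {..<n} L t v (set (pool n (snd s') v))"
  show ?thesis
    apply (rule wp_For[where I = "\<lambda>t s'. good M s' \<and> (\<forall>v<n. ?rep t s' v)"])
    using s Z g apply (simp_all add: represents_0)[3]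
    subgoal premises prems for t s1
    proof -
      have s1: "fst s1 vN = n" "fst s1 vL = L" "fst s1 vR = R"
        using prems(3) s by (auto simp: agree_def com_defs)
      have g1: "good M (set_var vT t s1)" using prems(2) unfolding good_def by (simp add: set_var_def)
      show ?thesis
        \<comment> \<open>Pools are rebuilt in place: within a sweep some already handle color
          \<open>Suc t\<close>, the rest only \<open>t\<close>. By \<open>represents_mono\<close>
          the former can be used for \<open>t\<close> as well.\<close>
        apply (rule wp_For[where I = "\<lambda>b s'. good M s' \<and> (\<forall>v<n. ?rep (if v < b then Suc t else t) s' v)"])
        using s1 n_le g1 prems(2) apply (simp_all add: set_var_def)[3]
        subgoal premises inner for v s2
        proof -
          have v: "v < n" using inner(1) s1 by (simp add: set_var_def)
          have s2: "fst s2 vN = n" "fst s2 vL = L" "fst s2 vR = R"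
            using inner(3) s1 by (auto simp: agree_def com_defs set_var_def)
          have g2: "good M (set_var vV v s2)" using inner(2) unfolding good_def by (simp add: set_var_def)
          have rep2: "?rep t s2 u" if "u < n" for u
            using inner(2) that represents_mono[of E "{..<n}" L "Suc t" u _ t] by (auto split: if_splits)
          show ?thesis
            apply (rule wp_mono[OF wp_build[where v = v and L = L and R = R and M = M and i = i and j = j]])
            using s2 v g2 Z M bic apply (simp_all add: set_var_def)[13]
            subgoal premises bd for s3
            proof -
              obtain P where P: "P 0 = {v}" "P R = set (pool n (snd s3) v)"
                "\<And>r. r < R \<Longrightarrow> saturates E L j {..<n} (tuples L v s2) (P r) (P (Suc r))"
                using bd(1) by (auto simp: set_var_def tuples_def)
              have PV: "P R \<subseteq> {..<n}" using bd(1) v P(2) unfolding good_def by auto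
              have "represents E {..<n} L (Suc t) v (P R)"
                by (rule represents_step[where S = "\<lambda>u. set (pool n (snd s2) u)" and j = j])
                  (use E j P R PV rep2 in \<open>auto simp: tuples_def\<close>)
              then have "?rep (Suc t) s3 v" unfolding P(2) .
              moreover have "pool n (snd s3) u = pool n (snd s2) u" if "u < n" "u \<noteq> v" for u
                using bd(1) that by (simp add: set_var_def)
              ultimately show ?thesis using bd(1) inner(2) by (auto simp: less_Suc_eq)
            qed
            done
        qed
        subgoal using s1 by (auto simp: set_var_def)
        done
    qed
    subgoal using s by simp
    done
qed

text \<open>Colors have to be at most \<open>Z\<close> because they drive the loop over smaller
  colors and are left factors of products.\<close>

lemma wp_check:
  assumes s: "fst s vN = n" "fst s vV = v" "fst s vK = k" "fst s vM = length xs"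
    and xs: "pool n (snd s) v = xs" "set xs \<subseteq> {..<n}" and Z: "length xs \<le> Z"
    and d: "\<And>z. z < length xs \<Longrightarrow> snd s Tup z \<le> Z"
  shows "wp inp Z check_com (\<lambda>s'. fst s' vBad = 0 \<and> 0 < fst s' vHas \<longleftrightarrow> index_coloring E k xs (snd s Tup)) s"
proof -
  let ?d = "snd s Tup"
  have len: "snd s Len v = length xs" using arg_cong[OF xs(1), of length] by simp
  have nth: "snd s Pool (z * n + v) = xs ! z" "xs ! z < n" if "z < length xs" for z
  proof -
    show "snd s Pool (z * n + v) = xs ! z" using nth_pool[of z "snd s" v n] that len xs(1) by simp
    show "xs ! z < n" using nth_mem[OF that] xs(2) by blast
  qed
  let ?ok1 = "\<lambda>z y. 0 < ?d z \<longrightarrow> ?d z = ?d y \<longrightarrow> \<not> E (xs ! z) (xs ! y)"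
  let ?ok2 = "\<lambda>z s. s = 0 \<or> (\<exists>y<length xs. ?d y = s \<and> E (xs ! z) (xs ! y))"
  let ?ok = "\<lambda>z. (\<forall>y<length xs. ?ok1 z y) \<and> (\<forall>s<?d z. ?ok2 z s)"
  show ?thesis
    unfolding check_com_def wp_simps(2,4)
    apply (rule conjI, simp)
    apply (rule conjI, simp)
    apply (rule wp_For[where I = "\<lambda>b s'. (fst s' vBad = 0 \<longleftrightarrow> (\<forall>z<b. ?ok z)) \<and> (0 < fst s' vHas \<longleftrightarrow> (\<exists>z<b. ?d z = k))"])
    using s Z apply (simp_all add: set_var_def)[3]
    subgoal premises prems for b s1
    proof -
      have b: "b < length xs" using prems(1) s by (simp add: set_var_def)
      have s1: "fst s1 vN = n" "fst s1 vV = v" "fst s1 vK = k" "fst s1 vM = length xs" "snd s1 = snd s"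
        using prems(3) s by (auto simp: agree_def set_var_def)
      let ?h = "\<lambda>s'. 0 < fst s' vHas \<longleftrightarrow> (\<exists>z<Suc b. ?d z = k)"
      show ?thesis
        unfolding wp_simps(2,4)
        apply (rule conjI, simp)
        apply (rule wp_For[where I = "\<lambda>y s'. (fst s' vBad = 0 \<longleftrightarrow> (\<forall>z<b. ?ok z) \<and> (\<forall>y'<y. ?ok1 b y')) \<and> ?h s'"])
        using s1 Z prems(2) apply (auto simp add: set_var_def less_Suc_eq)[3]
        subgoal premises in1 for y s2
        proof -
          have y: "y < length xs" using in1(1) s1 by (simp add: set_var_def)
          have s2: "fst s2 vN = n" "fst s2 vV = v" "fst s2 vI = b" "snd s2 = snd s"
            using in1(3) s1 by (auto simp: agree_def set_var_def)
          show ?thesis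
            using in1(2) s2 nth[OF b] nth[OF y] y b inp[of "xs ! b" "xs ! y"] Z d[OF b] n_le four_le
            by (auto simp: wp_simps set_var_def less_Suc_eq)
        qed
        subgoal premises out1 for s2
        proof -
          have s2: "fst s2 vN = n" "fst s2 vV = v" "fst s2 vI = b" "fst s2 vM = length xs" "snd s2 = snd s"
            using out1(2) s1 by (auto simp: agree_def set_var_def)
          have b2: "(fst s2 vBad = 0 \<longleftrightarrow> (\<forall>z<b. ?ok z) \<and> (\<forall>y<length xs. ?ok1 b y)) \<and> ?h s2"
            using out1(1) s1 by (simp add: set_var_def)
          show ?thesis
            apply (rule wp_For[where I = "\<lambda>t s'. (fst s' vBad = 0 \<longleftrightarrow> (\<forall>z<b. ?ok z) \<and> (\<forall>y<length xs. ?ok1 b y) \<and> (\<forall>s<t. ?ok2 b s)) \<and> ?h s'"])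
            using s2 b2 d[OF b] apply (simp_all)[3]
            subgoal premises in2 for t s3
            proof -
              have s3: "fst s3 vN = n" "fst s3 vV = v" "fst s3 vI = b" "fst s3 vM = length xs" "snd s3 = snd s"
                using in2(3) s2 by (auto simp: agree_def set_var_def)
              show ?thesis
                unfolding wp_simps(2,4)
                apply (rule conjI, simp)
                apply (rule wp_For[where I = "\<lambda>z s'. 0 < fst s' vF \<longleftrightarrow> t = 0 \<or> (\<exists>y<z. ?d y = t \<and> E (xs ! b) (xs ! y))"])
                using s3 Z apply (simp_all add: set_var_def)[3]
                subgoal premises in3 for z s4
                proof -
                  have z: "z < length xs" using in3(1) s3 by (simp add: set_var_def)
                  have s4: "fst s4 vN = n" "fst s4 vV = v" "fst s4 vI = b" "fst s4 vS = t" "snd s4 = snd s"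
                    using in3(3) s3 by (auto simp: agree_def set_var_def)
                  show ?thesis
                    using in3(2) s4 nth[OF b] nth[OF z] z b inp[of "xs ! b" "xs ! z"] Z n_le four_le
                    by (auto simp: wp_simps set_var_def less_Suc_eq)
                qed
                subgoal premises out3 for s4
                proof -
                  have s4: "fst s4 vBad = fst s3 vBad" "fst s4 vHas = fst s3 vHas"
                    using out3(2) by (auto simp: agree_def set_var_def)
                  have "0 < fst s4 vF \<longleftrightarrow> ?ok2 b t" using out3(1) s3 by (simp add: set_var_def)
                  then show ?thesis using in2(2) s4 by (auto simp: set_var_def less_Suc_eq)
                qed
                done
            qed
            subgoal premises out2 for s3
              using out2(1) s2 by (auto simp: less_Suc_eq)
            done
        qed
        done
    qed
    subgoal for s' using s by (auto simp: index_coloring_def set_var_def)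
    done
qed

end

section \<open>Exhaustive search and the whole program\<close>

context pool_machine
begin

lemma wp_decide:
  assumes s: "fst s vN = n" "fst s vK = k" "fst s vAns = 0"
    and g: "good M s" and Z: "M \<le> Z" "(k + 1) ^ M \<le> Z" "k + 1 \<le> Z"
  shows "wp inp Z decide_com (\<lambda>s'. fst s' vAns = of_bool (\<exists>v<n. \<exists>b<(k + 1) ^ snd s Len v.
     index_coloring E k (pool n (snd s) v) (\<lambda>z. b div (k + 1) ^ z mod (k + 1)))) s"
proof -
  let ?x = "\<lambda>v b. index_coloring E k (pool n (snd s) v) (\<lambda>z. b div (k + 1) ^ z mod (k + 1))"
  let ?ex = "\<lambda>v. \<exists>b<(k + 1) ^ snd s Len v. ?x v b"
  show ?thesis
    unfolding decide_com_def
    apply (rule wp_For[where I = "\<lambda>v s'. fst s' vAns = of_bool (\<exists>u<v. ?ex u)"])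
    using s n_le apply simp_all[3]
    subgoal premises prems for v s1
    proof -
      have v: "v < n" using prems(1) s by simp
      define m where "m = snd s Len v"
      define xs where "xs = pool n (snd s) v"
      have lx: "length xs = m" unfolding xs_def m_def by simp
      have m: "m \<le> M" and xn: "set xs \<subseteq> {..<n}" using g v unfolding good_def m_def xs_def by auto
      have pm: "(k + 1) ^ m \<le> Z" using Z(2) power_increasing[OF m, of "k + 1"] by simp
      have s1: "fst s1 vN = n" "fst s1 vK = k" "snd s1 Len = snd s Len" "snd s1 Pool = snd s Pool"
        using prems(3) s by (auto simp: agree_def com_defs)
      let ?s2 = "set_var vB (k + 1) (set_var vM m (set_var vV v s1))"
      have "wp inp Z (Semi (power_com (Var vM)) (For vIt (Var vP) (Semi (decode_com vM) (Semi check_com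
        (Cond (Times (Minus (Const 1) (Var vBad)) (Var vHas)) (Assign vAns (Const 1)) Nop)))))
        (\<lambda>s'. fst s' vAns = of_bool (\<exists>u<Suc v. ?ex u)) ?s2"
        unfolding wp_simps(4)
        apply (rule wp_mono[OF wp_power])
        using m Z apply (simp_all add: set_var_def)[3]
        subgoal premises pw for s3
        proof -
          have s3: "fst s3 vN = n" "fst s3 vK = k" "fst s3 vV = v" "fst s3 vM = m" "fst s3 vB = k + 1"
            "fst s3 vP = (k + 1) ^ m" "snd s3 Len = snd s Len" "snd s3 Pool = snd s Pool"
            "fst s3 vAns = of_bool (\<exists>u<v. ?ex u)"
            using pw s1 prems(2) by (auto simp: agree_def com_defs set_var_def)
          show ?thesis
            apply (rule wp_For[where I = "\<lambda>b s'. fst s' vAns = of_bool ((\<exists>u<v. ?ex u) \<or> (\<exists>b'<b. ?x v b'))"])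
            using s3 pm apply simp_all[3]
            subgoal premises it for b s4
            proof -
              have b: "b < (k + 1) ^ m" using it(1) s3 by simp
              have s4: "fst s4 vN = n" "fst s4 vK = k" "fst s4 vV = v" "fst s4 vM = m" "fst s4 vB = k + 1"
                "snd s4 Len = snd s Len" "snd s4 Pool = snd s Pool"
                using it(3) s3 by (auto simp: agree_def com_defs)
              show ?thesis
                unfolding wp_simps(4)
                apply (rule wp_mono[OF wp_decode])
                using b pm s4 m Z apply (simp_all add: set_var_def)[4]
                subgoal premises dc for s5
                proof -
                  have s5: "fst s5 vN = n" "fst s5 vK = k" "fst s5 vV = v" "fst s5 vM = m"
                    "snd s5 Len = snd s Len" "snd s5 Pool = snd s Pool" "fst s5 vAns = fst s4 vAns"
                    using dc(2) s4 by (auto simp: agree_def com_defs set_var_def)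
                  have tup: "snd s5 Tup z = b div (k + 1) ^ z mod (k + 1)" if "z < m" for z
                    using dc(1) that s4 by (simp add: set_var_def)
                  have tupZ: "snd s5 Tup z \<le> Z" if "z < m" for z
                  proof -
                    have "b div (k + 1) ^ z mod (k + 1) < k + 1" by (rule mod_less_divisor) simp
                    then show ?thesis using tup[OF that] Z(3) by linarith
                  qed
                  have p5: "pool n (snd s5) v = xs" unfolding xs_def using pool_cong[of "snd s5" "snd s" n] s5 by simp
                  have eq: "index_coloring E k xs (snd s5 Tup) \<longleftrightarrow> ?x v b"
                    unfolding xs_def[symmetric] by (rule index_coloring_cong) (use tup lx in simp)
                  show ?thesis
                    apply (rule wp_mono[OF wp_check[where v = v and xs = xs and k = k]])
                    using s5 lx p5 xn m Z tupZ apply simp_all[8]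
                    subgoal premises ck for s6
                    proof -
                      have a6: "fst s6 vAns = fst s4 vAns" using ck(2) s5 by (auto simp: agree_def com_defs)
                      have "fst s6 vBad = 0 \<and> 0 < fst s6 vHas \<longleftrightarrow> ?x v b" using ck(1) eq by simp
                      then show ?thesis using a6 it(2) Z(3)
                        by (cases "fst s6 vBad") (auto simp: wp_simps set_var_def less_Suc_eq)
                    qed
                    done
                qed
                done
            qed
            subgoal for s' using s3 by (auto simp: less_Suc_eq m_def)
            done
        qed
        done
      then show ?thesis
        unfolding wp_simps(2) wp_simps(4)[of _ _ "Assign _ _"] using s1 by (simp add: set_var_def m_def)
    qed
    subgoal using s by simp
    done
qed

text \<open>\<open>R\<close> is the least number above \<open>L * j\<close>, as the pigeonhole
  argument in \<open>exchange\<close> demands. After \<open>k\<close> sweeps the pools handle color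
  \<open>k\<close>, the only color whose existence has to be tested.\<close>

lemma wp_main:
  assumes G: "pair_graph G" "pverts G = {..<n}" "biclique_free i j G" and k: "0 < k" and j: "0 < j"
    and E: "E = adj G" and L: "L = 2 ^ k" and R: "R = j * L + 1"
    and s: "fst s vN = n" "fst s vK = k" "fst s vAns = 0" "\<And>u. snd s Len u = 0" "\<And>c. snd s Seen c \<le> fst s vStamp"
    and M: "\<And>b. b \<le> R \<Longrightarrow> (grow i L ^^ b) 1 \<le> M"
    and Z: "M \<le> Z" "M ^ L \<le> Z" "L \<le> Z" "R \<le> Z" "j \<le> Z" "(k + 1) ^ M \<le> Z" "k + 1 \<le> Z"
  shows "wp inp Z (main_com j) (\<lambda>s'. fst s' vN = (if grundy_at_least G k then 1 else 0)) s"
proof -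
  interpret G: pair_graph G by (rule G(1))
  have bic: "card {y \<in> {..<n}. j \<le> card {w \<in> Q. E y w}} \<le> i * 2 ^ card Q" if "Q \<subseteq> {..<n}" for Q
    using card_many_neighbors_le[OF G(1,3), of Q] that unfolding G(2) E by simp
  have Eg: "symp E" "irreflp E" using G.adj_graph unfolding E by auto
  let ?init = "Semi (Assign vB (Const 2)) (Semi (power_com (Var vK)) (Semi (Assign vL (Var vP))
       (Assign vR (Plus (Times (Const j) (Var vL)) (Const 1)))))"
  have init: "wp inp Z ?init (\<lambda>s'. fst s' vL = L \<and> fst s' vR = R) s"
    unfolding wp_simps(2,4)
    apply (rule conjI, simp)
    apply (rule wp_mono[OF wp_power])
    using s Z four_le apply (simp_all add: set_var_def)[3]
    using s Z by (auto simp: set_var_def agree_def com_defs L R)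
  show ?thesis
    unfolding main_com_def wp_simps(4)[of _ _ ?init]
    apply (rule wp_mono[OF init])
    subgoal premises prems for s1
    proof -
      have s1: "fst s1 vN = n" "fst s1 vK = k" "fst s1 vAns = 0" "snd s1 = snd s" "fst s1 vStamp = fst s vStamp"
        using prems(2) s by (auto simp: agree_def com_defs)
      have "good M s1" unfolding good_def using s s1 by (simp add: pool_def)
      then have pools: "wp inp Z (For vT (Var vK) (For vV (Var vN) (build_com j)))
         (\<lambda>s'. good M s' \<and> (\<forall>v<n. represents E {..<n} L k v (set (pool n (snd s') v)))) s1"
        by (intro wp_pools[where R = R and L = L and M = M and i = i and k = k])
          (use s1 prems(1) Z M bic Eg j in \<open>auto simp: L R mult.commute\<close>)
      show ?thesis
        unfolding wp_simps(4)
        apply (rule wp_mono[OF pools])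
        subgoal premises pl for s2
        proof -
          have s2: "fst s2 vN = n" "fst s2 vK = k" "fst s2 vAns = 0"
            using pl(2) s1 by (auto simp: agree_def com_defs)
          have g2: "good M s2" using pl(1) by blast
          have "grundy_at_least G k \<longleftrightarrow>
             (\<exists>v\<in>pverts G. \<exists>c. pool_coloring (adj G) k (set (pool n (snd s2) v)) c \<and> (\<forall>x. c x \<le> k))"
          proof (rule grundy_at_least_iff_pool_coloring[OF G(1) k])
            show "2 ^ (k - 1) \<le> L" unfolding L by simp
            fix v assume "v \<in> pverts G"
            then have "v < n" using G(2) by simp
            then show "represents (adj G) (pverts G) L k v (set (pool n (snd s2) v))"
              "set (pool n (snd s2) v) \<subseteq> pverts G"
              using pl(1) unfolding good_def G(2) E by auto
          qed
          also have "\<dots> \<longleftrightarrow> (\<exists>v<n. \<exists>b<(k + 1) ^ snd s2 Len v.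
              index_coloring E k (pool n (snd s2) v) (\<lambda>z. b div (k + 1) ^ z mod (k + 1)))"
          proof -
            have "(\<exists>c. pool_coloring (adj G) k (set (pool n (snd s2) v)) c \<and> (\<forall>x. c x \<le> k)) \<longleftrightarrow>
               (\<exists>b<(k + 1) ^ snd s2 Len v. index_coloring E k (pool n (snd s2) v) (\<lambda>z. b div (k + 1) ^ z mod (k + 1)))"
              if "v < n" for v
              using pool_coloring_digits[of "pool n (snd s2) v" E k] g2 that unfolding good_def E by simp
            then show ?thesis unfolding G(2) by auto
          qed
          finally have iff: "grundy_at_least G k \<longleftrightarrow> \<dots>" .
          show ?thesis
            apply (rule wp_mono[OF wp_decide[OF s2 g2 Z(1,6,7)]])
            subgoal for s3 unfolding iff[symmetric] by (simp add: wp_simps set_var_def)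
            done
        qed
        done
    qed
    done
qed

end

definition prelude :: prog where
  "prelude = SEQ (ADD 4 1 3) (SEQ (LIT 1 0) (SEQ (ADD 3 0 1) (SEQ (LIT 5 1)
     (WHILENZ 3 (SEQ (ADD 1 1 0) (SUB 3 3 5))))))"

text \<open>Register 1 arrives with \<open>k\<close> but must hold \<open>n * n\<close> for the
  compiled program; \<open>k\<close> moves to register 4, and the square is a sum of
  \<open>n\<close> copies of \<open>n\<close>.\<close>

lemma runs_prelude:
  "runs prelude (graph_input n G k) (\<lambda>t s'. t \<le> 3 * n + 5 \<and>
     rep (n * n) (snd (graph_input n G k)) ((\<lambda>_. 0)(vN := n, vK := k), \<lambda>_ _. 0) s')"
proof -
  define m where "m = snd (graph_input n G k)"
  define r where "r = ((\<lambda>_. 0)(0 := n, 1 := 0, 3 := n, 4 := k, 5 := 1) :: nat \<Rightarrow> nat)"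
  define I where "I b s' \<longleftrightarrow> snd s' = m \<and> fst s' 1 = b * n \<and> fst s' 3 = n - b \<and> fst s' 5 = 1 \<and>
      (\<forall>x. fst s' (2 * x) = r (2 * x))" for b and s' :: state
  have "I 0 (r, m)" unfolding I_def r_def by simp
  then have "runs (WHILENZ 3 (SEQ (ADD 1 1 0) (SUB 3 3 5))) (r, m) (\<lambda>t s'. t \<le> n * (2 + 1) + 1 \<and> I n s')"
  proof (rule runs_countdown)
    fix b and s' :: state assume I: "I b s'" "b < n"
    obtain r' m' where [simp]: "s' = (r', m')" by (cases s')
    have "2 * x \<noteq> Suc 0" "2 * x \<noteq> 3" for x :: nat by presburger+
    moreover have "r' 0 = n" using I(1) unfolding I_def r_def by (metis fst_conv fun_upd_apply mult_0_right \<open>s' = _\<close> One_nat_def zero_neq_one zero_neq_numeral)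
    ultimately show "runs (SEQ (ADD 1 1 0) (SUB 3 3 5)) s' (\<lambda>t s'. t \<le> 2 \<and> I (Suc b) s')"
      using I unfolding I_def by auto
  qed (simp add: I_def)
  then have loop: "runs (WHILENZ 3 (SEQ (ADD 1 1 0) (SUB 3 3 5))) (r, m) (\<lambda>t s'. t \<le> 3 * n + 1 \<and>
      rep (n * n) m ((\<lambda>_. 0)(vN := n, vK := k), \<lambda>_ _. 0) s')"
  proof (rule runs_mono)
    fix t s' assume *: "t \<le> n * (2 + 1) + 1 \<and> I n s'"
    have "2 * x \<noteq> Suc 0" "2 * x \<noteq> 3" "2 * x \<noteq> 5" "2 * x = 4 \<longleftrightarrow> x = 2" for x :: nat by presburger+
    then have "rep (n * n) m ((\<lambda>_. 0)(vN := n, vK := k), \<lambda>_ _. 0) s'"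
      using * unfolding I_def rep_def r_def m_def tmp_def graph_input_def by auto
    then show "t \<le> 3 * n + 1 \<and> rep (n * n) m ((\<lambda>_. 0)(vN := n, vK := k), \<lambda>_ _. 0) s'" using * by simp
  qed
  have "graph_input n G k = ((\<lambda>_. 0)(0 := n, 1 := k), m)" unfolding m_def graph_input_def by simp
  moreover have "((\<lambda>_. 0)(0 := n, 1 := k, 4 := k, 1 := 0, 3 := n, 5 := 1) :: nat \<Rightarrow> nat) = r"
    unfolding r_def by (auto simp: fun_eq_iff)
  ultimately show ?thesis
    unfolding prelude_def m_def[symmetric] using runs_mono[OF loop] by (simp add: fun_upd_twist)
qed


section \<open>Exponential towers and their computability\<close>

fun tower :: "nat \<Rightarrow> nat \<Rightarrow> nat" where
  "tower b 0 = b"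
| "tower b (Suc r) = 2 ^ tower b r"

lemma tower_mono: "r \<le> r' \<Longrightarrow> tower b r \<le> tower b r'"
proof (induction rule: dec_induct)
  case (step r')
  then show ?case using less_exp[of "tower b r'"] unfolding tower.simps by linarith
qed simp

lemma tower_ge: "b \<le> tower b r"
  using tower_mono[of 0 r b] by simp

lemma square_le_power2: "4 \<le> x \<Longrightarrow> x * x \<le> 2 ^ x" for x :: nat
proof (induction x rule: dec_induct)
  case (step x)
  have "Suc x * Suc x = x * x + (2 * x + 1)" by simp
  also have "2 * x + 1 \<le> x * x" using step(1) mult_le_mono1[OF step(1), of x] by linarith
  finally show ?case using step by simp
qed simp

text \<open>From 4 on, \<open>T * T \<le> 2 ^ T\<close>. One level thus pays for a sum or a product
  and, since \<open>T ^ T \<le> 2 ^ (T * T)\<close>, two levels pay for a power.\<close>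

lemma tower_closure:
  assumes "4 \<le> b" "x \<le> tower b r" "y \<le> tower b r"
  shows "r < q \<Longrightarrow> x + y \<le> tower b q" "r < q \<Longrightarrow> x * y \<le> tower b q" "Suc r < q \<Longrightarrow> x ^ y \<le> tower b q"
proof -
  define T where "T = tower b r"
  have T: "4 \<le> T" using assms(1) tower_ge[of b r] unfolding T_def by simp
  have xy: "x \<le> T" "y \<le> T" using assms unfolding T_def by auto
  have sq: "T * T \<le> 2 ^ T" by (rule square_le_power2[OF T])
  have "x * y \<le> T * T" using xy by (rule mult_le_mono)
  then have "x * y \<le> tower b (Suc r)" using sq unfolding tower.simps T_def[symmetric] by linarith
  then show "x * y \<le> tower b q" if "r < q" using tower_mono[of "Suc r" q b] that by linarith
  have "2 * T \<le> T * T" using T by (intro mult_le_mono1) simp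
  then have "x + y \<le> tower b (Suc r)" using sq xy unfolding tower.simps T_def[symmetric] by linarith
  then show "x + y \<le> tower b q" if "r < q" using tower_mono[of "Suc r" q b] that by linarith
  have "x ^ y \<le> T ^ y" using xy by (simp add: power_mono)
  also have "\<dots> \<le> T ^ T" using xy T by (intro power_increasing) auto
  also have "\<dots> \<le> (2 ^ T) ^ T" using less_exp[of T] by (intro power_mono) auto
  also have "\<dots> = 2 ^ (T * T)" by (simp add: power_mult)
  also have "\<dots> \<le> 2 ^ (2 ^ T)" using sq by (intro power_increasing) auto
  finally have "x ^ y \<le> tower b (Suc (Suc r))" unfolding tower.simps T_def[symmetric] .
  then show "x ^ y \<le> tower b q" if "Suc r < q" using tower_mono[of "Suc (Suc r)" q b] that by linarith
qed

text \<open>The ten levels are those of the operations in \<open>grow\<close>: two powers at two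
  levels each and six sums or products at one each.\<close>

lemma grow_le_tower:
  assumes b: "4 \<le> b" and L: "L \<le> b" and i: "i \<le> b" and m: "m \<le> tower b r"
  shows "grow i L m \<le> tower b (r + 10)"
proof -
  have up: "x \<le> tower b r'" if "x \<le> tower b r" "r \<le> r'" for x r r'
    using that tower_mono order_trans by blast
  have L': "L \<le> tower b q" and i': "i \<le> tower b q" and n4: "4 \<le> tower b q" for q
    using L i b tower_ge[of b q] by auto
  note add = tower_closure(1)[OF b] and mul = tower_closure(2)[OF b] and pow = tower_closure(3)[OF b]
  have "m + L \<le> tower b (r + 1)" by (rule add[OF m L']) simp
  then have "L * (m + L) \<le> tower b (r + 2)" by (rule mul[OF L']) simp
  then have "4 ^ (L * (m + L)) \<le> tower b (r + 4)" by (rule pow[OF n4]) simp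
  then have "L * 4 ^ (L * (m + L)) \<le> tower b (r + 5)" by (rule mul[OF L']) simp
  then have m': "m + L * 4 ^ (L * (m + L)) \<le> tower b (r + 6)" (is "?m \<le> _")
    by (rule add[OF up[OF m le_add1]]) simp
  have two: "2 \<le> tower b (r + 6)" using n4[of "r + 6"] by linarith
  have "2 ^ ?m \<le> tower b (r + 8)" by (rule pow[OF two m']) simp
  then have "i * 2 ^ ?m \<le> tower b (r + 9)" by (rule mul[OF i']) simp
  then have "?m + i * 2 ^ ?m \<le> tower b (r + 10)" by (rule add[OF up[OF m'], rotated]) simp_all
  then show ?thesis unfolding grow_def Let_def .
qed

lemma grow_iter_le_tower:
  assumes "4 \<le> b" "L \<le> b" "i \<le> b"
  shows "(grow i L ^^ r) 1 \<le> tower b (10 * r)"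
proof (induction r)
  case (Suc r)
  then show ?case using grow_le_tower[OF assms Suc] by (simp add: add.commute)
qed (use assms in simp)

definition exp2_prog :: prog where
  "exp2_prog = SEQ (LIT 2 1) (SEQ (LIT 3 1) (SEQ (LIT 4 0)
     (SEQ (WHILENZ 0 (SEQ (ADD 2 2 2) (SUB 0 0 3))) (ADD 0 2 4))))"

text \<open>Registers 3, 4 and 5 are tracked for the caller: 5 is its loop counter, 3 its constant
  1, and 4 a zero used for copying.\<close>

lemma runs_exp2:
  "runs exp2_prog (r, m) (\<lambda>_ s'. fst s' 0 = 2 ^ r 0 \<and> fst s' 4 = 0 \<and> fst s' 3 = 1 \<and> fst s' 5 = r 5)"
proof -
  define I where "I b s' \<longleftrightarrow> fst s' 0 = r 0 - b \<and> fst s' 2 = 2 ^ b \<and> fst s' 3 = 1 \<and> fst s' 4 = 0 \<and> fst s' 5 = r 5"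
    for b and s' :: state
  have "I 0 (r(2 := 1, 3 := 1, 4 := 0), m)" unfolding I_def by simp
  then have "runs (WHILENZ 0 (SEQ (ADD 2 2 2) (SUB 0 0 3))) (r(2 := 1, 3 := 1, 4 := 0), m)
      (\<lambda>t s'. t \<le> r 0 * (2 + 1) + 1 \<and> I (r 0) s')"
    by (rule runs_countdown) (auto simp: I_def)
  then show ?thesis
    unfolding exp2_prog_def by (simp, elim runs_mono) (auto simp: I_def)
qed

lemma runs_tower:
  assumes "r 3 = 1"
  shows "runs (WHILENZ 5 (SEQ exp2_prog (SUB 5 5 3))) (r, m) (\<lambda>_ s'. fst s' 0 = tower (r 0) (r 5))"
proof -
  \<comment> \<open>The loop exponentiates at the bottom of the tower, while \<open>tower\<close>
    recurses at the top.\<close>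
  have tower_rotate: "tower (2 ^ b) q = tower b (Suc q)" for b q by (induction q) auto
  have "r 5 = q \<Longrightarrow> runs (WHILENZ 5 (SEQ exp2_prog (SUB 5 5 3))) (r, m) (\<lambda>_ s'. fst s' 0 = tower (r 0) q)"
    if "r 3 = 1" for q r m
    using that
  proof (induction q arbitrary: r m)
    case 0
    then show ?case using exec.LoopF[of "(r, m)" 5] unfolding runs_def by fastforce
  next
    case (Suc q)
    have "runs (SEQ exp2_prog (SUB 5 5 3)) (r, m) (\<lambda>_ s'. fst s' 0 = 2 ^ r 0 \<and> fst s' 3 = 1 \<and> fst s' 5 = q)"
      unfolding runs_simps(7) by (rule runs_mono[OF runs_exp2]) (use Suc.prems in auto)
    then obtain t s' where 1: "exec (SEQ exp2_prog (SUB 5 5 3)) (r, m) t s'" "fst s' 0 = 2 ^ r 0" "fst s' 3 = 1" "fst s' 5 = q"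
      unfolding runs_def by blast
    obtain t' s'' where 2: "exec (WHILENZ 5 (SEQ exp2_prog (SUB 5 5 3))) s' t' s''" "fst s'' 0 = tower (fst s' 0) q"
      using Suc.IH[of "fst s'" "snd s'"] 1 unfolding runs_def by auto
    have "exec (WHILENZ 5 (SEQ exp2_prog (SUB 5 5 3))) (r, m) (t + t' + 1) s''"
      by (rule exec.LoopT[OF _ 1(1) 2(1)]) (use Suc.prems in simp)
    then show ?case unfolding runs_def using 2(2) unfolding 1(2) tower_rotate by blast
  qed
  then show ?thesis using assms by blast
qed

text \<open>Equal base and height let one exponentiation initialize both.\<close>

lemma computable_tower: "computable (\<lambda>k. tower (2 ^ (k + c)) (2 ^ (k + c)))"
proof -
  define p where "p = SEQ (LIT 1 c) (SEQ (ADD 0 0 1) (SEQ exp2_prog (SEQ (ADD 5 0 4)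
     (WHILENZ 5 (SEQ exp2_prog (SUB 5 5 3))))))"
  have "runs p ((\<lambda>_. 0)(0 := k), \<lambda>_. 0) (\<lambda>_ s'. fst s' 0 = tower (2 ^ (k + c)) (2 ^ (k + c)))" for k
    unfolding p_def runs_simps(2,3,7)
    apply (rule runs_mono[OF runs_exp2])
    subgoal premises prems for t s'
    proof -
      obtain r m where [simp]: "s' = (r, m)" by (cases s')
      have "r 0 = 2 ^ (k + c)" "r 4 = 0" "r 3 = 1" using prems by auto
      then show ?thesis using runs_tower[of "r(5 := r 0 + r 4)" m] by (simp add: runs_simps(3))
    qed
    done
  then show ?thesis unfolding computable_def runs_def by (metis prod.collapse)
qed

theorem theorem3:
  fixes i j :: nat
  assumes "i > 0" and "j > 0"
  shows "\<exists>(p :: prog) (g :: nat \<Rightarrow> nat) (d :: nat). computable g \<and>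
           (\<forall>(n :: nat) (G :: nat pair_pre_digraph) (k :: nat).
              pair_graph G \<and> pverts G = {..<n} \<and> biclique_free i j G \<and> k > 0 \<longrightarrow>
              (\<exists>t r m. exec p (graph_input n G k) t (r, m) \<and>
                       t \<le> g k * (max 1 n) ^ d \<and>
                       r 0 = (if grundy_at_least G k then 1 else 0)))"
proof -
  \<comment> \<open>The exponent of \<open>n\<close> is the nesting depth of a program that depends
    on \<open>j\<close> alone. The 8 in \<open>w\<close> pays for the prelude.\<close>
  define d where "d = depth (main_com j)"
  define w where "w = com_cost (main_com j) + 8"
  \<comment> \<open>\<open>c\<close> adds up the constants that must lie below
    \<open>b = 2 ^ (k + c)\<close>. As \<open>L * c \<le> b\<close>, the summand
    \<open>10 * j + 16\<close> makes the height \<open>10 * R + 6\<close> fit for every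
    \<open>k\<close>.\<close>
  define c where "c = 10 * j + 16 + i + w + d"
  define g where "g k = tower (2 ^ (k + c)) (2 ^ (k + c))" for k
  have d0: "0 < d" unfolding d_def by (rule depth_pos)
  have "\<exists>t r m. exec (SEQ prelude (compile (main_com j) 1)) (graph_input n G k) t (r, m) \<and>
      t \<le> g k * (max 1 n) ^ d \<and> r 0 = (if grundy_at_least G k then 1 else 0)"
    if G: "pair_graph G" "pverts G = {..<n}" "biclique_free i j G" and k: "0 < k" for n G k
  proof -
    define inp where "inp = snd (graph_input n G k)"
    define b where "b = (2::nat) ^ (k + c)"
    define L where "L = (2::nat) ^ k"
    define R where "R = j * L + 1"
    define M where "M = tower b (10 * R)"
    \<comment> \<open>Two levels above \<open>M\<close> absorb the number \<open>M ^ L\<close> of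
      tuples and the number \<open>(k + 1) ^ M\<close> of colorings. In \<open>Z\<close> the vertex
      count enters as a single factor, which keeps the dependence on \<open>n\<close>
      polynomial.\<close>
    define B where "B = tower b (10 * R + 2)"
    define Z where "Z = B * max 1 n"
    have b: "L * c \<le> b" unfolding b_def L_def power_add using less_exp[of c] by simp
    have L1: "1 \<le> L" "k + 1 \<le> L" unfolding L_def using Suc_leI[OF less_exp[of k]] by auto
    have "c \<le> L * c" using L1 by simp
    then have cb: "c \<le> b" using b by (rule order_trans)
    have "L \<le> L * c" unfolding c_def by simp
    then have Lb: "L \<le> b" using b by (rule order_trans)
    have Rb: "10 * R + 6 \<le> b"
    proof -
      have "10 * R + 6 = L * (10 * j) + 16" unfolding R_def by simp
      also have "\<dots> \<le> L * (10 * j) + L * 16" using L1 by simp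
      also have "\<dots> = L * (10 * j + 16)" by (simp add: algebra_simps)
      also have "\<dots> \<le> L * c" unfolding c_def by (rule mult_le_mono2) simp
      finally show ?thesis using b by simp
    qed
    have b4: "4 \<le> b" "i \<le> b" "j \<le> b" "w \<le> b" "d \<le> b" "k + 1 \<le> b" "R \<le> b"
      using cb Lb L1 Rb unfolding c_def by auto
    note cl = tower_closure[OF b4(1)]
    have bt: "x \<le> tower b q" if "x \<le> b" for x q using that tower_ge[of b q] by simp
    have BZ: "x \<le> Z" if "x \<le> B" for x
    proof -
      have "B * 1 \<le> B * max 1 n" by (rule mult_le_mono2) simp
      then show ?thesis using that unfolding Z_def mult_1_right by linarith
    qed
    have bZ: "x \<le> Z" if "x \<le> b" for x using BZ[of x] bt[OF that] unfolding B_def by blast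
    have B1: "4 \<le> B" unfolding B_def using bt b4 by blast
    have nZ: "n \<le> Z"
    proof -
      have "1 * max 1 n \<le> B * max 1 n" by (rule mult_le_mono1) (use B1 in simp)
      then show ?thesis unfolding Z_def mult_1 by linarith
    qed
    have inp_adj: "inp (x * n + y) = of_bool (adj G x y)" if "x < n" "y < n" for x y
    proof -
      have "x * n + y < Suc x * n" using that by simp
      also have "\<dots> \<le> n * n" by (rule mult_le_mono1) (use that in simp)
      finally show ?thesis using that unfolding inp_def graph_input_def adj_def by simp
    qed
    interpret pool_machine n Z inp "adj G"
      by unfold_locales (use inp_adj nZ BZ[OF B1] in auto)
    let ?s = "((\<lambda>_. 0)(vN := n, vK := k), \<lambda>_ _. 0) :: store"
    have wp: "wp inp Z (main_com j) (\<lambda>s'. fst s' vN = (if grundy_at_least G k then 1 else 0)) ?s"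
    proof (rule wp_main[OF G k assms(2) refl L_def R_def])
      show "(grow i L ^^ b') 1 \<le> M" if "b' \<le> R" for b'
        using grow_iter_le_tower[OF b4(1) Lb b4(2), of b'] tower_mono[of "10 * b'" "10 * R" b] that
        unfolding M_def by simp
      have "M \<le> B" unfolding M_def B_def by (rule tower_mono) simp
      then show "M \<le> Z" by (rule BZ)
      have "M ^ L \<le> B" "(k + 1) ^ M \<le> B"
        unfolding M_def B_def by (rule cl(3)[OF order_refl bt[OF Lb]], simp) (rule cl(3)[OF bt[OF b4(6)] order_refl], simp)
      then show "M ^ L \<le> Z" "(k + 1) ^ M \<le> Z" by (auto intro: BZ)
      show "L \<le> Z" "R \<le> Z" "j \<le> Z" "k + 1 \<le> Z"
        using b4 Lb bZ by blast+
    qed simp_all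
    have "runs (SEQ prelude (compile (main_com j) 1)) (graph_input n G k)
      (\<lambda>t s'. t \<le> 3 * n + 5 + com_cost (main_com j) * (Z + 1) ^ d \<and> rep (n * n) inp (sem inp (main_com j) ?s) s')"
      unfolding runs_simps(7)
      apply (rule runs_mono[OF runs_prelude])
      subgoal premises prems for t s'
        apply (rule runs_mono[OF compile_correct[where N = "n * n" and inp = inp and s = ?s and Z = Z]])
        using wp prems unfolding wp_def inp_def d_def by (auto simp: graph_input_def)
      done
    then obtain t r m where ex: "exec (SEQ prelude (compile (main_com j) 1)) (graph_input n G k) t (r, m)"
        "t \<le> 3 * n + 5 + com_cost (main_com j) * (Z + 1) ^ d" "rep (n * n) inp (sem inp (main_com j) ?s) (r, m)"
      unfolding runs_def by auto
    have "r 0 = fst (sem inp (main_com j) ?s) vN" using ex(3) unfolding rep_def by (metis fst_conv mult_0_right)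
    then have "r 0 = (if grundy_at_least G k then 1 else 0)" using wp unfolding wp_def by simp
    moreover have "t \<le> g k * max 1 n ^ d"
    proof -
      have Z1: "1 \<le> (Z + 1) ^ d" "Z + 1 \<le> (Z + 1) ^ d"
        using d0 self_le_power[of "Z + 1" d] by auto
      have "3 * n + 5 \<le> 8 * (Z + 1) ^ d" using nZ Z1 by linarith
      then have "t \<le> w * (Z + 1) ^ d" using ex(2) unfolding w_def by (simp add: add_mult_distrib)
      also have "\<dots> \<le> w * ((B + B) * max 1 n) ^ d"
      proof (intro mult_le_mono2 power_mono)
        have "1 * 1 \<le> B * max 1 n" by (rule mult_le_mono) (use B1 in auto)
        then show "Z + 1 \<le> (B + B) * max 1 n" unfolding Z_def add_mult_distrib by linarith
      qed simp
      also have "\<dots> = (w * (B + B) ^ d) * max 1 n ^ d" by (simp add: power_mult_distrib)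
      \<comment> \<open>Four levels above \<open>B\<close>: one for the sum, two for the power and
        one for the product.\<close>
      also have "w * (B + B) ^ d \<le> g k"
      proof -
        have "B + B \<le> tower b (10 * R + 3)" unfolding B_def by (rule cl(1)[OF order_refl order_refl]) simp
        then have "(B + B) ^ d \<le> tower b (10 * R + 5)" by (rule cl(3)[OF _ bt[OF b4(5)]]) simp
        then have "w * (B + B) ^ d \<le> tower b (10 * R + 6)" by (rule cl(2)[OF bt[OF b4(4)]]) simp
        also have "\<dots> \<le> g k" unfolding g_def b_def[symmetric] by (rule tower_mono[OF Rb])
        finally show ?thesis .
      qed
      finally show ?thesis by (simp add: mult_le_mono1)
    qed
    ultimately show ?thesis using ex(1) by blast
  qed
  moreover have "computable g" unfolding g_def by (rule computable_tower)
  ultimately show ?thesis by blast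
qed

end
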